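(* Let $\gamma_1,\gamma_2\in(-1,-1/2)$ with $\gamma_1+\gamma_2>-3/2$, let $A\neq 0$ be a real constant, and let $$Z_{\gamma_1,\gamma_2}(1)=\frac{A}{2}\int_{\mathbb{R}^2}'\int_0^1\big[(s-x_1)_+^{\gamma_1}(s-x_2)_+^{\gamma_2}+(s-x_1)_+^{\gamma_2}(s-x_2)_+^{\gamma_1}\big]\,ds\;B(dx_1)B(dx_2)$$ be the double Wiener-Itô integral with respect to a Brownian random measure $B(\cdot)$ on $\mathbb{R}$. Then the second moment $\mu_2(\gamma_1,\gamma_2)=\mathbb{E}[Z_{\gamma_1,\gamma_2}(1)^2]$ is $$\mu_2(\gamma_1,\gamma_2)=\frac{A^2}{(\gamma_1+\gamma_2+2)(2(\gamma_1+\gamma_2)+3)}\Big[\mathrm{B}(\gamma_1+1,-\gamma_1-\gamma_2-1)\,\mathrm{B}(\gamma_2+1,-\gamma_1-\gamma_2-1)+\mathrm{B}(\gamma_1+1,-2\gamma_1-1)\,\mathrm{B}(\gamma_2+1,-2\gamma_2-1)\Big],$$ and the third moment $\mu_3(\gamma_1,\gamma_2)=\mathbb{E}[Z_{\gamma_1,\gamma_2}(1)^3]$ is $$\mu_3(\gamma_1,\gamma_2)=\frac{2A^3}{(\gamma_1+\gamma_2+2)(3(\gamma_1+\gamma_2)+5)}\sum_{\sigma\in\{1,2\}^3}\Big[\mathrm{B}(\gamma_{\sigma_1}+1,-\gamma_{\sigma_1}-\gamma_{\sigma_3'}-1)\,\mathrm{B}(\gamma_{\sigma_1'}+1,-\gamma_{\sigma_1'}-\gamma_{\sigma_2}-1)\,\mathrm{B}(\gamma_{\sigma_2'}+1,-\gamma_{\sigma_2'}-\gamma_{\sigma_3}-1)\,\mathrm{B}(\gamma_{\sigma_1'}+\gamma_{\sigma_2}+2,\gamma_{\sigma_2'}+\gamma_{\sigma_3}+2)\Big],$$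 where $\sigma=(\sigma_1,\sigma_2,\sigma_3)$ with $\sigma_i\in\{1,2\}$, and $\sigma_i'=3-\sigma_i$.
   Context: $\mathrm{B}(x,y)=\int_0^1u^{x-1}(1-u)^{y-1}\,du=\Gamma(x)\Gamma(y)/\Gamma(x+y)$ for $x,y>0$ is the beta function (not to be confused with the random measure $B(dx)$). For real $x$ and exponent $p$, $x_+^p=x^p$ if $x>0$ and $x_+^p=0$ otherwise. $B(\cdot)$ is a Brownian random measure on $\mathbb{R}$, i.e. a Gaussian random measure (white noise) with Lebesgue control measure. For $f\in L^2(\mathbb{R}^2)$, $\int_{\mathbb{R}^2}'f(x_1,x_2)\,B(dx_1)B(dx_2)$ is the double Wiener-Itô integral, the prime indicating exclusion of the diagonal $x_1=x_2$; the normalization is the usual one: the integral has mean $0$, and for symmetric $f$ its variance is $2\|f\|_{L^2(\mathbb{R}^2)}^2$. *)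

theory Defs
  imports "HOL-Probability.Probability"
begin

text \<open>Almost surely constant variables count as (degenerate) Gaussian variables. They have to be
  allowed: the random measure of a null set and the zero linear combination are of this kind.\<close>

definition gaussian_rv :: "'a measure \<Rightarrow> ('a \<Rightarrow> real) \<Rightarrow> bool" where
  "gaussian_rv M X \<longleftrightarrow> X \<in> borel_measurable M \<and>
     ((\<exists>m. AE \<omega> in M. X \<omega> = m) \<or>
      (\<exists>m s. s > 0 \<and> distributed M lborel X (normal_density m s)))"

definition gaussian_family :: "'a measure \<Rightarrow> 'i set \<Rightarrow> ('i \<Rightarrow> 'a \<Rightarrow> real) \<Rightarrow> bool" where
  "gaussian_family M I X \<longleftrightarrow>
     (\<forall>F c. finite F \<and> F \<subseteq> I \<longrightarrow> gaussian_rv M (\<lambda>\<omega>. \<Sum>i\<in>F. c i * X i \<omega>))"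

text \<open>A Gaussian random measure with Lebesgue control measure: a centred Gaussian family indexed by
  the Borel sets of finite Lebesgue measure whose covariance is the measure of the intersection.\<close>

locale brownian_random_measure = prob_space M for M :: "'a measure" +
  fixes W :: "real set \<Rightarrow> 'a \<Rightarrow> real"
  assumes gaussian: "gaussian_family M (fmeasurable lborel) W"
    and centred: "\<And>S. S \<in> fmeasurable lborel \<Longrightarrow> expectation (W S) = 0"
    and covariance: "\<And>S T. S \<in> fmeasurable lborel \<Longrightarrow> T \<in> fmeasurable lborel \<Longrightarrow>
      expectation (\<lambda>\<omega>. W S \<omega> * W T \<omega>) = measure lborel (S \<inter> T)"

text \<open>\<open>Y\<close> is the double integral of the off-diagonal step function \<open>g\<close>; since \<open>c i i = 0\<close> and the
  sets are disjoint, \<open>g\<close> vanishes on the diagonal.\<close>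

definition step_double_integral ::
    "(real set \<Rightarrow> 'a \<Rightarrow> real) \<Rightarrow> (real \<times> real \<Rightarrow> real) \<Rightarrow> ('a \<Rightarrow> real) \<Rightarrow> bool" where
  "step_double_integral W g Y \<longleftrightarrow>
     (\<exists>(n::nat) (S :: nat \<Rightarrow> real set) (c :: nat \<Rightarrow> nat \<Rightarrow> real).
        (\<forall>i<n. S i \<in> fmeasurable lborel) \<and> disjoint_family_on S {..<n} \<and> (\<forall>i<n. c i i = 0) \<and>
        g = (\<lambda>(x\<^sub>1, x\<^sub>2). \<Sum>i<n. \<Sum>j<n. c i j * indicator (S i) x\<^sub>1 * indicator (S j) x\<^sub>2) \<and>
        Y = (\<lambda>\<omega>. \<Sum>i<n. \<Sum>j<n. c i j * W (S i) \<omega> * W (S j) \<omega>))"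

text \<open>\<open>Z\<close> is a version of the double Wiener-Ito integral of \<open>f\<close>: the limit in \<open>L\<^sup>2(M)\<close> of the
  integrals of off-diagonal step functions converging to \<open>f\<close> in \<open>L\<^sup>2(\<real>\<^sup>2)\<close>. In particular \<open>f\<close> is
  square integrable. The distances are nonnegative Lebesgue integrals, so that convergence to \<open>0\<close>
  cannot hold merely because an integrand fails to be integrable.\<close>

definition has_double_wiener_ito_integral ::
    "'a measure \<Rightarrow> (real set \<Rightarrow> 'a \<Rightarrow> real) \<Rightarrow> (real \<times> real \<Rightarrow> real) \<Rightarrow> ('a \<Rightarrow> real) \<Rightarrow> bool" where
  "has_double_wiener_ito_integral M W f Z \<longleftrightarrow>
     f \<in> borel_measurable (lborel \<Otimes>\<^sub>M lborel) \<and> Z \<in> borel_measurable M \<and>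
     (\<exists>g Y. (\<forall>k. step_double_integral W (g k) (Y k)) \<and>
        (\<lambda>k::nat. \<integral>\<^sup>+x. ennreal ((g k x - f x)\<^sup>2) \<partial>(lborel \<Otimes>\<^sub>M lborel)) \<longlonglongrightarrow> 0 \<and>
        (\<lambda>k. \<integral>\<^sup>+\<omega>. ennreal ((Y k \<omega> - Z \<omega>)\<^sup>2) \<partial>M) \<longlonglongrightarrow> 0)"

text \<open>The integral is determined up to almost sure equality; a version is chosen.\<close>

definition double_wiener_ito_integral ::
    "'a measure \<Rightarrow> (real set \<Rightarrow> 'a \<Rightarrow> real) \<Rightarrow> (real \<times> real \<Rightarrow> real) \<Rightarrow> 'a \<Rightarrow> real" where
  "double_wiener_ito_integral M W f = (SOME Z. has_double_wiener_ito_integral M W f Z)"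

definition pos_powr :: "real \<Rightarrow> real \<Rightarrow> real" where
  "pos_powr x p = (if x > 0 then x powr p else 0)"

text \<open>On the diagonal, a null set, the integrand may fail to be integrable in \<open>s\<close>; the Bochner
  integral then gives the kernel the value \<open>0\<close>.\<close>

definition rosenblatt_kernel :: "real \<Rightarrow> real \<Rightarrow> real \<times> real \<Rightarrow> real" where
  "rosenblatt_kernel p q = (\<lambda>(x\<^sub>1, x\<^sub>2).
     \<integral>s\<in>{0..1}. (pos_powr (s - x\<^sub>1) p * pos_powr (s - x\<^sub>2) q
                 + pos_powr (s - x\<^sub>1) q * pos_powr (s - x\<^sub>2) p) \<partial>lborel)"

definition rosenblatt_at_1 ::
    "'a measure \<Rightarrow> (real set \<Rightarrow> 'a \<Rightarrow> real) \<Rightarrow> real \<Rightarrow> real \<Rightarrow> real \<Rightarrow> 'a \<Rightarrow> real" where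
  "rosenblatt_at_1 M W A p q =
     (\<lambda>\<omega>. A / 2 * double_wiener_ito_integral M W (rosenblatt_kernel p q) \<omega>)"

end

(*
  For an off-diagonal step function the double integral is a quadratic form, with zero diagonal, in
  independent centred normal variables. Adding one variable at a time shows that its second and
  third moments are 2 |f|^2 and 8 tr f^3, where f is the symmetrized step function viewed as an
  integral operator, and that its fourth moment is at most 27 times the square of the second. The
  last bound makes third moments continuous under L^2 limits, and tr f^3 is continuous in the
  Hilbert-Schmidt norm, so both formulas hold for every symmetric square integrable kernel.

  The Rosenblatt kernel is an integral over s of products of powers. By Tonelli the x-variables can
  be integrated out first, which leaves beta functions times powers of the differences of the
  s-variables; by symmetry these may be taken to be ordered, and their integral is a beta integral.
*)

theory Submission
  imports Defs "HOL-Real_Asymp.Real_Asymp"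
begin

section \<open>Joint characteristic functions and Gaussian moments\<close>

text \<open>A Gaussian family is given only through its finite linear combinations, so the
  independence of the values of \<open>W\<close> on disjoint sets has to be derived: the joint
  characteristic function factorizes, and Kac's criterion is reduced to uniqueness for one real
  variable by restricting to an event in one coordinate at a time. Additivity of \<open>W\<close>
  likewise comes from the covariances, and only almost surely, so identities between integrals of
  step functions hold up to null sets.

  Since \<open>double_wiener_ito_integral\<close> selects a version with \<open>SOME\<close>, moment
  formulas speak about it only once existence is known. This takes density of off-diagonal step
  functions and completeness; the difficulty is a rectangle that meets the diagonal, since it is not
  itself such a step function.

  On the analytic side everything is computed in \<open>ennreal\<close>: Tonelli then requires no
  finiteness, and the finite norm of the kernel is an outcome of the computation. The condition
  \<open>\<gamma> 1 + \<gamma> 2 > -3/2\<close> says exactly that |s - t| to the power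
  \<open>2 * (\<gamma> 1 + \<gamma> 2) + 2\<close> is integrable near the diagonal of the unit
  square of times.\<close>

lemma (in finite_measure) integral_indicator_of_char:
  fixes X h :: "'a \<Rightarrow> real" and w :: complex
  assumes [measurable]: "X \<in> borel_measurable M" "h \<in> borel_measurable M"
    and h: "\<And>x. 0 \<le> h x" "\<And>x. h x \<le> B"
    and \<nu>: "real_distribution \<nu>"
    and eq: "\<And>t. (CLINT x|M. iexp (t * X x) * h x) = char \<nu> t * w"
    and [measurable]: "A \<in> sets borel"
  shows "(CLINT x|M. indicator A (X x) * complex_of_real (h x)) = measure \<nu> A * w"
proof -
  interpret \<nu>: real_distribution \<nu> by fact
  have inth: "integrable M h"
    by (rule integrable_const_bound[where B=B]) (use h in auto)
  define K where "K = (LINT x|M. h x)"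
  have w: "w = K"
    using eq[of 0] by (simp add: \<nu>.char_zero K_def)
  have intA: "integrable M (\<lambda>x. indicator A (X x) * h x)"
    by (rule integrable_const_bound[where B=B]) (use h in \<open>auto simp: indicator_def intro: order_trans[OF h(1) h(2)]\<close>)
  have K0: "0 \<le> K" unfolding K_def using h by (intro integral_nonneg_AE) auto
  have "(LINT x|M. indicator A (X x) * h x) = measure \<nu> A * K"
  proof (cases "K = 0")
    case True
    then have "AE x in M. h x = 0"
      using inth h integral_nonneg_eq_0_iff_AE[of M h] by (auto simp: K_def)
    then have "(LINT x|M. indicator A (X x) * h x) = (LINT x|M. 0)"
      by (intro integral_cong_AE) auto
    then show ?thesis using True by simp
  next
    case False
    with K0 have K: "K > 0" by simp
    \<comment> \<open>Under the probability measure with density \<open>h / K\<close> the variable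
      \<open>X\<close> has the characteristic function of \<open>\<nu>\<close>, hence the law
      \<open>\<nu>\<close> by Levy's uniqueness theorem. The case \<open>K = 0\<close>, where no
      normalization is possible, forces \<open>h = 0\<close> almost everywhere.\<close>
    define D where "D = density M (\<lambda>x. ennreal (h x / K))"
    have "emeasure D (space D) = (\<integral>\<^sup>+x. ennreal (h x / K) \<partial>M)"
      unfolding D_def by (simp add: emeasure_density cong: nn_integral_cong)
    also have "\<dots> = ennreal (LINT x|M. h x / K)"
      using inth h K by (intro nn_integral_eq_integral) auto
    also have "\<dots> = 1" using K by (simp add: K_def[symmetric])
    finally have pD: "prob_space D" by (intro prob_spaceI)
    have mX: "X \<in> measurable D borel" unfolding D_def by simp
    define N where "N = distr D borel X"
    interpret D: prob_space D by fact
    have rN: "real_distribution N"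
      unfolding N_def using D.real_distribution_distr mX by simp
    have "char N t = char \<nu> t" for t
    proof -
      have "char N t = (CLINT x|D. iexp (t * X x))"
        unfolding char_def N_def using mX by (subst integral_distr) auto
      also have "\<dots> = (CLINT x|M. (h x / K) *\<^sub>R iexp (t * X x))"
        unfolding D_def using h K by (subst integral_density) auto
      also have "\<dots> = (CLINT x|M. (1/complex_of_real K) * (iexp (t * X x) * h x))"
        by (intro Bochner_Integration.integral_cong) (auto simp: scaleR_conv_of_real field_simps)
      also have "\<dots> = (1/complex_of_real K) * (CLINT x|M. iexp (t * X x) * h x)"
        by (rule integral_mult_right_zero)
      also have "\<dots> = char \<nu> t" using eq[of t] K w by simp
      finally show ?thesis .
    qed
    then have "N = \<nu>" using Levy_uniqueness[OF rN \<nu>] by auto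
    then have "measure \<nu> A = measure N A" by simp
    also have "\<dots> = (LINT x|N. indicator A x)"
      by (simp add: N_def)
    also have "\<dots> = (LINT x|D. indicator A (X x))"
      unfolding N_def using mX by (subst integral_distr) auto
    also have "\<dots> = (LINT x|M. (h x / K) *\<^sub>R indicator A (X x))"
      unfolding D_def using h K by (subst integral_density) auto
    also have "\<dots> = (LINT x|M. (1/K) * (indicator A (X x) * h x))"
      by (intro Bochner_Integration.integral_cong) (auto simp: field_simps)
    also have "\<dots> = (1/K) * (LINT x|M. indicator A (X x) * h x)"
      by (rule integral_mult_right_zero)
    finally show ?thesis using K by (simp add: field_simps)
  qed
  then have "complex_of_real (LINT x|M. indicator A (X x) * h x) = measure \<nu> A * w" by (simp add: w)
  moreover have "(CLINT x|M. indicator A (X x) * complex_of_real (h x)) = complex_of_real (LINT x|M. indicator A (X x) * h x)"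
    by (subst integral_complex_of_real[symmetric]) (auto intro!: Bochner_Integration.integral_cong simp: indicator_def)
  ultimately show ?thesis by simp
qed

lemma (in finite_measure) integrable_complex_bounded:
  fixes f :: "'a \<Rightarrow> complex"
  shows "f \<in> borel_measurable M \<Longrightarrow> (\<And>x. norm (f x) \<le> B) \<Longrightarrow> integrable M f"
  by (rule integrable_const_bound[where B=B]) auto

text \<open>Levy's theorem applies to nonnegative weights only, so the weight \<open>exp (i U)\<close> is split into
  \<open>1 + cos U\<close> and \<open>1 + sin U\<close>.\<close>

lemma (in finite_measure) integral_indicator_iexp_of_char:
  fixes X U :: "'a \<Rightarrow> real" and m z z' :: complex
  assumes [measurable]: "X \<in> borel_measurable M" "U \<in> borel_measurable M"
    and \<nu>: "real_distribution \<nu>"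
    and eq0: "\<And>t. (CLINT x|M. iexp (t * X x)) = char \<nu> t * m"
    and eq1: "\<And>t. (CLINT x|M. iexp (t * X x) * iexp (U x)) = char \<nu> t * z"
    and eq2: "\<And>t. (CLINT x|M. iexp (t * X x) * iexp (- U x)) = char \<nu> t * z'"
    and [measurable]: "A \<in> sets borel"
  shows "(CLINT x|M. indicator A (X x) * iexp (U x)) = measure \<nu> A * z"
proof -
  have c0: "0 \<le> 1 + cos r" "1 + cos r \<le> 2" "0 \<le> 1 + sin r" "1 + sin r \<le> 2" for r :: real
    using cos_ge_minus_one[of r] cos_le_one[of r] sin_ge_minus_one[of r] sin_le_one[of r] by linarith+
  have nc: "norm (cos (complex_of_real r)) \<le> 1" for r
    by (metis abs_cos_le_one cos_of_real norm_of_real)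
  have ns: "norm (sin (complex_of_real r)) \<le> 1" for r
    by (metis abs_sin_le_one sin_of_real norm_of_real)
  have ind: "norm (indicator A x :: complex) \<le> 1" for x by (auto simp: indicator_def)
  have cosE: "complex_of_real (cos r) = (iexp r + iexp (-r)) / 2" for r
    by (simp add: cos_of_real[symmetric] cos_exp_eq exp_minus)
  have sinE: "complex_of_real (sin r) = (iexp r - iexp (-r)) / (2*\<i>)" for r
    by (simp add: sin_of_real[symmetric] sin_exp_eq exp_minus)
  have i0: "integrable M (\<lambda>x. iexp (t * X x))" for t
    by (rule integrable_complex_bounded[where B=1]) auto
  have i1: "integrable M (\<lambda>x. iexp (t * X x) * iexp (U x))" for t
    by (rule integrable_complex_bounded[where B=1]) (auto simp: norm_mult)
  have i2: "integrable M (\<lambda>x. iexp (t * X x) * iexp (- U x))" for t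
    by (rule integrable_complex_bounded[where B=1]) (auto simp: norm_mult)
  have "(CLINT x|M. iexp (t * X x) * complex_of_real (1 + cos (U x))) = char \<nu> t * (m + (z + z')/2)" for t
  proof -
    have "(CLINT x|M. iexp (t * X x) * complex_of_real (1 + cos (U x))) =
      (CLINT x|M. iexp (t * X x) + (iexp (t * X x) * iexp (U x) + iexp (t * X x) * iexp (- U x))/2)"
      by (intro Bochner_Integration.integral_cong refl) (simp add: cosE field_simps)
    also have "\<dots> = char \<nu> t * (m + (z + z')/2)"
      using i0[of t] i1[of t] i2[of t]
      by (simp only: Bochner_Integration.integral_add Bochner_Integration.integrable_add integral_divide_zero integrable_divide_zero eq0 eq1 eq2)
        (simp add: field_simps)
    finally show ?thesis .
  qed
  then have c: "(CLINT x|M. indicator A (X x) * complex_of_real (1 + cos (U x))) = measure \<nu> A * (m + (z + z')/2)"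
    by (intro integral_indicator_of_char[OF _ _ _ _ \<nu>, where B=2]) (simp_all add: c0)
  have "(CLINT x|M. iexp (t * X x) * complex_of_real (1 + sin (U x))) = char \<nu> t * (m + (z - z')/(2*\<i>))" for t
  proof -
    have "(CLINT x|M. iexp (t * X x) * complex_of_real (1 + sin (U x))) =
      (CLINT x|M. iexp (t * X x) + (iexp (t * X x) * iexp (U x) - iexp (t * X x) * iexp (- U x))/(2*\<i>))"
      by (intro Bochner_Integration.integral_cong refl) (simp add: sinE field_simps)
    also have "\<dots> = char \<nu> t * (m + (z - z')/(2*\<i>))"
      using i0[of t] i1[of t] i2[of t]
      by (simp only: Bochner_Integration.integral_add Bochner_Integration.integral_diff Bochner_Integration.integrable_diff Bochner_Integration.integrable_add integral_divide_zero integrable_divide_zero eq0 eq1 eq2)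
        (simp add: field_simps)
    finally show ?thesis .
  qed
  then have s: "(CLINT x|M. indicator A (X x) * complex_of_real (1 + sin (U x))) = measure \<nu> A * (m + (z - z')/(2*\<i>))"
    by (intro integral_indicator_of_char[OF _ _ _ _ \<nu>, where B=2]) (simp_all add: c0)
  have "(CLINT x|M. iexp (t * X x) * complex_of_real 1) = char \<nu> t * m" for t
    using eq0 by simp
  then have "(CLINT x|M. indicator A (X x) * complex_of_real 1) = measure \<nu> A * m"
    by (intro integral_indicator_of_char[OF _ _ _ _ \<nu>, where B=1]) simp_all
  then have o: "(CLINT x|M. indicator A (X x)) = measure \<nu> A * m" by simp
  have j: "integrable M (\<lambda>x. indicator A (X x) :: complex)"
    by (rule integrable_complex_bounded[where B=1]) (auto simp: ind)
  have jc: "integrable M (\<lambda>x. indicator A (X x) * complex_of_real (1 + cos (U x)))"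
    by (rule integrable_complex_bounded[where B=2]) (auto simp: norm_mult indicator_def intro!: order_trans[OF norm_triangle_ineq] nc order_trans[OF add_left_mono[OF nc]])
  have js: "integrable M (\<lambda>x. indicator A (X x) * complex_of_real (1 + sin (U x)))"
    by (rule integrable_complex_bounded[where B=2]) (auto simp: norm_mult indicator_def intro!: order_trans[OF norm_triangle_ineq] ns order_trans[OF add_left_mono[OF ns]])
  \<comment> \<open>exp (i U) = (1 + cos U) + i (1 + sin U) - (1 + i). The last term is covered by
    the weight 1; the weights exp (i U) and exp (- i U) together separate cos U from sin U.\<close>
  have "(CLINT x|M. indicator A (X x) * iexp (U x)) =
    (CLINT x|M. indicator A (X x) * complex_of_real (1 + cos (U x))
      + \<i> * (indicator A (X x) * complex_of_real (1 + sin (U x))) - (1 + \<i>) * indicator A (X x))"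
    by (intro Bochner_Integration.integral_cong refl) (simp add: algebra_simps exp_Euler cos_of_real sin_of_real)
  also have "\<dots> = measure \<nu> A * (m + (z + z')/2) + \<i> * (measure \<nu> A * (m + (z - z')/(2*\<i>))) - (1 + \<i>) * (measure \<nu> A * m)"
    using j jc js by (subst Bochner_Integration.integral_diff Bochner_Integration.integral_add, simp, simp)+
      (simp only: integral_mult_right_zero c s o)
  also have "\<dots> = measure \<nu> A * z" by (simp add: field_simps)
  finally show ?thesis .
qed

text \<open>The induction generalizes the measure: the event that \<open>X j\<close> lies in
  \<open>A j\<close> is absorbed as an indicator density, which multiplies the mass by
  \<open>measure (\<nu> j) (A j)\<close> and keeps the factorization for the remaining coordinates.
  This is why \<open>M\<close> is an arbitrary finite measure; \<open>m\<close> is its total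
  mass.\<close>

lemma measure_of_joint_char:
  fixes X :: "'i \<Rightarrow> 'a \<Rightarrow> real"
  assumes "finite I" and "finite_measure M"
    and "\<And>i. i \<in> I \<Longrightarrow> X i \<in> borel_measurable M"
    and "\<And>i. i \<in> I \<Longrightarrow> real_distribution (\<nu> i)"
    and "\<And>c. (CLINT x|M. iexp (\<Sum>i\<in>I. c i * X i x)) = complex_of_real m * (\<Prod>i\<in>I. char (\<nu> i) (c i))"
    and "\<And>i. i \<in> I \<Longrightarrow> A i \<in> sets borel"
  shows "measure M {x\<in>space M. \<forall>i\<in>I. X i x \<in> A i} = m * (\<Prod>i\<in>I. measure (\<nu> i) (A i))"
  using assms
proof (induction I arbitrary: M m rule: finite_induct)
  case empty
  then interpret finite_measure M by simp
  have "complex_of_real (measure M (space M)) = complex_of_real m"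
    using empty(4)[of undefined] by (simp add: scaleR_conv_of_real)
  then show ?case by simp
next
  case (insert j I)
  interpret finite_measure M by fact
  have [measurable]: "X i \<in> borel_measurable M" if "i \<in> insert j I" for i
    using insert.prems(2) that by auto
  have [measurable]: "X j \<in> borel_measurable M" by simp
  have [measurable]: "A j \<in> sets borel" "\<And>i. i \<in> I \<Longrightarrow> A i \<in> sets borel" using insert.prems by auto
  have rj: "real_distribution (\<nu> j)" using insert.prems by auto
  have \<nu>0: "char (\<nu> i) 0 = 1" if "i \<in> insert j I" for i
    using insert.prems(3)[OF that] by (rule real_distribution.char_zero)
  have split: "(\<Sum>i\<in>insert j I. (c(j := t)) i * X i x) = t * X j x + (\<Sum>i\<in>I. c i * X i x)" for c t x
  proof -
    have "(\<Sum>i\<in>I. (c(j := t)) i * X i x) = (\<Sum>i\<in>I. c i * X i x)"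
      using insert.hyps by (intro sum.cong) auto
    then show ?thesis using insert.hyps by simp
  qed
  have splitp: "(\<Prod>i\<in>insert j I. char (\<nu> i) ((c(j := t)) i)) = char (\<nu> j) t * (\<Prod>i\<in>I. char (\<nu> i) (c i))" for c t
  proof -
    have "(\<Prod>i\<in>I. char (\<nu> i) ((c(j := t)) i)) = (\<Prod>i\<in>I. char (\<nu> i) (c i))"
      using insert.hyps by (intro prod.cong) auto
    then show ?thesis using insert.hyps by simp
  qed
  have eq: "(CLINT x|M. iexp (t * X j x) * iexp (\<Sum>i\<in>I. c i * X i x)) =
      char (\<nu> j) t * (complex_of_real m * (\<Prod>i\<in>I. char (\<nu> i) (c i)))" for c t
    using insert.prems(4)[of "c(j := t)"] unfolding split splitp
    by (simp add: exp_add distrib_left mult_ac)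
  define D where "D = density M (\<lambda>x. ennreal (indicator (A j) (X j x)))"
  have sD [simp]: "space D = space M" "sets D = sets M" by (simp_all add: D_def)
  have mD: "measure D S = measure M (S \<inter> {x\<in>space M. X j x \<in> A j})" if "S \<in> sets M" for S
  proof -
    have "emeasure D S = (\<integral>\<^sup>+x. indicator (S \<inter> {x\<in>space M. X j x \<in> A j}) x \<partial>M)"
      unfolding D_def using that
      by (subst emeasure_density, simp, simp, intro nn_integral_cong) (auto simp: indicator_def)
    then show ?thesis using that by (simp add: measure_def)
  qed
  have fD: "finite_measure D"
  proof (rule finite_measureI)
    have "emeasure D (space D) \<le> (\<integral>\<^sup>+x. 1 \<partial>M)"
      unfolding D_def by (subst emeasure_density, simp, simp, intro nn_integral_mono) (auto simp: indicator_def)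
    also have "\<dots> < \<infinity>" by (simp add: top.not_eq_extremum[symmetric])
    finally show "emeasure D (space D) \<noteq> \<infinity>" by simp
  qed
  have "(CLINT x|D. iexp (\<Sum>i\<in>I. c i * X i x)) =
      complex_of_real (m * measure (\<nu> j) (A j)) * (\<Prod>i\<in>I. char (\<nu> i) (c i))" for c
  proof -
    have "(CLINT x|D. iexp (\<Sum>i\<in>I. c i * X i x)) =
      (CLINT x|M. indicator (A j) (X j x) *\<^sub>R iexp (\<Sum>i\<in>I. c i * X i x))"
      unfolding D_def by (subst integral_density) auto
    also have "\<dots> = (CLINT x|M. indicator (A j) (X j x) * iexp (\<Sum>i\<in>I. c i * X i x))"
      by (intro Bochner_Integration.integral_cong) (auto simp: indicator_def)
    \<comment> \<open>Here U is the linear combination of the remaining coordinates; the conjugate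
      weight is obtained by negating all its coefficients.\<close>
    also have "\<dots> = measure (\<nu> j) (A j) * (complex_of_real m * (\<Prod>i\<in>I. char (\<nu> i) (c i)))"
    proof (rule integral_indicator_iexp_of_char[OF _ _ rj])
      show "(CLINT x|M. iexp (t * X j x)) = char (\<nu> j) t * complex_of_real m" for t
        using eq[of t "\<lambda>_. 0"] \<nu>0 by simp
      show "(CLINT x|M. iexp (t * X j x) * iexp (- (\<Sum>i\<in>I. c i * X i x))) =
        char (\<nu> j) t * (complex_of_real m * (\<Prod>i\<in>I. char (\<nu> i) (- c i)))" for t
        using eq[of t "\<lambda>i. - c i"] by (simp add: sum_negf)
    qed (use eq in auto)
    finally show ?thesis by (simp add: mult_ac)
  qed
  then have IH: "measure D {x\<in>space D. \<forall>i\<in>I. X i x \<in> A i} = m * measure (\<nu> j) (A j) * (\<Prod>i\<in>I. measure (\<nu> i) (A i))"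
    using insert.prems by (intro insert.IH[OF fD]) (auto simp: D_def)
  have "{x\<in>space M. \<forall>i\<in>insert j I. X i x \<in> A i} = {x\<in>space D. \<forall>i\<in>I. X i x \<in> A i} \<inter> {x\<in>space M. X j x \<in> A j}"
    by auto
  moreover have "{x\<in>space D. \<forall>i\<in>I. X i x \<in> A i} \<in> sets M"
    using insert.hyps by simp
  ultimately show ?case using mD IH insert.hyps by (simp add: mult_ac)
qed

text \<open>Kac's criterion. With mass 1 and the law of each variable as \<open>\<nu> i\<close>, the
  factorized characteristic function gives the product formula on all measurable rectangles, which
  is what independence of finitely many variables means.\<close>

theorem (in prob_space) indep_vars_of_joint_char:
  fixes X :: "'i \<Rightarrow> 'a \<Rightarrow> real"
  assumes I: "finite I" and X: "\<And>i. i \<in> I \<Longrightarrow> X i \<in> borel_measurable M"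
    and eq: "\<And>c. (CLINT x|M. iexp (\<Sum>i\<in>I. c i * X i x)) = (\<Prod>i\<in>I. char (distr M borel (X i)) (c i))"
  shows "indep_vars (\<lambda>_. borel) X I"
proof (cases "I = {}")
  case True
  then show ?thesis by (auto simp: indep_vars_def indep_sets_def)
next
  case False
  have eq': "measure M {x\<in>space M. \<forall>i\<in>I. X i x \<in> A i} = (\<Prod>i\<in>I. measure M (X i -` A i \<inter> space M))"
    if "\<And>i. i \<in> I \<Longrightarrow> A i \<in> sets borel" for A
  proof -
    have "measure M {x\<in>space M. \<forall>i\<in>I. X i x \<in> A i} = 1 * (\<Prod>i\<in>I. measure (distr M borel (X i)) (A i))"
      using I X eq that by (intro measure_of_joint_char) (auto intro: real_distribution_distr finite_measure_axioms)
    also have "\<dots> = (\<Prod>i\<in>I. measure M (X i -` A i \<inter> space M))"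
      using X that by (simp add: measure_distr)
    finally show ?thesis .
  qed
  have *: "(\<Inter>j\<in>I. X j -` A j \<inter> space M) = {x\<in>space M. \<forall>i\<in>I. X i x \<in> A i}" for A
    using False by auto
  have "\<forall>A\<in>(\<Pi> i\<in>I. sets borel). prob (\<Inter>j\<in>I. X j -` A j \<inter> space M) = (\<Prod>j\<in>I. prob (X j -` A j \<inter> space M))"
    unfolding * using eq' by (auto simp: Pi_iff)
  then show ?thesis
    using X by (subst indep_vars_finite[where E="\<lambda>_. sets borel", OF False I])
      (auto simp: sets.Int_stable sets.sigma_sets_eq[of borel, simplified])
qed

section \<open>Characteristic function and moments of a single centred Gaussian variable\<close>

lemma (in prob_space) char_centred_normal:
  assumes "distributed M lborel X (normal_density 0 s)" and s: "s > 0"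
  shows "char (distr M borel X) t = exp (- (s * t)\<^sup>2 / 2)"
proof -
  have [measurable]: "X \<in> borel_measurable M" using assms by (auto simp: distributed_def)
  have "distributed M lborel (\<lambda>x. 0 + (1/s) * X x) (normal_density (0 + (1/s) * 0) (\<bar>1/s\<bar> * s))"
    using assms by (intro normal_density_affine) auto
  then have d: "distributed M lborel (\<lambda>x. X x / s) std_normal_density"
    using s by simp
  have st: "s * t * (X x / s) = t * X x" for x using s by simp
  have "char (distr M borel X) t = (CLINT x|M. iexp (s * t * (X x / s)))"
    unfolding st by (simp add: char_def integral_distr mult.assoc)
  also have "\<dots> = char (distr M lborel (\<lambda>x. X x / s)) (s * t)"
    using s by (simp add: char_def integral_distr)
  also have "distr M lborel (\<lambda>x. X x / s) = std_normal_distribution"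
    using d by (simp add: distributed_def)
  finally show ?thesis by (simp add: char_std_normal_distribution)
qed

text \<open>A class closed under sums and products, so that every polynomial in Gaussian variables
  is integrable without an estimate of its own.\<close>

definition all_moments :: "'a measure \<Rightarrow> ('a \<Rightarrow> real) \<Rightarrow> bool" where
  "all_moments M X \<longleftrightarrow> X \<in> borel_measurable M \<and> (\<forall>k::nat. integrable M (\<lambda>x. X x ^ k))"

lemma all_moments_measurable[measurable_dest]: "all_moments M X \<Longrightarrow> X \<in> borel_measurable M"
  by (simp add: all_moments_def)

lemma all_moments_integrable: "all_moments M X \<Longrightarrow> integrable M X"
  by (auto simp: all_moments_def dest: spec[of _ 1])

lemma integrable_mult_of_squares:
  fixes f g :: "'a \<Rightarrow> real"
  assumes [measurable]: "f \<in> borel_measurable M" "g \<in> borel_measurable M"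
    and "integrable M (\<lambda>x. (f x)\<^sup>2)" "integrable M (\<lambda>x. (g x)\<^sup>2)"
  shows "integrable M (\<lambda>x. f x * g x)"
proof (rule Bochner_Integration.integrable_bound)
  show "integrable M (\<lambda>x. (f x)\<^sup>2 + (g x)\<^sup>2)" using assms by simp
  have "\<bar>a * b\<bar> \<le> a\<^sup>2 + b\<^sup>2" for a b :: real
    using sum_squares_bound[of "\<bar>a\<bar>" "\<bar>b\<bar>"] zero_le_power2[of a] zero_le_power2[of b]
    by (auto simp: abs_mult intro: order_trans[of _ "2 * \<bar>a\<bar> * \<bar>b\<bar>"])
  then show "AE x in M. norm (f x * g x) \<le> norm ((f x)\<^sup>2 + (g x)\<^sup>2)" by auto
qed auto

lemma all_moments_mult:
  assumes "all_moments M X" "all_moments M Y"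
  shows "all_moments M (\<lambda>x. X x * Y x)"
  unfolding all_moments_def
proof (intro conjI allI)
  show "integrable M (\<lambda>x. (X x * Y x) ^ k)" for k
    unfolding power_mult_distrib using assms
    by (intro integrable_mult_of_squares) (auto simp: all_moments_def power_mult[symmetric])
qed (use assms in \<open>auto simp: all_moments_def\<close>)

lemma all_moments_power: "all_moments M X \<Longrightarrow> all_moments M (\<lambda>x. X x ^ k)"
  by (auto simp: all_moments_def power_mult[symmetric])

lemma (in finite_measure) all_moments_const: "all_moments M (\<lambda>_. c)"
  by (simp add: all_moments_def)

lemma all_moments_add:
  assumes "all_moments M X" "all_moments M Y"
  shows "all_moments M (\<lambda>x. X x + Y x)"
  unfolding all_moments_def
proof (intro conjI allI)
  have "integrable M (\<lambda>x. X x ^ i * Y x ^ j)" for i j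
    by (intro all_moments_integrable all_moments_mult all_moments_power assms)
  then show "integrable M (\<lambda>x. (X x + Y x) ^ k)" for k
    by (simp add: binomial_ring mult.assoc)
qed (use assms in \<open>auto simp: all_moments_def\<close>)

lemma (in finite_measure) all_moments_cmult: "all_moments M X \<Longrightarrow> all_moments M (\<lambda>x. c * X x)"
  by (intro all_moments_mult all_moments_const)

lemma (in finite_measure) all_moments_sum:
  "(\<And>i. i \<in> I \<Longrightarrow> all_moments M (X i)) \<Longrightarrow> all_moments M (\<lambda>x. \<Sum>i\<in>I. X i x)"
  by (induction I rule: infinite_finite_induct) (auto intro: all_moments_add all_moments_const)

lemma all_moments_cong_AE:
  assumes "all_moments M X" "AE x in M. X x = Y x" "Y \<in> borel_measurable M"
  shows "all_moments M Y"
proof -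
  have "integrable M (\<lambda>x. Y x ^ k)" for k
    using assms by (subst integrable_cong_AE[of _ _ "\<lambda>x. X x ^ k"]) (auto simp: all_moments_def)
  then show ?thesis using assms by (simp add: all_moments_def)
qed

text \<open>One set of formulas covers both kinds of Gaussian variable: an almost surely constant
  variable with mean 0 is almost surely 0, and then \<open>v = 0\<close>.\<close>

lemma (in prob_space) centred_gaussian:
  assumes g: "gaussian_rv M X" and E: "expectation X = 0" and v: "expectation (\<lambda>x. (X x)\<^sup>2) = v"
  shows "char (distr M borel X) t = exp (- v * t\<^sup>2 / 2)" and "all_moments M X"
    and "expectation (\<lambda>x. X x ^ 3) = 0" and "expectation (\<lambda>x. X x ^ 4) = 3 * v\<^sup>2"
proof -
  have [measurable]: "X \<in> borel_measurable M" using g by (simp add: gaussian_rv_def)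
  consider (const) m where "AE x in M. X x = m" | (normal) m s where "s > 0" "distributed M lborel X (normal_density m s)"
    using g by (auto simp: gaussian_rv_def)
  then have "char (distr M borel X) t = exp (- v * t\<^sup>2 / 2) \<and> all_moments M X \<and>
    expectation (\<lambda>x. X x ^ 3) = 0 \<and> expectation (\<lambda>x. X x ^ 4) = 3 * v\<^sup>2"
  proof cases
    case const
    have "expectation X = (LINT x|M. m)" using const by (intro integral_cong_AE) auto
    then have m: "m = 0" using E by (simp add: prob_space)
    have p: "expectation (\<lambda>x. X x ^ k) = 0" if "k > 0" for k
    proof -
      have "expectation (\<lambda>x. X x ^ k) = (LINT x|M. 0)"
        using const m that by (intro integral_cong_AE) (auto elim!: eventually_mono)
      then show ?thesis by simp
    qed
    have v0: "v = 0" using p[of 2] v by simp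
    have "char (distr M borel X) t = (CLINT x|M. 1)"
      unfolding char_def using const m
      by (subst integral_distr, simp, simp, intro integral_cong_AE) (auto elim!: eventually_mono)
    moreover have "all_moments M X"
      using const m by (intro all_moments_cong_AE[OF all_moments_const[of 0]]) (auto elim!: eventually_mono)
    ultimately show ?thesis using v0 p by (simp add: prob_space)
  next
    case normal
    have i: "integrable M (\<lambda>x. f (X x)) \<longleftrightarrow> integrable lborel (\<lambda>x. normal_density m s x * f x)"
      if "f \<in> borel_measurable borel" for f :: "real \<Rightarrow> real"
      using distributed_integrable[OF normal(2), of f] that by simp
    have e: "(LINT x|M. f (X x)) = (LINT x|lborel. normal_density m s x * f x)"
      if "f \<in> borel_measurable borel" for f :: "real \<Rightarrow> real"
      using distributed_integral[OF normal(2), of f] that by simp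
    have "expectation X = m"
      using e[of "\<lambda>x. x"] integral_normal_moment_nz_1[of s m] normal(1) by simp
    then have m: "m = 0" using E by simp
    have am: "all_moments M X"
      unfolding all_moments_def using i[of "\<lambda>x. x ^ k" for k] integrable_normal_moment[of s 0] normal(1) m by simp
    have "s\<^sup>2 = v"
      using e[of "\<lambda>x. x\<^sup>2"] v normal(1) integral_normal_moment_even[of s 0 1] m by (simp add: fact_numeral)
    moreover have "expectation (\<lambda>x. X x ^ 3) = 0"
      using e[of "\<lambda>x. x^3"] normal(1) integral_normal_moment_odd[of s 0 1] m by simp
    moreover have "expectation (\<lambda>x. X x ^ 4) = 3 * (s\<^sup>2)\<^sup>2"
      using e[of "\<lambda>x. x^4"] normal(1) integral_normal_moment_even[of s 0 2] m
      by (simp add: fact_numeral power2_eq_square field_simps)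
    moreover have "char (distr M borel X) t = exp (- s\<^sup>2 * t\<^sup>2 / 2)"
      using char_centred_normal[of X s t] normal m by (simp add: power_mult_distrib)
    ultimately show ?thesis using am by simp
  qed
  then show "char (distr M borel X) t = exp (- v * t\<^sup>2 / 2)" and "all_moments M X"
    and "expectation (\<lambda>x. X x ^ 3) = 0" and "expectation (\<lambda>x. X x ^ 4) = 3 * v\<^sup>2" by auto
qed

section \<open>Quadratic forms in independent normal variables\<close>

lemma Cauchy_Schwarz_integral:
  fixes f g :: "'a \<Rightarrow> real"
  assumes [measurable]: "f \<in> borel_measurable M" "g \<in> borel_measurable M"
    and f: "integrable M (\<lambda>x. (f x)\<^sup>2)" and g: "integrable M (\<lambda>x. (g x)\<^sup>2)"
  shows "(LINT x|M. \<bar>f x * g x\<bar>)\<^sup>2 \<le> (LINT x|M. (f x)\<^sup>2) * (LINT x|M. (g x)\<^sup>2)"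
proof -
  have fg: "integrable M (\<lambda>x. \<bar>f x * g x\<bar>)"
    using integrable_mult_of_squares[OF assms] by (rule integrable_abs)
  have "(\<integral>\<^sup>+x. ennreal \<bar>f x\<bar> * ennreal \<bar>g x\<bar> \<partial>M)\<^sup>2 \<le>
      (\<integral>\<^sup>+x. (ennreal \<bar>f x\<bar>)\<^sup>2 \<partial>M) * (\<integral>\<^sup>+x. (ennreal \<bar>g x\<bar>)\<^sup>2 \<partial>M)"
    by (rule Cauchy_Schwarz_nn_integral) auto
  also have "(\<integral>\<^sup>+x. ennreal \<bar>f x\<bar> * ennreal \<bar>g x\<bar> \<partial>M) = ennreal (LINT x|M. \<bar>f x * g x\<bar>)"
    using fg by (subst nn_integral_eq_integral[symmetric]) (auto simp: ennreal_mult abs_mult)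
  also have "(\<integral>\<^sup>+x. (ennreal \<bar>f x\<bar>)\<^sup>2 \<partial>M) = ennreal (LINT x|M. (f x)\<^sup>2)"
    using f by (subst nn_integral_eq_integral[symmetric]) (auto simp: ennreal_power)
  also have "(\<integral>\<^sup>+x. (ennreal \<bar>g x\<bar>)\<^sup>2 \<partial>M) = ennreal (LINT x|M. (g x)\<^sup>2)"
    using g by (subst nn_integral_eq_integral[symmetric]) (auto simp: ennreal_power)
  finally show ?thesis
    by (simp add: ennreal_power flip: ennreal_mult)
qed

text \<open>What the moment computations use of normality: independence and the moments 0,
  \<open>v\<close>, 0, \<open>3 * v\<^sup>2\<close> of orders one to four. The value
  \<open>v i = 0\<close> occurs for null sets.\<close>

locale indep_normal_moments = prob_space +
  fixes X :: "'i \<Rightarrow> 'a \<Rightarrow> real" and v :: "'i \<Rightarrow> real" and I :: "'i set"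
  assumes indep: "indep_vars (\<lambda>_. borel) X I"
    and moments: "\<And>i. i \<in> I \<Longrightarrow> all_moments M (X i)"
    and moment1: "\<And>i. i \<in> I \<Longrightarrow> expectation (X i) = 0"
    and moment2: "\<And>i. i \<in> I \<Longrightarrow> expectation (\<lambda>\<omega>. X i \<omega> ^ 2) = v i"
    and moment3: "\<And>i. i \<in> I \<Longrightarrow> expectation (\<lambda>\<omega>. X i \<omega> ^ 3) = 0"
    and moment4: "\<And>i. i \<in> I \<Longrightarrow> expectation (\<lambda>\<omega>. X i \<omega> ^ 4) = 3 * (v i)\<^sup>2"
begin

text \<open>Factoring through the product space over \<open>J\<close> is the form in which grouping
  of independent variables applies: such a \<open>P\<close> is independent of every
  \<open>X n\<close> with \<open>n\<close> outside \<open>J\<close>.\<close>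

definition fun_of :: "'i set \<Rightarrow> ('a \<Rightarrow> real) \<Rightarrow> bool" where
  "fun_of J P \<longleftrightarrow> J \<subseteq> I \<and> all_moments M P \<and>
    (\<exists>F\<in>borel_measurable (PiM J (\<lambda>_. borel)). \<forall>\<omega>. P \<omega> = F (restrict (\<lambda>i. X i \<omega>) J))"

lemma fun_of_const: "J \<subseteq> I \<Longrightarrow> fun_of J (\<lambda>_. c)"
  by (auto simp: fun_of_def all_moments_const intro!: bexI[of _ "\<lambda>_. c"])

lemma fun_of_var: "J \<subseteq> I \<Longrightarrow> i \<in> J \<Longrightarrow> fun_of J (X i)"
  by (auto simp: fun_of_def moments subset_iff intro!: bexI[of _ "\<lambda>f. f i"])

lemma fun_of_add: "fun_of J P \<Longrightarrow> fun_of J R \<Longrightarrow> fun_of J (\<lambda>\<omega>. P \<omega> + R \<omega>)"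
  unfolding fun_of_def by (auto intro: all_moments_add intro!: bexI[of _ "\<lambda>x. F x + G x" for F G])

lemma fun_of_mult: "fun_of J P \<Longrightarrow> fun_of J R \<Longrightarrow> fun_of J (\<lambda>\<omega>. P \<omega> * R \<omega>)"
  unfolding fun_of_def by (auto intro: all_moments_mult intro!: bexI[of _ "\<lambda>x. F x * G x" for F G])

lemma fun_of_power: "fun_of J P \<Longrightarrow> fun_of J (\<lambda>\<omega>. P \<omega> ^ k)"
  unfolding fun_of_def by (auto intro: all_moments_power intro!: bexI[of _ "\<lambda>x. F x ^ k" for F])

lemma fun_of_sum:
  "J \<subseteq> I \<Longrightarrow> (\<And>i. i \<in> K \<Longrightarrow> fun_of J (P i)) \<Longrightarrow> fun_of J (\<lambda>\<omega>. \<Sum>i\<in>K. P i \<omega>)"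
  by (induction K rule: infinite_finite_induct) (auto intro: fun_of_const fun_of_add)

lemma fun_of_integrable: "fun_of J P \<Longrightarrow> integrable M P"
  by (auto simp: fun_of_def all_moments_integrable)

lemma expectation_fun_of_times_power:
  assumes P: "fun_of J P" and n: "n \<in> I" "n \<notin> J"
  shows "integrable M (\<lambda>\<omega>. P \<omega> * X n \<omega> ^ k)"
    and "expectation (\<lambda>\<omega>. P \<omega> * X n \<omega> ^ k) = expectation P * expectation (\<lambda>\<omega>. X n \<omega> ^ k)"
proof -
  obtain F where F: "F \<in> borel_measurable (PiM J (\<lambda>_. borel))" "P = (\<lambda>\<omega>. F (restrict (\<lambda>i. X i \<omega>) J))"
    and J: "J \<subseteq> I" using P by (auto simp: fun_of_def)
  have "indep_var borel (F \<circ> (\<lambda>\<omega>. restrict (\<lambda>i. X i \<omega>) J))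
      borel ((\<lambda>f. f n ^ k) \<circ> (\<lambda>\<omega>. restrict (\<lambda>i. X i \<omega>) {n}))"
    using n J F by (intro indep_var_compose[OF indep_var_restrict[OF indep]]) auto
  then have "indep_var borel P borel (\<lambda>\<omega>. X n \<omega> ^ k)"
    using F(2) by (simp add: comp_def)
  moreover have "integrable M P" using P by (rule fun_of_integrable)
  moreover have "integrable M (\<lambda>\<omega>. X n \<omega> ^ k)" using moments[OF n(1)] by (simp add: all_moments_def)
  ultimately show "integrable M (\<lambda>\<omega>. P \<omega> * X n \<omega> ^ k)"
    "expectation (\<lambda>\<omega>. P \<omega> * X n \<omega> ^ k) = expectation P * expectation (\<lambda>\<omega>. X n \<omega> ^ k)"
    by (auto intro: indep_var_integrable indep_var_lebesgue_integral)
qed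

text \<open>Integrates out one variable: the coefficients are independent of \<open>X n\<close>, the
  odd moments vanish, and the fourth moment contributes the factor \<open>3 * (v n)\<^sup>2\<close>.
  All inductions over the index set below rest on this identity; degree four is the highest power of
  \<open>X n\<close> that occurs.\<close>

lemma expectation_quartic:
  assumes "fun_of J P0" "fun_of J P1" "fun_of J P2" "fun_of J P3" "fun_of J P4" and n: "n \<in> I" "n \<notin> J"
  shows "expectation (\<lambda>\<omega>. P0 \<omega> + P1 \<omega> * X n \<omega> + P2 \<omega> * X n \<omega> ^ 2 + P3 \<omega> * X n \<omega> ^ 3 + P4 \<omega> * X n \<omega> ^ 4)
    = expectation P0 + v n * expectation P2 + 3 * (v n)\<^sup>2 * expectation P4"
proof -
  note * = expectation_fun_of_times_power[OF _ n]
  have 1: "integrable M (\<lambda>\<omega>. P1 \<omega> * X n \<omega>)" "expectation (\<lambda>\<omega>. P1 \<omega> * X n \<omega>) = 0"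
    using *[OF assms(2), of 1] moment1[OF n(1)] by auto
  show ?thesis
    using 1 *[OF assms(3), of 2] *[OF assms(4), of 3] *[OF assms(5), of 4]
      moment2[OF n(1)] moment3[OF n(1)] moment4[OF n(1)] fun_of_integrable[OF assms(1)]
    by simp
qed

section \<open>Moments of linear and off-diagonal quadratic forms\<close>

definition linear_form :: "('i \<Rightarrow> real) \<Rightarrow> 'i set \<Rightarrow> 'a \<Rightarrow> real" where
  "linear_form l J \<omega> = (\<Sum>i\<in>J. l i * X i \<omega>)"

definition quadratic_form :: "('i \<Rightarrow> 'i \<Rightarrow> real) \<Rightarrow> 'i set \<Rightarrow> 'a \<Rightarrow> real" where
  "quadratic_form c J \<omega> = (\<Sum>i\<in>J. \<Sum>j\<in>J. c i j * X i \<omega> * X j \<omega>)"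

lemma fun_of_linear_form: "J \<subseteq> I \<Longrightarrow> fun_of J (linear_form l J)"
  unfolding linear_form_def[abs_def] by (intro fun_of_sum fun_of_mult fun_of_const fun_of_var)

lemma fun_of_quadratic_form: "J \<subseteq> I \<Longrightarrow> fun_of J (quadratic_form c J)"
  unfolding quadratic_form_def[abs_def] by (intro fun_of_sum fun_of_mult fun_of_const fun_of_var)

lemmas fun_of_intros = fun_of_const fun_of_mult fun_of_add fun_of_power fun_of_linear_form fun_of_quadratic_form

lemma linear_form_insert:
  "finite J \<Longrightarrow> n \<notin> J \<Longrightarrow> linear_form l (insert n J) \<omega> = linear_form l J \<omega> + l n * X n \<omega>"
  by (simp add: linear_form_def)

text \<open>A zero diagonal makes the form affine in each variable; by symmetry the new row and the
  new column contribute the same linear form, whence the factor 2.\<close>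

lemma quadratic_form_insert:
  assumes "finite J" "n \<notin> J" "c n n = 0" "\<And>i j. c i j = c j i"
  shows "quadratic_form c (insert n J) \<omega> = quadratic_form c J \<omega> + 2 * linear_form (c n) J \<omega> * X n \<omega>"
proof -
  have 1: "(\<Sum>i\<in>J. c i n * X i \<omega> * X n \<omega>) = linear_form (c n) J \<omega> * X n \<omega>"
    unfolding linear_form_def sum_distrib_right by (intro sum.cong refl) (simp only: assms(4)[of _ n])
  have 2: "(\<Sum>j\<in>J. c n j * X n \<omega> * X j \<omega>) = linear_form (c n) J \<omega> * X n \<omega>"
    unfolding linear_form_def sum_distrib_right by (intro sum.cong refl) simp
  show ?thesis
    using assms(1-3) unfolding quadratic_form_def by (simp add: sum.distrib 1 2)
qed

lemma expectation_linear_form_mult: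
  assumes "finite J" "J \<subseteq> I"
  shows "expectation (\<lambda>\<omega>. linear_form l J \<omega> * linear_form l' J \<omega>) = (\<Sum>i\<in>J. l i * l' i * v i)"
  using assms
proof (induction J rule: finite_induct)
  case (insert n J)
  let ?L = "linear_form l J" and ?K = "linear_form l' J"
  have "expectation (\<lambda>\<omega>. linear_form l (insert n J) \<omega> * linear_form l' (insert n J) \<omega>) =
    expectation (\<lambda>\<omega>. ?L \<omega> * ?K \<omega> + (l' n * ?L \<omega> + l n * ?K \<omega>) * X n \<omega> + l n * l' n * X n \<omega> ^ 2
       + 0 * X n \<omega> ^ 3 + 0 * X n \<omega> ^ 4)"
    using insert by (intro Bochner_Integration.integral_cong) (auto simp: linear_form_insert algebra_simps power2_eq_square)
  also have "\<dots> = expectation (\<lambda>\<omega>. ?L \<omega> * ?K \<omega>) + v n * expectation (\<lambda>\<omega>. l n * l' n) + 3 * (v n)\<^sup>2 * expectation (\<lambda>_. 0)"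
    using insert by (intro expectation_quartic[where J=J] fun_of_intros) auto
  finally show ?case using insert by (simp add: prob_space mult_ac)
qed (simp add: linear_form_def)

text \<open>With S the variance so far, the recursion closes because 3 S^2 + 6 l^2 v S + 3 l^4 v^2 =
  3 (S + l^2 v)^2; the factor 3 in the fourth moment of the single variables is essential.\<close>

lemma expectation_linear_form_power4:
  assumes "finite J" "J \<subseteq> I"
  shows "expectation (\<lambda>\<omega>. linear_form l J \<omega> ^ 4) = 3 * (\<Sum>i\<in>J. (l i)\<^sup>2 * v i)\<^sup>2"
  using assms
proof (induction J rule: finite_induct)
  case (insert n J)
  let ?L = "linear_form l J"
  have "expectation (\<lambda>\<omega>. linear_form l (insert n J) \<omega> ^ 4) =
    expectation (\<lambda>\<omega>. ?L \<omega> ^ 4 + 4 * l n * ?L \<omega> ^ 3 * X n \<omega> + (6 * (l n)\<^sup>2) * (?L \<omega> * ?L \<omega>) * X n \<omega> ^ 2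
       + (4 * (l n) ^ 3 * ?L \<omega>) * X n \<omega> ^ 3 + (l n) ^ 4 * X n \<omega> ^ 4)"
    unfolding linear_form_insert[OF insert(1,2)]
    by (intro Bochner_Integration.integral_cong refl) algebra
  also have "\<dots> = expectation (\<lambda>\<omega>. ?L \<omega> ^ 4) + v n * expectation (\<lambda>\<omega>. (6 * (l n)\<^sup>2) * (?L \<omega> * ?L \<omega>)) + 3 * (v n)\<^sup>2 * expectation (\<lambda>_. (l n) ^ 4)"
    using insert by (intro expectation_quartic[where J=J] fun_of_intros) auto
  also have "expectation (\<lambda>\<omega>. (6 * (l n)\<^sup>2) * (?L \<omega> * ?L \<omega>)) = (6 * (l n)\<^sup>2) * (\<Sum>i\<in>J. (l i)\<^sup>2 * v i)"
    using insert by (subst integral_mult_right_zero) (simp add: expectation_linear_form_mult power2_eq_square)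
  finally show ?case using insert
    by (simp add: prob_space) (simp add: algebra_simps power2_eq_square power4_eq_xxxx)
qed (simp add: linear_form_def)

context
  fixes c :: "'i \<Rightarrow> 'i \<Rightarrow> real"
  assumes diag: "\<And>i. i \<in> I \<Longrightarrow> c i i = 0" and sym: "\<And>i j. c i j = c j i"
begin

lemma quadratic_form_insert_c:
  "finite J \<Longrightarrow> n \<notin> J \<Longrightarrow> insert n J \<subseteq> I \<Longrightarrow>
    quadratic_form c (insert n J) = (\<lambda>\<omega>. quadratic_form c J \<omega> + 2 * linear_form (c n) J \<omega> * X n \<omega>)"
  by (rule ext, rule quadratic_form_insert[OF _ _ diag sym]) simp_all

lemma expectation_quadratic_form:
  assumes "finite J" "J \<subseteq> I"
  shows "expectation (quadratic_form c J) = 0"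
  using assms
proof (induction J rule: finite_induct)
  case (insert n J)
  have "expectation (quadratic_form c (insert n J)) =
    expectation (\<lambda>\<omega>. quadratic_form c J \<omega> + 2 * linear_form (c n) J \<omega> * X n \<omega> + 0 * X n \<omega> ^ 2
       + 0 * X n \<omega> ^ 3 + 0 * X n \<omega> ^ 4)"
    unfolding quadratic_form_insert_c[OF insert(1,2) insert.prems] by simp
  also have "\<dots> = expectation (quadratic_form c J) + v n * expectation (\<lambda>_. 0) + 3 * (v n)\<^sup>2 * expectation (\<lambda>_. 0)"
    using insert by (intro expectation_quartic[where J=J] fun_of_intros) auto
  finally show ?case using insert by simp
qed (simp add: quadratic_form_def[abs_def])

lemma sum_insert_sym:
  fixes f :: "'i \<Rightarrow> 'i \<Rightarrow> real"
  assumes "finite J" "n \<notin> J" "f n n = 0" "\<And>i. f i n = f n i"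
  shows "(\<Sum>i\<in>insert n J. \<Sum>j\<in>insert n J. f i j) = (\<Sum>i\<in>J. \<Sum>j\<in>J. f i j) + 2 * (\<Sum>i\<in>J. f n i)"
proof -
  have "(\<Sum>i\<in>J. f i n) = (\<Sum>i\<in>J. f n i)" by (intro sum.cong refl assms(4))
  then show ?thesis using assms(1-3) by (simp add: sum.distrib)
qed

text \<open>Needed for the third moment: in the cube of the form extended by \<open>X n\<close>, the
  coefficient of \<open>X n ^ 2\<close> is 12 times the old form times the square of the linear form
  with coefficients \<open>c n\<close>.\<close>

lemma expectation_quadratic_form_linear_form_sq:
  assumes "finite J" "J \<subseteq> I"
  shows "expectation (\<lambda>\<omega>. quadratic_form c J \<omega> * (linear_form l J \<omega>)\<^sup>2) = 2 * (\<Sum>i\<in>J. \<Sum>j\<in>J. c i j * l i * l j * v i * v j)"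
  using assms
proof (induction J rule: finite_induct)
  case (insert n J)
  let ?L = "linear_form l J" and ?K = "linear_form (c n) J" and ?Q = "quadratic_form c J"
  have J: "finite J" "J \<subseteq> I" using insert by auto
  have "expectation (\<lambda>\<omega>. quadratic_form c (insert n J) \<omega> * (linear_form l (insert n J) \<omega>)\<^sup>2) =
    expectation (\<lambda>\<omega>. ?Q \<omega> * (?L \<omega>)\<^sup>2 + (2 * l n * (?Q \<omega> * ?L \<omega>) + 2 * (?K \<omega> * (?L \<omega>)\<^sup>2)) * X n \<omega>
        + ((l n)\<^sup>2 * ?Q \<omega> + 4 * l n * (?K \<omega> * ?L \<omega>)) * X n \<omega> ^ 2
       + (2 * (l n)\<^sup>2 * ?K \<omega>) * X n \<omega> ^ 3 + 0 * X n \<omega> ^ 4)"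
    unfolding quadratic_form_insert_c[OF insert(1,2) insert.prems] linear_form_insert[OF insert(1,2)]
    by (intro Bochner_Integration.integral_cong refl) algebra
  also have "\<dots> = expectation (\<lambda>\<omega>. ?Q \<omega> * (?L \<omega>)\<^sup>2) + v n * expectation (\<lambda>\<omega>. (l n)\<^sup>2 * ?Q \<omega> + 4 * l n * (?K \<omega> * ?L \<omega>)) + 3 * (v n)\<^sup>2 * expectation (\<lambda>_. 0)"
    using insert by (intro expectation_quartic[where J=J] fun_of_intros) auto
  also have "expectation (\<lambda>\<omega>. (l n)\<^sup>2 * ?Q \<omega> + 4 * l n * (?K \<omega> * ?L \<omega>)) = 4 * l n * (\<Sum>i\<in>J. c n i * l i * v i)"
    using J by (subst Bochner_Integration.integral_add)
      (auto intro!: fun_of_integrable[where J=J] fun_of_intros integrable_mult_right simp: expectation_linear_form_mult expectation_quadratic_form)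
  finally have E: "expectation (\<lambda>\<omega>. quadratic_form c (insert n J) \<omega> * (linear_form l (insert n J) \<omega>)\<^sup>2) =
      2 * (\<Sum>i\<in>J. \<Sum>j\<in>J. c i j * l i * l j * v i * v j) + 4 * (\<Sum>i\<in>J. c n i * l n * l i * v n * v i)"
    using insert.IH[OF J(2)] by (simp add: sum_distrib_left mult_ac)
  have S: "2 * (\<Sum>i\<in>insert n J. \<Sum>j\<in>insert n J. c i j * l i * l j * v i * v j) =
      2 * (\<Sum>i\<in>J. \<Sum>j\<in>J. c i j * l i * l j * v i * v j) + 4 * (\<Sum>i\<in>J. c n i * l n * l i * v n * v i)"
  proof (subst sum_insert_sym)
    show "c i n * l i * l n * v i * v n = c n i * l n * l i * v n * v i" for i
      unfolding sym[of i n] by simp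
  qed (use insert diag in auto)
  show ?case unfolding E S ..
qed (simp add: quadratic_form_def[abs_def])

lemma expectation_quadratic_form_sq:
  assumes "finite J" "J \<subseteq> I"
  shows "expectation (\<lambda>\<omega>. (quadratic_form c J \<omega>)\<^sup>2) = 2 * (\<Sum>i\<in>J. \<Sum>j\<in>J. (c i j)\<^sup>2 * v i * v j)"
  using assms
proof (induction J rule: finite_induct)
  case (insert n J)
  let ?K = "linear_form (c n) J" and ?Q = "quadratic_form c J"
  have J: "finite J" "J \<subseteq> I" using insert by auto
  have "expectation (\<lambda>\<omega>. (quadratic_form c (insert n J) \<omega>)\<^sup>2) =
    expectation (\<lambda>\<omega>. (?Q \<omega>)\<^sup>2 + (4 * (?Q \<omega> * ?K \<omega>)) * X n \<omega>
        + (4 * (?K \<omega> * ?K \<omega>)) * X n \<omega> ^ 2 + 0 * X n \<omega> ^ 3 + 0 * X n \<omega> ^ 4)"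
    unfolding quadratic_form_insert_c[OF insert(1,2) insert.prems]
    by (intro Bochner_Integration.integral_cong refl) algebra
  also have "\<dots> = expectation (\<lambda>\<omega>. (?Q \<omega>)\<^sup>2) + v n * expectation (\<lambda>\<omega>. 4 * (?K \<omega> * ?K \<omega>)) + 3 * (v n)\<^sup>2 * expectation (\<lambda>_. 0)"
    using insert by (intro expectation_quartic[where J=J] fun_of_intros) auto
  also have "expectation (\<lambda>\<omega>. 4 * (?K \<omega> * ?K \<omega>)) = 4 * (\<Sum>i\<in>J. c n i * c n i * v i)"
    using J by (simp add: expectation_linear_form_mult)
  finally have E: "expectation (\<lambda>\<omega>. (quadratic_form c (insert n J) \<omega>)\<^sup>2) =
      2 * (\<Sum>i\<in>J. \<Sum>j\<in>J. (c i j)\<^sup>2 * v i * v j) + 4 * (\<Sum>i\<in>J. (c n i)\<^sup>2 * v n * v i)"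
    using insert.IH[OF J(2)] by (simp add: sum_distrib_left power2_eq_square mult_ac)
  have S: "2 * (\<Sum>i\<in>insert n J. \<Sum>j\<in>insert n J. (c i j)\<^sup>2 * v i * v j) =
      2 * (\<Sum>i\<in>J. \<Sum>j\<in>J. (c i j)\<^sup>2 * v i * v j) + 4 * (\<Sum>i\<in>J. (c n i)\<^sup>2 * v n * v i)"
  proof (subst sum_insert_sym)
    show "(c i n)\<^sup>2 * v i * v n = (c n i)\<^sup>2 * v n * v i" for i
      unfolding sym[of i n] by simp
  qed (use insert diag in auto)
  show ?case unfolding E S ..
qed (simp add: quadratic_form_def[abs_def])

text \<open>The triple sum runs over closed triangles. A new index \<open>n\<close> can occupy any
  one of the three corners, but not two of them, because adjacent corners would produce
  \<open>c n n = 0\<close>. So the sum grows by 3 equal terms with weight 8, which matches the 12 *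
  2 from the square of the linear form.\<close>

lemma expectation_quadratic_form_cube:
  assumes "finite J" "J \<subseteq> I"
  shows "expectation (\<lambda>\<omega>. (quadratic_form c J \<omega>) ^ 3) = 8 * (\<Sum>i\<in>J. \<Sum>j\<in>J. \<Sum>k\<in>J. c i j * c j k * c k i * v i * v j * v k)"
  using assms
proof (induction J rule: finite_induct)
  case (insert n J)
  let ?K = "linear_form (c n) J" and ?Q = "quadratic_form c J"
  let ?f = "\<lambda>i j k. c i j * c j k * c k i * v i * v j * v k"
  have J: "finite J" "J \<subseteq> I" and n: "n \<in> I" using insert by auto
  have "expectation (\<lambda>\<omega>. (quadratic_form c (insert n J) \<omega>) ^ 3) =
    expectation (\<lambda>\<omega>. (?Q \<omega>) ^ 3 + (6 * ((?Q \<omega>)\<^sup>2 * ?K \<omega>)) * X n \<omega>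
        + (12 * (?Q \<omega> * (?K \<omega>)\<^sup>2)) * X n \<omega> ^ 2 + (8 * (?K \<omega>) ^ 3) * X n \<omega> ^ 3 + 0 * X n \<omega> ^ 4)"
    unfolding quadratic_form_insert_c[OF insert(1,2) insert.prems]
    by (intro Bochner_Integration.integral_cong refl) algebra
  also have "\<dots> = expectation (\<lambda>\<omega>. (?Q \<omega>) ^ 3) + v n * expectation (\<lambda>\<omega>. 12 * (?Q \<omega> * (?K \<omega>)\<^sup>2)) + 3 * (v n)\<^sup>2 * expectation (\<lambda>_. 0)"
    using insert by (intro expectation_quartic[where J=J] fun_of_intros) auto
  also have "expectation (\<lambda>\<omega>. 12 * (?Q \<omega> * (?K \<omega>)\<^sup>2)) = 24 * (\<Sum>i\<in>J. \<Sum>j\<in>J. c i j * c n i * c n j * v i * v j)"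
    using J by (simp add: expectation_quadratic_form_linear_form_sq)
  finally have *: "expectation (\<lambda>\<omega>. (quadratic_form c (insert n J) \<omega>) ^ 3) =
    8 * (\<Sum>i\<in>J. \<Sum>j\<in>J. \<Sum>k\<in>J. ?f i j k) + 24 * v n * (\<Sum>i\<in>J. \<Sum>j\<in>J. c i j * c n i * c n j * v i * v j)"
    using insert by simp
  \<comment> \<open>By symmetry of \<open>c\<close> the weight of a triangle does not depend on
    which corner carries \<open>n\<close>.\<close>
  have r: "?f n i j = v n * (c i j * c n i * c n j * v i * v j)" "?f i n j = v n * (c i j * c n i * c n j * v i * v j)"
    "?f i j n = v n * (c i j * c n i * c n j * v i * v j)" for i j
    using sym[of i n] sym[of j n] sym[of i j] by auto
  have "(\<Sum>i\<in>insert n J. \<Sum>j\<in>insert n J. \<Sum>k\<in>insert n J. ?f i j k) =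
    (\<Sum>j\<in>J. \<Sum>k\<in>J. ?f n j k) + (\<Sum>i\<in>J. \<Sum>k\<in>J. ?f i n k) + (\<Sum>i\<in>J. \<Sum>j\<in>J. ?f i j n) + (\<Sum>i\<in>J. \<Sum>j\<in>J. \<Sum>k\<in>J. ?f i j k)"
    using insert.hyps by (simp add: sum.distrib diag[OF n])
  also have "\<dots> = 3 * v n * (\<Sum>i\<in>J. \<Sum>j\<in>J. c i j * c n i * c n j * v i * v j) + (\<Sum>i\<in>J. \<Sum>j\<in>J. \<Sum>k\<in>J. ?f i j k)"
    unfolding r sum_distrib_left[symmetric] by (simp add: algebra_simps)
  finally show ?case unfolding * by simp
qed (simp add: quadratic_form_def[abs_def])

text \<open>The constant \<open>K = 27\<close> solves \<open>6 * sqrt (3 * K) = 2 * K\<close>, which is what the Cauchy-Schwarz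
  estimate of the cross term requires for the induction to close.\<close>

lemma expectation_quadratic_form_power4:
  assumes "finite J" "J \<subseteq> I" and v: "\<And>i. i \<in> I \<Longrightarrow> 0 \<le> v i"
  shows "expectation (\<lambda>\<omega>. (quadratic_form c J \<omega>) ^ 4) \<le> 27 * (expectation (\<lambda>\<omega>. (quadratic_form c J \<omega>)\<^sup>2))\<^sup>2"
  using assms(1,2)
proof (induction J rule: finite_induct)
  case (insert n J)
  let ?K = "linear_form (c n) J" and ?Q = "quadratic_form c J"
  have J: "finite J" "J \<subseteq> I" and n: "n \<in> I" using insert by auto
  define k where "k = (\<Sum>i\<in>J. (c n i)\<^sup>2 * v i)"
  define a where "a = expectation (\<lambda>\<omega>. (?Q \<omega>)\<^sup>2)"
  have k0: "0 \<le> k" unfolding k_def using v J by (intro sum_nonneg mult_nonneg_nonneg) auto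
  have a0: "0 \<le> a" unfolding a_def by (intro integral_nonneg_AE) auto
  have "expectation (\<lambda>\<omega>. (quadratic_form c (insert n J) \<omega>)\<^sup>2) = 2 * (\<Sum>i\<in>insert n J. \<Sum>j\<in>insert n J. (c i j)\<^sup>2 * v i * v j)"
    using insert by (intro expectation_quadratic_form_sq) auto
  also have "\<dots> = 2 * (\<Sum>i\<in>J. \<Sum>j\<in>J. (c i j)\<^sup>2 * v i * v j) + 4 * (\<Sum>i\<in>J. (c n i)\<^sup>2 * v n * v i)"
  proof (subst sum_insert_sym)
    show "(c i n)\<^sup>2 * v i * v n = (c n i)\<^sup>2 * v n * v i" for i
      unfolding sym[of i n] by simp
  qed (use insert diag in auto)
  also have "\<dots> = a + 4 * v n * k"
    using J by (simp add: a_def expectation_quadratic_form_sq k_def sum_distrib_left mult_ac)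
  finally have sq: "expectation (\<lambda>\<omega>. (quadratic_form c (insert n J) \<omega>)\<^sup>2) = a + 4 * v n * k" .
  have "expectation (\<lambda>\<omega>. (quadratic_form c (insert n J) \<omega>) ^ 4) =
    expectation (\<lambda>\<omega>. (?Q \<omega>) ^ 4 + (8 * ((?Q \<omega>) ^ 3 * ?K \<omega>)) * X n \<omega>
        + (24 * ((?Q \<omega>)\<^sup>2 * (?K \<omega>)\<^sup>2)) * X n \<omega> ^ 2 + (32 * (?Q \<omega> * (?K \<omega>) ^ 3)) * X n \<omega> ^ 3 + (16 * (?K \<omega>) ^ 4) * X n \<omega> ^ 4)"
    unfolding quadratic_form_insert_c[OF insert(1,2) insert.prems]
    by (intro Bochner_Integration.integral_cong refl) algebra
  also have "\<dots> = expectation (\<lambda>\<omega>. (?Q \<omega>) ^ 4) + v n * expectation (\<lambda>\<omega>. 24 * ((?Q \<omega>)\<^sup>2 * (?K \<omega>)\<^sup>2)) + 3 * (v n)\<^sup>2 * expectation (\<lambda>\<omega>. 16 * (?K \<omega>) ^ 4)"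
    using insert by (intro expectation_quartic[where J=J] fun_of_intros) auto
  also have "\<dots> = expectation (\<lambda>\<omega>. (?Q \<omega>) ^ 4) + 24 * v n * expectation (\<lambda>\<omega>. (?Q \<omega>)\<^sup>2 * (?K \<omega>)\<^sup>2) + 144 * (v n)\<^sup>2 * k\<^sup>2"
    using J by (simp add: expectation_linear_form_power4 k_def)
  finally have *: "expectation (\<lambda>\<omega>. (quadratic_form c (insert n J) \<omega>) ^ 4) = \<dots>" .
  have amQ: "all_moments M ?Q" and amK: "all_moments M ?K"
    using fun_of_quadratic_form[OF J(2)] fun_of_linear_form[OF J(2)] by (auto simp: fun_of_def)
  have "(expectation (\<lambda>\<omega>. \<bar>(?Q \<omega>)\<^sup>2 * (?K \<omega>)\<^sup>2\<bar>))\<^sup>2 \<le> expectation (\<lambda>\<omega>. ((?Q \<omega>)\<^sup>2)\<^sup>2) * expectation (\<lambda>\<omega>. ((?K \<omega>)\<^sup>2)\<^sup>2)"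
    using amQ amK by (intro Cauchy_Schwarz_integral) (auto simp: all_moments_def power_mult[symmetric])
  also have "\<dots> = expectation (\<lambda>\<omega>. (?Q \<omega>) ^ 4) * expectation (\<lambda>\<omega>. (?K \<omega>) ^ 4)"
    by (simp flip: power_mult)
  \<comment> \<open>The induction hypothesis bounds the quadratic form, while the fourth moment of
    the linear form is known exactly; the product 81 a^2 k^2 is the square of 9 a k.\<close>
  also have "\<dots> \<le> (27 * a\<^sup>2) * (3 * k\<^sup>2)"
    using insert.IH J by (intro mult_mono) (auto simp: a_def expectation_linear_form_power4 k_def intro!: integral_nonneg_AE)
  also have "\<dots> = (9 * a * k)\<^sup>2" by (simp add: power_mult_distrib)
  finally have "expectation (\<lambda>\<omega>. \<bar>(?Q \<omega>)\<^sup>2 * (?K \<omega>)\<^sup>2\<bar>) \<le> 9 * a * k"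
    using a0 k0 by (rule_tac power2_le_imp_le) auto
  then have "24 * v n * expectation (\<lambda>\<omega>. (?Q \<omega>)\<^sup>2 * (?K \<omega>)\<^sup>2) \<le> 24 * v n * (9 * a * k)"
    using v[OF n] by (intro mult_left_mono) auto
  moreover have "expectation (\<lambda>\<omega>. (?Q \<omega>) ^ 4) \<le> 27 * a\<^sup>2"
    using insert.IH J by (simp add: a_def)
  ultimately have "expectation (\<lambda>\<omega>. (quadratic_form c (insert n J) \<omega>) ^ 4) \<le> 27 * a\<^sup>2 + 24 * v n * (9 * a * k) + 144 * (v n)\<^sup>2 * k\<^sup>2"
    unfolding * by linarith
  \<comment> \<open>The cross terms agree exactly, 24 * 9 = 27 * 2 * 4 = 216; in the last terms 144
    is at most 27 * 16 = 432.\<close>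
  also have "\<dots> \<le> 27 * (a + 4 * v n * k)\<^sup>2"
    using zero_le_power2[of "v n * k"] by (simp add: power2_eq_square algebra_simps)
  finally show ?case unfolding sq .
qed (simp add: quadratic_form_def[abs_def])

end
end

section \<open>Random measures and step functions\<close>

context brownian_random_measure
begin

text \<open>\<open>gaussian_family\<close> speaks of sums over distinct members of the index set,
  here distinct Borel sets, whereas \<open>S\<close> may repeat a value. The coefficients of equal
  sets are therefore collected into \<open>d\<close>.\<close>

lemma gaussian_rv_sum:
  assumes "finite I" "\<And>i. i \<in> I \<Longrightarrow> S i \<in> fmeasurable lborel"
  shows "gaussian_rv M (\<lambda>\<omega>. \<Sum>i\<in>I. c i * W (S i) \<omega>)"
proof -
  define d where "d T = (\<Sum>i\<in>{i\<in>I. S i = T}. c i)" for T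
  have "(\<Sum>i\<in>I. c i * W (S i) \<omega>) = (\<Sum>T\<in>S ` I. d T * W T \<omega>)" for \<omega>
  proof -
    have "(\<Sum>i\<in>I. c i * W (S i) \<omega>) = (\<Sum>T\<in>S ` I. \<Sum>i\<in>{i\<in>I. S i = T}. c i * W (S i) \<omega>)"
      using assms(1) by (rule sum.image_gen)
    also have "\<dots> = (\<Sum>T\<in>S ` I. d T * W T \<omega>)"
      unfolding d_def sum_distrib_right by (intro sum.cong) auto
    finally show ?thesis .
  qed
  moreover have "gaussian_rv M (\<lambda>\<omega>. \<Sum>T\<in>S ` I. d T * W T \<omega>)"
    using gaussian assms unfolding gaussian_family_def by blast
  ultimately show ?thesis by simp
qed

lemma gaussian_rv_W: "S \<in> fmeasurable lborel \<Longrightarrow> gaussian_rv M (W S)"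
  using gaussian_rv_sum[of "{()}" "\<lambda>_. S" "\<lambda>_. 1"] by simp

lemma expectation_W_sq:
  "S \<in> fmeasurable lborel \<Longrightarrow> expectation (\<lambda>\<omega>. (W S \<omega>)\<^sup>2) = measure lborel S"
  using covariance[of S S] by (simp add: power2_eq_square)

lemma all_moments_W: "S \<in> fmeasurable lborel \<Longrightarrow> all_moments M (W S)"
  using centred_gaussian(2)[OF gaussian_rv_W centred refl] .

lemma integrable_W_mult:
  "S \<in> fmeasurable lborel \<Longrightarrow> T \<in> fmeasurable lborel \<Longrightarrow> integrable M (\<lambda>\<omega>. W S \<omega> * W T \<omega>)"
  by (intro all_moments_integrable all_moments_mult all_moments_W)

lemma expectation_sum_W_sq:
  assumes "finite I" "\<And>i. i \<in> I \<Longrightarrow> S i \<in> fmeasurable lborel"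
  shows "expectation (\<lambda>\<omega>. (\<Sum>i\<in>I. c i * W (S i) \<omega>)\<^sup>2) = (\<Sum>i\<in>I. \<Sum>j\<in>I. c i * c j * measure lborel (S i \<inter> S j))"
proof -
  have "expectation (\<lambda>\<omega>. (\<Sum>i\<in>I. c i * W (S i) \<omega>)\<^sup>2) =
    expectation (\<lambda>\<omega>. \<Sum>i\<in>I. \<Sum>j\<in>I. c i * c j * (W (S i) \<omega> * W (S j) \<omega>))"
    by (simp add: power2_eq_square sum_product mult_ac)
  also have "\<dots> = (\<Sum>i\<in>I. \<Sum>j\<in>I. c i * c j * expectation (\<lambda>\<omega>. W (S i) \<omega> * W (S j) \<omega>))"
    using assms by (simp add: integrable_W_mult)
  also have "\<dots> = (\<Sum>i\<in>I. \<Sum>j\<in>I. c i * c j * measure lborel (S i \<inter> S j))"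
    using assms by (simp add: covariance)
  finally show ?thesis .
qed

lemma expectation_sum_W:
  assumes "finite I" "\<And>i. i \<in> I \<Longrightarrow> S i \<in> fmeasurable lborel"
  shows "expectation (\<lambda>\<omega>. \<Sum>i\<in>I. c i * W (S i) \<omega>) = 0"
  using assms by (simp add: all_moments_integrable all_moments_W centred)

lemma measure_Int_disjoint_family:
  assumes "disjoint_family_on S I" "finite I" "i \<in> I"
  shows "(\<Sum>j\<in>I. c j * measure lborel (S i \<inter> S j)) = c i * measure lborel (S i)"
proof -
  have "(\<Sum>j\<in>I. c j * measure lborel (S i \<inter> S j)) = (\<Sum>j\<in>{i}. c j * measure lborel (S i \<inter> S j))"
    using assms by (intro sum.mono_neutral_right) (auto simp: disjoint_family_on_def)
  then show ?thesis by simp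
qed

text \<open>Additivity is a consequence of the covariance: the second moment of the difference is
  computed from the measures of intersections and vanishes, so the difference is almost surely
  0.\<close>

lemma W_UN_disjoint:
  fixes S :: "'i \<Rightarrow> real set"
  assumes I: "finite I" and S: "\<And>i. i \<in> I \<Longrightarrow> S i \<in> fmeasurable lborel" and dis: "disjoint_family_on S I"
    and U: "U = (\<Union>i\<in>I. S i)"
  shows "AE \<omega> in M. W U \<omega> = (\<Sum>i\<in>I. W (S i) \<omega>)"
proof -
  have hU: "U \<in> fmeasurable lborel" unfolding U using I S by (intro fmeasurable.finite_UN) auto
  \<comment> \<open>The index \<open>None\<close> carries the union with coefficient -1, so that the
    difference becomes one linear combination to which the second moment formula applies.\<close>
  define S' where "S' = case_option U S"
  define c :: "'i option \<Rightarrow> real" where "c = case_option (-1) (\<lambda>_. 1)"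
  have S': "S' i \<in> fmeasurable lborel" if "i \<in> insert None (Some ` I)" for i
    using that S hU by (auto simp: S'_def)
  have sum: "(\<Sum>i\<in>insert None (Some ` I). c i * f (S' i)) = (\<Sum>i\<in>I. f (S i)) - f U" for f
    using I by (simp add: sum.reindex S'_def c_def)
  have mU: "measure lborel U = (\<Sum>i\<in>I. measure lborel (S i))"
    unfolding U using I S dis
    by (intro measure_finite_Union) (auto simp: fmeasurable_def less_top)
  have US: "U \<inter> S i = S i" "S i \<inter> U = S i" if "i \<in> I" for i using that U by auto
  have eq: "(\<Sum>i\<in>I. \<Sum>j\<in>I. measure lborel (S i \<inter> S j)) = measure lborel U"
    using measure_Int_disjoint_family[OF dis I, of _ "\<lambda>_. 1"] mU by simp
  have dd: "(\<Sum>i\<in>insert None (Some ` I). \<Sum>j\<in>insert None (Some ` I). c i * c j * measure lborel (S' i \<inter> S' j)) =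
    (\<Sum>i\<in>insert None (Some ` I). c i * (\<Sum>j\<in>insert None (Some ` I). c j * measure lborel (S' i \<inter> S' j)))"
    by (simp add: sum_distrib_left mult_ac)
  have "expectation (\<lambda>\<omega>. (\<Sum>i\<in>insert None (Some ` I). c i * W (S' i) \<omega>)\<^sup>2) =
    (\<Sum>i\<in>insert None (Some ` I). c i * (\<Sum>j\<in>insert None (Some ` I). c j * measure lborel (S' i \<inter> S' j)))"
    unfolding dd[symmetric] using I S' by (intro expectation_sum_W_sq) auto
  also have "\<dots> = 0"
    by (subst sum[of "\<lambda>T. measure lborel (_ \<inter> T)"],
        subst sum[of "\<lambda>T. (\<Sum>i\<in>I. measure lborel (T \<inter> S i)) - measure lborel (T \<inter> U)"])
      (simp add: sum_subtractf eq US mU)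
  finally have "expectation (\<lambda>\<omega>. (\<Sum>i\<in>insert None (Some ` I). c i * W (S' i) \<omega>)\<^sup>2) = 0" .
  then have "expectation (\<lambda>\<omega>. ((\<Sum>i\<in>I. W (S i) \<omega>) - W U \<omega>)\<^sup>2) = 0"
    by (simp only: sum[of "\<lambda>T. W T \<omega>" for \<omega>])
  moreover have "all_moments M (\<lambda>\<omega>. (\<Sum>i\<in>I. W (S i) \<omega>) + (-1) * W U \<omega>)"
    using S hU by (intro all_moments_add all_moments_sum all_moments_cmult all_moments_W) auto
  ultimately have "AE \<omega> in M. ((\<Sum>i\<in>I. W (S i) \<omega>) - W U \<omega>)\<^sup>2 = 0"
    by (subst integral_nonneg_eq_0_iff_AE[symmetric]) (auto simp: all_moments_def)
  then show ?thesis by eventually_elim simp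
qed

text \<open>The joint characteristic function at \<open>c\<close> is that of the single Gaussian
  variable with coefficients \<open>c\<close>, taken at 1. By disjointness its variance is a sum
  over single sets, and the exponential of the sum is the product of the individual characteristic
  functions.\<close>

lemma indep_normal_moments_W:
  assumes I: "finite I" and S: "\<And>i. i \<in> I \<Longrightarrow> S i \<in> fmeasurable lborel" and dis: "disjoint_family_on S I"
  shows "indep_normal_moments M (\<lambda>i. W (S i)) (\<lambda>i. measure lborel (S i)) I"
proof
  note g = centred_gaussian[OF gaussian_rv_W centred expectation_W_sq]
  show "indep_vars (\<lambda>_. borel) (\<lambda>i. W (S i)) I"
  proof (rule indep_vars_of_joint_char[OF I])
    show "W (S i) \<in> borel_measurable M" if "i \<in> I" for i
      using gaussian_rv_W[OF S[OF that]] by (simp add: gaussian_rv_def)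
    fix c :: "_ \<Rightarrow> real"
    define X where "X = (\<lambda>\<omega>. \<Sum>i\<in>I. c i * W (S i) \<omega>)"
    have gX: "gaussian_rv M X" unfolding X_def by (rule gaussian_rv_sum[OF I S])
    then have [measurable]: "X \<in> borel_measurable M" by (simp add: gaussian_rv_def)
    have "expectation (\<lambda>\<omega>. (X \<omega>)\<^sup>2) = (\<Sum>i\<in>I. c i * (\<Sum>j\<in>I. c j * measure lborel (S i \<inter> S j)))"
      unfolding X_def by (subst expectation_sum_W_sq[OF I S]) (simp_all add: sum_distrib_left mult.assoc)
    also have "\<dots> = (\<Sum>i\<in>I. (c i)\<^sup>2 * measure lborel (S i))"
      using measure_Int_disjoint_family[OF dis I] by (simp add: power2_eq_square mult.assoc)
    finally have v: "expectation (\<lambda>\<omega>. (X \<omega>)\<^sup>2) = (\<Sum>i\<in>I. (c i)\<^sup>2 * measure lborel (S i))" .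
    have "(CLINT \<omega>|M. iexp (\<Sum>i\<in>I. c i * W (S i) \<omega>)) = char (distr M borel X) 1"
      by (simp add: char_def integral_distr X_def[symmetric]) (simp add: X_def)
    also have "\<dots> = exp (- (\<Sum>i\<in>I. (c i)\<^sup>2 * measure lborel (S i)) * 1\<^sup>2 / 2)"
      by (rule centred_gaussian(1)[OF gX _ v]) (unfold X_def, rule expectation_sum_W[OF I S])
    also have "- (\<Sum>i\<in>I. (c i)\<^sup>2 * measure lborel (S i)) * 1\<^sup>2 / 2 = (\<Sum>i\<in>I. - measure lborel (S i) * (c i)\<^sup>2 / 2)"
      by (simp add: sum_negf sum_divide_distrib mult.commute)
    also have "complex_of_real (exp \<dots>) = (\<Prod>i\<in>I. complex_of_real (exp (- measure lborel (S i) * (c i)\<^sup>2 / 2)))"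
      using I by (simp add: exp_sum)
    also have "\<dots> = (\<Prod>i\<in>I. char (distr M borel (W (S i))) (c i))"
      using S by (intro prod.cong refl) (simp add: g(1))
    finally show "(CLINT \<omega>|M. iexp (\<Sum>i\<in>I. c i * W (S i) \<omega>)) = (\<Prod>i\<in>I. char (distr M borel (W (S i))) (c i))" .
  qed
qed (use S centred expectation_W_sq all_moments_W centred_gaussian[OF gaussian_rv_W centred expectation_W_sq] in auto)

end

section \<open>Step functions over finite families of disjoint sets, and linearity of their
  integrals\<close>

definition step_kernel :: "'i set \<Rightarrow> ('i \<Rightarrow> real set) \<Rightarrow> ('i \<Rightarrow> 'i \<Rightarrow> real) \<Rightarrow> real \<times> real \<Rightarrow> real" where
  "step_kernel I S c = (\<lambda>(x\<^sub>1, x\<^sub>2). \<Sum>i\<in>I. \<Sum>j\<in>I. c i j * indicator (S i) x\<^sub>1 * indicator (S j) x\<^sub>2)"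

text \<open>Common refinements are naturally indexed by pairs and two-set families by
  \<open>bool\<close>; an enumeration of the index set brings them into the form with indices below
  \<open>n\<close> that the definition demands.\<close>

lemma step_double_integralI:
  fixes I :: "'i set"
  assumes "finite I" "\<And>i. i \<in> I \<Longrightarrow> S i \<in> fmeasurable lborel" "disjoint_family_on S I" "\<And>i. i \<in> I \<Longrightarrow> c i i = 0"
    and g: "g = step_kernel I S c" and Y: "Y = (\<lambda>\<omega>. \<Sum>i\<in>I. \<Sum>j\<in>I. c i j * W (S i) \<omega> * W (S j) \<omega>)"
  shows "step_double_integral W g Y"
proof -
  obtain h where h: "bij_betw h {..<card I} I"
    using ex_bij_betw_nat_finite[OF assms(1)] by (auto simp: atLeast0LessThan)
  have s: "(\<Sum>i<card I. f (h i)) = (\<Sum>i\<in>I. f i)" for f :: "'i \<Rightarrow> real"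
    using sum.reindex_bij_betw[OF h, of f] .
  have hI: "h i \<in> I" if "i < card I" for i using h that by (auto simp: bij_betw_def)
  have inj: "inj_on h {..<card I}" using h by (simp add: bij_betw_def)
  show ?thesis
    unfolding step_double_integral_def
  proof (intro exI[of _ "card I"] exI[of _ "S \<circ> h"] exI[of _ "\<lambda>i j. c (h i) (h j)"] conjI)
    show "\<forall>i<card I. (S \<circ> h) i \<in> fmeasurable lborel" using hI assms by auto
    show "disjoint_family_on (S \<circ> h) {..<card I}"
      using assms(3) hI inj unfolding disjoint_family_on_def inj_on_def by (metis comp_apply lessThan_iff)
    show "\<forall>i<card I. c (h i) (h i) = 0" using hI assms by auto
    show "g = (\<lambda>(x\<^sub>1, x\<^sub>2). \<Sum>i<card I. \<Sum>j<card I. c (h i) (h j) * indicator ((S \<circ> h) i) x\<^sub>1 * indicator ((S \<circ> h) j) x\<^sub>2)"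
      unfolding g step_kernel_def comp_apply
      using s[of "\<lambda>j. c i j * indicator (S i) x * indicator (S j) y" for i x y]
         s[of "\<lambda>i. \<Sum>j\<in>I. c i j * indicator (S i) x * indicator (S j) y" for x y] by simp
    show "Y = (\<lambda>\<omega>. \<Sum>i<card I. \<Sum>j<card I. c (h i) (h j) * W ((S \<circ> h) i) \<omega> * W ((S \<circ> h) j) \<omega>)"
      unfolding Y comp_apply
      using s[of "\<lambda>j. c i j * W (S i) \<omega> * W (S j) \<omega>" for i \<omega>]
         s[of "\<lambda>i. \<Sum>j\<in>I. c i j * W (S i) \<omega> * W (S j) \<omega>" for \<omega>] by simp
  qed
qed

lemma step_double_integralE:
  assumes "step_double_integral W g Y"
  obtains n :: nat and S c where "\<And>i. i < n \<Longrightarrow> S i \<in> fmeasurable lborel" "disjoint_family_on S {..<n}" "\<And>i. i < n \<Longrightarrow> c i i = 0"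
    "g = step_kernel {..<n} S c" "Y = (\<lambda>\<omega>. \<Sum>i<n. \<Sum>j<n. c i j * W (S i) \<omega> * W (S j) \<omega>)"
  using assms unfolding step_double_integral_def step_kernel_def by auto

text \<open>Both step functions are rewritten over the common refinement of their partitions. The index
  \<open>n\<close> (resp. \<open>m\<close>) stands for the complement of the sets of the first (resp. second) partition.\<close>

lemma common_refinement_sum:
  fixes A B :: "nat \<times> nat \<Rightarrow> real" and n m :: nat
  defines "J \<equiv> {..n} \<times> {..m} - {(n, m)}"
  assumes "\<And>i. i < n \<Longrightarrow> u i = (\<Sum>j\<le>m. A (i, j))" "\<And>i. i < n \<Longrightarrow> u' i = (\<Sum>j\<le>m. B (i, j))"
    and "\<And>j. j < m \<Longrightarrow> w j = (\<Sum>i\<le>n. A (i, j))" "\<And>j. j < m \<Longrightarrow> w' j = (\<Sum>i\<le>n. B (i, j))"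
  shows "(\<Sum>p\<in>J. \<Sum>q\<in>J. ((if fst p < n \<and> fst q < n then a * c (fst p) (fst q) else 0) +
        (if snd p < m \<and> snd q < m then b * d (snd p) (snd q) else 0)) * A p * B q) =
    a * (\<Sum>i<n. \<Sum>j<n. c i j * u i * u' j) + b * (\<Sum>i<m. \<Sum>j<m. d i j * w i * w' j)"
proof -
  have 1: "(\<Sum>i<n. f i * (\<Sum>j\<le>m. C (i, j))) = (\<Sum>p\<in>J. (if fst p < n then f (fst p) else 0) * C p)" for f and C :: "nat \<times> nat \<Rightarrow> real"
  proof -
    have "(\<Sum>i<n. f i * (\<Sum>j\<le>m. C (i, j))) = (\<Sum>p\<in>{..<n} \<times> {..m}. f (fst p) * C p)"
      by (simp add: sum_distrib_left sum.cartesian_product case_prod_unfold)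
    also have "\<dots> = (\<Sum>p\<in>J. (if fst p < n then f (fst p) else 0) * C p)"
      by (intro sum.mono_neutral_cong_left) (auto simp: J_def)
    finally show ?thesis .
  qed
  have 2: "(\<Sum>j<m. f j * (\<Sum>i\<le>n. C (i, j))) = (\<Sum>p\<in>J. (if snd p < m then f (snd p) else 0) * C p)" for f and C :: "nat \<times> nat \<Rightarrow> real"
  proof -
    have "(\<Sum>j<m. f j * (\<Sum>i\<le>n. C (i, j))) = (\<Sum>i\<le>n. \<Sum>j<m. f j * C (i, j))"
      by (simp add: sum_distrib_left) (rule sum.swap)
    also have "\<dots> = (\<Sum>p\<in>{..n} \<times> {..<m}. f (snd p) * C p)"
      by (simp add: sum.cartesian_product case_prod_unfold)
    also have "\<dots> = (\<Sum>p\<in>J. (if snd p < m then f (snd p) else 0) * C p)"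
      by (intro sum.mono_neutral_cong_left) (auto simp: J_def)
    finally show ?thesis .
  qed
  have "(\<Sum>i<n. \<Sum>j<n. c i j * u i * u' j) = (\<Sum>i<n. (\<Sum>j<n. c i j * u' j) * u i)"
    by (simp add: sum_distrib_left mult_ac)
  also have "\<dots> = (\<Sum>i<n. (\<Sum>j<n. c i j * (\<Sum>k\<le>m. B (j, k))) * (\<Sum>k\<le>m. A (i, k)))"
    using assms(2,3) by simp
  also have "\<dots> = (\<Sum>p\<in>J. \<Sum>q\<in>J. (if fst p < n \<and> fst q < n then c (fst p) (fst q) else 0) * A p * B q)"
    unfolding 1[where C=B] 1[where C=A] by (intro sum.cong refl) (auto simp: sum_distrib_left sum_distrib_right mult_ac intro!: sum.cong)
  finally have e1: "(\<Sum>i<n. \<Sum>j<n. c i j * u i * u' j) = \<dots>" .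
  have "(\<Sum>i<m. \<Sum>j<m. d i j * w i * w' j) = (\<Sum>i<m. (\<Sum>j<m. d i j * w' j) * w i)"
    by (simp add: sum_distrib_left mult_ac)
  also have "\<dots> = (\<Sum>i<m. (\<Sum>j<m. d i j * (\<Sum>k\<le>n. B (k, j))) * (\<Sum>k\<le>n. A (k, i)))"
    using assms(4,5) by simp
  also have "\<dots> = (\<Sum>p\<in>J. \<Sum>q\<in>J. (if snd p < m \<and> snd q < m then d (snd p) (snd q) else 0) * A p * B q)"
    unfolding 2[where C=B] 2[where C=A] by (intro sum.cong refl) (auto simp: sum_distrib_left sum_distrib_right mult_ac intro!: sum.cong)
  finally have e2: "(\<Sum>i<m. \<Sum>j<m. d i j * w i * w' j) = \<dots>" .
  show ?thesis
    unfolding e1 e2 sum_distrib_left sum.distrib[symmetric]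
    by (intro sum.cong refl) (auto simp: algebra_simps)
qed

text \<open>The integral \<open>V\<close> is formed over the common refinement. Since
  \<open>W\<close> is only almost surely additive, it agrees with the combination of the two given
  integrals outside a null set, one exceptional set for each of finitely many original sets.\<close>

lemma (in brownian_random_measure) step_double_integral_linear:
  assumes "step_double_integral W g Y" "step_double_integral W h X"
  obtains V where "step_double_integral W (\<lambda>x. a * g x + b * h x) V" "AE \<omega> in M. V \<omega> = a * Y \<omega> + b * X \<omega>"
proof -
  from assms(1) obtain n :: nat and S c where S: "\<And>i. i < n \<Longrightarrow> S i \<in> fmeasurable lborel" "disjoint_family_on S {..<n}" "\<And>i. i < n \<Longrightarrow> c i i = 0"
    "g = step_kernel {..<n} S c" "Y = (\<lambda>\<omega>. \<Sum>i<n. \<Sum>j<n. c i j * W (S i) \<omega> * W (S j) \<omega>)"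
    by (rule step_double_integralE) blast
  from assms(2) obtain m :: nat and T d where T: "\<And>i. i < m \<Longrightarrow> T i \<in> fmeasurable lborel" "disjoint_family_on T {..<m}" "\<And>i. i < m \<Longrightarrow> d i i = 0"
    "h = step_kernel {..<m} T d" "X = (\<lambda>\<omega>. \<Sum>i<m. \<Sum>j<m. d i j * W (T i) \<omega> * W (T j) \<omega>)"
    by (rule step_double_integralE) blast
  define S' where "S' i = (if i < n then S i else - (\<Union>i<n. S i))" for i
  define T' where "T' i = (if i < m then T i else - (\<Union>i<m. T i))" for i
  define R where "R p = S' (fst p) \<inter> T' (snd p)" for p
  \<comment> \<open>The cell of index \<open>(n, m)\<close> lies outside all sets of both families
    and has infinite measure, so \<open>W\<close> has no prescribed value there. Both coefficients
    vanish on it, and every other cell lies inside a set of finite measure.\<close>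
  define J where "J = {..n} \<times> {..m} - {(n, m)}"
  define e where "e p q = (if fst p < n \<and> fst q < n then a * c (fst p) (fst q) else 0) +
        (if snd p < m \<and> snd q < m then b * d (snd p) (snd q) else 0)" for p q
  have [measurable]: "S i \<in> sets borel" if "i < n" for i using S(1)[OF that] by (simp add: fmeasurable_def)
  have [measurable]: "T i \<in> sets borel" if "i < m" for i using T(1)[OF that] by (simp add: fmeasurable_def)
  have bS: "S' i \<in> sets borel" for i
    by (cases "i < n", simp add: S'_def, simp only: S'_def if_False, rule borel_comp, rule sets.finite_UN) auto
  have bT: "T' i \<in> sets borel" for i
    by (cases "i < m", simp add: T'_def, simp only: T'_def if_False, rule borel_comp, rule sets.finite_UN) auto
  have disS: "disjoint_family_on S' {..n}"
    using S(2) unfolding disjoint_family_on_def S'_def by auto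
  have disT: "disjoint_family_on T' {..m}"
    using T(2) unfolding disjoint_family_on_def T'_def by auto
  have UNS: "(\<Union>i\<le>n. S' i) = UNIV" unfolding S'_def by auto
  have UNT: "(\<Union>i\<le>m. T' i) = UNIV" unfolding T'_def by auto
  have R1: "R (i, j) \<in> fmeasurable lborel" if "i < n" for i j
    using S(1)[OF that] that bT unfolding R_def S'_def by (auto intro: fmeasurable_Int_fmeasurable)
  have R2: "R (i, j) \<in> fmeasurable lborel" if "j < m" for i j
    using T(1)[OF that] that bS unfolding R_def T'_def by (auto intro: fmeasurable_Int_fmeasurable simp: Int_commute[of _ "T j"])
  have RJ: "R p \<in> fmeasurable lborel" if "p \<in> J" for p
    using that R1[of "fst p" "snd p"] R2[of "snd p" "fst p"] unfolding J_def by (cases p) force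
  have disR: "disjoint_family_on R J"
    unfolding disjoint_family_on_def
  proof (intro ballI impI)
    fix p q assume pq: "p \<in> J" "q \<in> J" "p \<noteq> q"
    then have le: "fst p \<le> n" "fst q \<le> n" "snd p \<le> m" "snd q \<le> m" by (auto simp: J_def)
    have "fst p \<noteq> fst q \<or> snd p \<noteq> snd q" using pq(3) by (auto simp: prod_eq_iff)
    then have "S' (fst p) \<inter> S' (fst q) = {} \<or> T' (snd p) \<inter> T' (snd q) = {}"
      using disS disT le unfolding disjoint_family_on_def by blast
    then show "R p \<inter> R q = {}" unfolding R_def by blast
  qed
  have indS: "indicator (S i) x = (\<Sum>j\<le>m. indicator (R (i, j)) x :: real)" if "i < n" for i x
  proof -
    have "indicator (S i) x = (indicator (\<Union>j\<le>m. R (i, j)) x :: real)"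
      using UNT that by (auto simp: R_def S'_def simp flip: Int_UN_distrib)
    then show ?thesis
      using disT by (subst indicator_UN_disjoint[symmetric]) (auto simp: disjoint_family_on_def R_def)
  qed
  have indT: "indicator (T j) x = (\<Sum>i\<le>n. indicator (R (i, j)) x :: real)" if "j < m" for j x
  proof -
    have "indicator (T j) x = (indicator (\<Union>i\<le>n. R (i, j)) x :: real)"
      using UNS that by (auto simp: R_def T'_def simp flip: Int_UN_distrib2)
    then show ?thesis
      using disS by (subst indicator_UN_disjoint[symmetric]) (auto simp: disjoint_family_on_def R_def)
  qed
  have WS: "AE \<omega> in M. W (S i) \<omega> = (\<Sum>j\<le>m. W (R (i, j)) \<omega>)" if "i < n" for i
  proof (rule W_UN_disjoint)
    show "disjoint_family_on (\<lambda>j. R (i, j)) {..m}" using disT by (auto simp: disjoint_family_on_def R_def)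
    show "S i = (\<Union>j\<le>m. R (i, j))" using UNT that by (auto simp: R_def S'_def simp flip: Int_UN_distrib)
  qed (use R1 that in auto)
  have WT: "AE \<omega> in M. W (T j) \<omega> = (\<Sum>i\<le>n. W (R (i, j)) \<omega>)" if "j < m" for j
  proof (rule W_UN_disjoint)
    show "disjoint_family_on (\<lambda>i. R (i, j)) {..n}" using disS by (auto simp: disjoint_family_on_def R_def)
    show "T j = (\<Union>i\<le>n. R (i, j))" using UNS that by (auto simp: R_def T'_def simp flip: Int_UN_distrib2)
  qed (use R2 that in auto)
  define V where "V = (\<lambda>\<omega>. \<Sum>p\<in>J. \<Sum>q\<in>J. e p q * W (R p) \<omega> * W (R q) \<omega>)"
  show ?thesis
  proof
    show "step_double_integral W (\<lambda>x. a * g x + b * h x) V"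
    proof (rule step_double_integralI[OF _ RJ disR _ _ V_def])
      show "finite J" by (simp add: J_def)
      show "e p p = 0" for p using S(3) T(3) by (auto simp: e_def)
      show "(\<lambda>x. a * g x + b * h x) = step_kernel J R e"
        unfolding step_kernel_def J_def e_def S(4) T(4) case_prod_unfold
        by (rule ext, rule common_refinement_sum[symmetric]) (use indS indT in auto)
    qed
    have "AE \<omega> in M. \<forall>i\<in>{..<n}. W (S i) \<omega> = (\<Sum>j\<le>m. W (R (i, j)) \<omega>)"
      using WS by (intro AE_finite_allI) auto
    moreover have "AE \<omega> in M. \<forall>j\<in>{..<m}. W (T j) \<omega> = (\<Sum>i\<le>n. W (R (i, j)) \<omega>)"
      using WT by (intro AE_finite_allI) auto
    ultimately show "AE \<omega> in M. V \<omega> = a * Y \<omega> + b * X \<omega>"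
    proof eventually_elim
      case (elim \<omega>)
      then show ?case
        unfolding V_def J_def e_def S(5) T(5) by (intro common_refinement_sum) auto
    qed
  qed
qed

section \<open>Moments of the integrals of step functions\<close>

abbreviation lborel2 :: "(real \<times> real) measure" where
  "lborel2 \<equiv> lborel \<Otimes>\<^sub>M lborel"

abbreviation lborel3 :: "(real \<times> real \<times> real) measure" where
  "lborel3 \<equiv> lborel \<Otimes>\<^sub>M lborel \<Otimes>\<^sub>M lborel"

abbreviation L2_sq :: "'a measure \<Rightarrow> ('a \<Rightarrow> real) \<Rightarrow> ennreal" where
  "L2_sq M f \<equiv> \<integral>\<^sup>+x. ennreal ((f x)\<^sup>2) \<partial>M"

text \<open>The only part of \<open>g\<close> that its double integral depends on, as the products
  of values of \<open>W\<close> commute.\<close>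

definition symmetrization :: "(real \<times> real \<Rightarrow> real) \<Rightarrow> real \<times> real \<Rightarrow> real" where
  "symmetrization g = (\<lambda>(x, y). (g (x, y) + g (y, x)) / 2)"

text \<open>Its integral is the trace of the third power of the integral operator with kernel
  \<open>f\<close>.\<close>

definition cyclic_product :: "(real \<times> real \<Rightarrow> real) \<Rightarrow> real \<times> real \<times> real \<Rightarrow> real" where
  "cyclic_product f = (\<lambda>(x, y, z). f (x, y) * f (y, z) * f (z, x))"

context
  fixes I :: "'i set" and S :: "'i \<Rightarrow> real set"
  assumes I: "finite I" and S: "\<And>i. i \<in> I \<Longrightarrow> S i \<in> fmeasurable lborel" and dis: "disjoint_family_on S I"
begin

lemma sum_indicator_disjoint:
  fixes a :: "'i \<Rightarrow> real"
  assumes "p \<in> I" "x \<in> S p"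
  shows "(\<Sum>i\<in>I. a i * indicator (S i) x) = a p"
proof -
  have "(\<Sum>i\<in>I. a i * indicator (S i) x) = (\<Sum>i\<in>{p}. a i * indicator (S i) x)"
    using I dis assms by (intro sum.mono_neutral_right) (auto simp: disjoint_family_on_def indicator_def)
  then show ?thesis using assms by simp
qed

lemma step_kernel_eq: "p \<in> I \<Longrightarrow> q \<in> I \<Longrightarrow> x \<in> S p \<Longrightarrow> y \<in> S q \<Longrightarrow> step_kernel I S c (x, y) = c p q"
  using sum_indicator_disjoint[of q y "\<lambda>j. c i j * indicator (S i) x" for i]
    sum_indicator_disjoint[of p x "\<lambda>i. c i q"]
  by (simp add: step_kernel_def)

lemma step_kernel_eq_0: "x \<notin> \<Union>(S ` I) \<or> y \<notin> \<Union>(S ` I) \<Longrightarrow> step_kernel I S c (x, y) = 0"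
  by (auto simp: step_kernel_def intro!: sum.neutral)

text \<open>By disjointness at most one term of the double sum is nonzero at any point;
  \<open>F 0 = 0\<close> takes care of the points outside all rectangles.\<close>

lemma step_kernel_comp: "F 0 = 0 \<Longrightarrow> F (step_kernel I S c z) = step_kernel I S (\<lambda>i j. F (c i j)) z"
proof (cases z)
  case (Pair x y)
  assume F: "F 0 = 0"
  show ?thesis
  proof (cases "x \<in> \<Union>(S ` I) \<and> y \<in> \<Union>(S ` I)")
    case True
    then obtain p q where "p \<in> I" "q \<in> I" "x \<in> S p" "y \<in> S q" by auto
    then show ?thesis by (simp add: Pair step_kernel_eq)
  next
    case False
    then have "x \<notin> \<Union>(S ` I) \<or> y \<notin> \<Union>(S ` I)" by blast
    then show ?thesis using F by (simp only: Pair step_kernel_eq_0)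
  qed
qed

lemma cyclic_product_step_kernel:
  "cyclic_product (step_kernel I S c) (x, y, z) =
    (\<Sum>i\<in>I. \<Sum>j\<in>I. \<Sum>k\<in>I. c i j * c j k * c k i * indicator (S i) x * indicator (S j) y * indicator (S k) z)"
proof (cases "x \<in> \<Union>(S ` I) \<and> y \<in> \<Union>(S ` I) \<and> z \<in> \<Union>(S ` I)")
  case True
  then obtain p q r where *: "p \<in> I" "q \<in> I" "r \<in> I" "x \<in> S p" "y \<in> S q" "z \<in> S r" by auto
  then have "(\<Sum>i\<in>I. \<Sum>j\<in>I. \<Sum>k\<in>I. c i j * c j k * c k i * indicator (S i) x * indicator (S j) y * indicator (S k) z)
      = (\<Sum>i\<in>I. \<Sum>j\<in>I. c i j * c j r * c r i * indicator (S i) x * indicator (S j) y)"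
    by (intro sum.cong refl sum_indicator_disjoint)
  also have "\<dots> = (\<Sum>i\<in>I. c i q * c q r * c r i * indicator (S i) x)"
    using * by (intro sum.cong refl sum_indicator_disjoint)
  also have "\<dots> = c p q * c q r * c r p"
    using * by (intro sum_indicator_disjoint)
  finally show ?thesis using * by (simp add: cyclic_product_def step_kernel_eq)
next
  case False
  then have "(\<Sum>i\<in>I. \<Sum>j\<in>I. \<Sum>k\<in>I. c i j * c j k * c k i * indicator (S i) x * indicator (S j) y * indicator (S k) z) = 0"
    by (auto intro!: sum.neutral simp: indicator_def)
  moreover have "cyclic_product (step_kernel I S c) (x, y, z) = 0"
    using False step_kernel_eq_0[of x y c] step_kernel_eq_0[of y z c] by (auto simp: cyclic_product_def)
  ultimately show ?thesis by simp
qed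

lemma sets_S [measurable]: "i \<in> I \<Longrightarrow> S i \<in> sets borel"
  using S by (auto simp: fmeasurable_def)

lemma measurable_step_kernel: "step_kernel I S c \<in> borel_measurable lborel2"
  unfolding step_kernel_def by measurable

lemma has_bochner_integral_step_kernel:
  "has_bochner_integral lborel2 (step_kernel I S c)
    (\<Sum>i\<in>I. \<Sum>j\<in>I. c i j * (measure lborel (S i) * measure lborel (S j)))"
proof -
  have "has_bochner_integral lborel2 (\<lambda>z. \<Sum>i\<in>I. \<Sum>j\<in>I. c i j * indicator (S i \<times> S j) z)
    (\<Sum>i\<in>I. \<Sum>j\<in>I. c i j * (measure lborel (S i) * measure lborel (S j)))"
  proof (intro has_bochner_integral_sum has_bochner_integral_mult_right)
    fix i j assume ij: "i \<in> I" "j \<in> I"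
    have e: "emeasure lborel2 (S i \<times> S j) = ennreal (measure lborel (S i) * measure lborel (S j))"
      using ij S by (subst lborel.emeasure_pair_measure_Times)
        (auto simp: ennreal_mult emeasure_eq_measure2 fmeasurableD)
    have "has_bochner_integral lborel2 (indicator (S i \<times> S j)) (measure lborel2 (S i \<times> S j))"
      using ij e by (intro has_bochner_integral_real_indicator) auto
    then show "has_bochner_integral lborel2 (indicator (S i \<times> S j)) (measure lborel (S i) * measure lborel (S j))"
      using e by (simp add: measure_def)
  qed
  moreover have "step_kernel I S c = (\<lambda>z. \<Sum>i\<in>I. \<Sum>j\<in>I. c i j * indicator (S i \<times> S j) z)"
    unfolding step_kernel_def by (auto simp: fun_eq_iff indicator_times mult.assoc)
  ultimately show ?thesis by simp
qed

lemma has_bochner_integral_cyclic_product_step_kernel: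
  "has_bochner_integral lborel3 (cyclic_product (step_kernel I S c))
    (\<Sum>i\<in>I. \<Sum>j\<in>I. \<Sum>k\<in>I. c i j * c j k * c k i * (measure lborel (S i) * (measure lborel (S j) * measure lborel (S k))))"
proof -
  note times = sigma_finite_measure.emeasure_pair_measure_Times[OF
    sigma_finite_pair_measure[OF lborel.sigma_finite_measure_axioms lborel.sigma_finite_measure_axioms]]
  have "has_bochner_integral lborel3
    (\<lambda>z. \<Sum>i\<in>I. \<Sum>j\<in>I. \<Sum>k\<in>I. c i j * c j k * c k i * indicator (S i \<times> S j \<times> S k) z)
    (\<Sum>i\<in>I. \<Sum>j\<in>I. \<Sum>k\<in>I. c i j * c j k * c k i * (measure lborel (S i) * (measure lborel (S j) * measure lborel (S k))))"
  proof (intro has_bochner_integral_sum has_bochner_integral_mult_right)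
    fix i j k assume ij: "i \<in> I" "j \<in> I" "k \<in> I"
    have e: "emeasure lborel3 (S i \<times> S j \<times> S k) = ennreal (measure lborel (S i) * (measure lborel (S j) * measure lborel (S k)))"
      using ij S by (subst times, simp, simp, subst lborel.emeasure_pair_measure_Times)
        (auto simp: ennreal_mult emeasure_eq_measure2 fmeasurableD)
    have "has_bochner_integral lborel3 (indicator (S i \<times> S j \<times> S k)) (measure lborel3 (S i \<times> S j \<times> S k))"
      using ij e by (intro has_bochner_integral_real_indicator) auto
    then show "has_bochner_integral lborel3 (indicator (S i \<times> S j \<times> S k)) (measure lborel (S i) * (measure lborel (S j) * measure lborel (S k)))"
      using e by (simp add: measure_def)
  qed
  moreover have "cyclic_product (step_kernel I S c) = (\<lambda>z. \<Sum>i\<in>I. \<Sum>j\<in>I. \<Sum>k\<in>I. c i j * c j k * c k i * indicator (S i \<times> S j \<times> S k) z)"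
    by (auto simp: fun_eq_iff cyclic_product_step_kernel indicator_times mult.assoc)
  ultimately show ?thesis by simp
qed

end

lemma sum_symmetrize:
  fixes c P :: "'i \<Rightarrow> 'i \<Rightarrow> real"
  shows "(\<Sum>i\<in>I. \<Sum>j\<in>I. (c i j + c j i) / 2 * P i j) =
    ((\<Sum>i\<in>I. \<Sum>j\<in>I. c i j * P i j) + (\<Sum>i\<in>I. \<Sum>j\<in>I. c j i * P i j)) / 2"
  by (simp add: sum.distrib[symmetric] sum_divide_distrib field_simps)

lemma symmetrization_step_kernel:
  "symmetrization (step_kernel I S c) = step_kernel I S (\<lambda>i j. (c i j + c j i) / 2)"
proof -
  have "symmetrization (step_kernel I S c) (x, y) = step_kernel I S (\<lambda>i j. (c i j + c j i) / 2) (x, y)" for x y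
  proof -
    have "step_kernel I S c (y, x) = (\<Sum>i\<in>I. \<Sum>j\<in>I. c j i * indicator (S i) x * indicator (S j) y)"
      unfolding step_kernel_def prod.case by (subst sum.swap) (simp add: mult_ac)
    then show ?thesis
      using sum_symmetrize[of c "\<lambda>i j. indicator (S i) x * indicator (S j) y" I]
      by (simp add: symmetrization_def step_kernel_def mult.assoc)
  qed
  then show ?thesis by auto
qed

text \<open>The integral is the quadratic form of the symmetrized coefficients in the independent
  values of \<open>W\<close>. Their variances are the measures of the sets, so the weighted
  coefficient sums in its moments are exactly integrals of the symmetrized step function.\<close>

lemma (in brownian_random_measure) step_double_integral_moments:
  assumes "step_double_integral W g Y"
  shows "g \<in> borel_measurable lborel2" "all_moments M Y"
    "has_bochner_integral lborel2 (\<lambda>z. (symmetrization g z)\<^sup>2) (expectation (\<lambda>\<omega>. (Y \<omega>)\<^sup>2) / 2)"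
    "has_bochner_integral lborel3 (cyclic_product (symmetrization g)) (expectation (\<lambda>\<omega>. Y \<omega> ^ 3) / 8)"
    "expectation (\<lambda>\<omega>. Y \<omega> ^ 4) \<le> 27 * (expectation (\<lambda>\<omega>. (Y \<omega>)\<^sup>2))\<^sup>2"
proof -
  from assms obtain n :: nat and S c where S: "\<And>i. i < n \<Longrightarrow> S i \<in> fmeasurable lborel" "disjoint_family_on S {..<n}" "\<And>i. i < n \<Longrightarrow> c i i = 0"
    "g = step_kernel {..<n} S c" "Y = (\<lambda>\<omega>. \<Sum>i<n. \<Sum>j<n. c i j * W (S i) \<omega> * W (S j) \<omega>)"
    by (rule step_double_integralE) blast
  define d where "d i j = (c i j + c j i) / 2" for i j
  have d: "d i i = 0" if "i \<in> {..<n}" for i using S(3) that by (simp add: d_def)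
  have dsym: "d i j = d j i" for i j by (simp add: d_def)
  interpret X: indep_normal_moments M "\<lambda>i. W (S i)" "\<lambda>i. measure lborel (S i)" "{..<n}"
    using S by (intro indep_normal_moments_W) auto
  have Y: "Y = X.quadratic_form d {..<n}"
  proof
    fix \<omega>
    have "Y \<omega> = (\<Sum>i<n. \<Sum>j<n. c j i * W (S i) \<omega> * W (S j) \<omega>)"
      unfolding S(5) by (subst sum.swap) (simp add: mult_ac)
    then show "Y \<omega> = X.quadratic_form d {..<n} \<omega>"
      using S(5) sum_symmetrize[of c "\<lambda>i j. W (S i) \<omega> * W (S j) \<omega>" "{..<n}"]
      by (simp add: X.quadratic_form_def d_def mult.assoc)
  qed
  have f: "finite {..<n}" "{..<n} \<subseteq> {..<n}" by auto
  have sg: "symmetrization g = step_kernel {..<n} S d"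
    unfolding S(4) symmetrization_step_kernel by (simp add: d_def[abs_def])
  show "all_moments M Y"
    unfolding Y using X.fun_of_quadratic_form[OF f(2)] by (simp add: X.fun_of_def)
  show "g \<in> borel_measurable lborel2"
    unfolding S(4) by (rule measurable_step_kernel) (use S in auto)
  have "has_bochner_integral lborel2 (\<lambda>z. (symmetrization g z)\<^sup>2)
    (\<Sum>i<n. \<Sum>j<n. (d i j)\<^sup>2 * (measure lborel (S i) * measure lborel (S j)))"
    unfolding sg using S has_bochner_integral_step_kernel[of "{..<n}" S "\<lambda>i j. (d i j)\<^sup>2"]
    by (subst step_kernel_comp[where F="\<lambda>x. x\<^sup>2"]) auto
  then show "has_bochner_integral lborel2 (\<lambda>z. (symmetrization g z)\<^sup>2) (expectation (\<lambda>\<omega>. (Y \<omega>)\<^sup>2) / 2)"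
    unfolding Y using X.expectation_quadratic_form_sq[OF d dsym f] by (simp add: mult.assoc)
  have "has_bochner_integral lborel3 (cyclic_product (symmetrization g))
    (\<Sum>i<n. \<Sum>j<n. \<Sum>k<n. d i j * d j k * d k i * (measure lborel (S i) * (measure lborel (S j) * measure lborel (S k))))"
    unfolding sg using S by (intro has_bochner_integral_cyclic_product_step_kernel) auto
  then show "has_bochner_integral lborel3 (cyclic_product (symmetrization g)) (expectation (\<lambda>\<omega>. Y \<omega> ^ 3) / 8)"
    unfolding Y using X.expectation_quadratic_form_cube[OF d dsym f] by (simp add: mult.assoc)
  show "expectation (\<lambda>\<omega>. Y \<omega> ^ 4) \<le> 27 * (expectation (\<lambda>\<omega>. (Y \<omega>)\<^sup>2))\<^sup>2"
    unfolding Y by (rule X.expectation_quadratic_form_power4[OF d dsym f]) simp_all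
qed

section \<open>Limits of second and third moments\<close>

text \<open>Allows Cauchy-Schwarz bounds to be used in squared form, without roots in
  \<open>ennreal\<close>.\<close>

lemma ennreal_tendsto_0_of_square:
  fixes X e :: "nat \<Rightarrow> ennreal"
  assumes "\<And>k. (X k)\<^sup>2 \<le> C * e k" "C < top" "e \<longlonglongrightarrow> 0"
  shows "X \<longlonglongrightarrow> 0"
proof (rule order_tendstoI)
  fix a :: ennreal assume "0 < a"
  have "(\<lambda>k. C * e k) \<longlonglongrightarrow> 0" using ennreal_tendsto_cmult[OF assms(2,3)] by simp
  moreover have "0 < a\<^sup>2" using \<open>0 < a\<close> by (simp add: zero_less_iff_neq_zero)
  ultimately have "\<forall>\<^sub>F k in sequentially. C * e k < a\<^sup>2" by (rule order_tendstoD)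
  then show "\<forall>\<^sub>F k in sequentially. X k < a"
  proof eventually_elim
    case (elim k)
    show ?case
    proof (rule ccontr)
      assume "\<not> X k < a"
      then have "a\<^sup>2 \<le> (X k)\<^sup>2" by (intro power_mono) auto
      with assms(1)[of k] elim show False by simp
    qed
  qed
qed simp

lemma nn_integral_abs_mult_sq_le:
  fixes f g :: "'a \<Rightarrow> real"
  assumes [measurable]: "f \<in> borel_measurable M" "g \<in> borel_measurable M"
  shows "(\<integral>\<^sup>+x. ennreal \<bar>f x * g x\<bar> \<partial>M)\<^sup>2 \<le> L2_sq M f * L2_sq M g"
proof -
  have "(\<integral>\<^sup>+x. ennreal \<bar>f x\<bar> * ennreal \<bar>g x\<bar> \<partial>M)\<^sup>2 \<le>
      (\<integral>\<^sup>+x. (ennreal \<bar>f x\<bar>)\<^sup>2 \<partial>M) * (\<integral>\<^sup>+x. (ennreal \<bar>g x\<bar>)\<^sup>2 \<partial>M)"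
    by (rule Cauchy_Schwarz_nn_integral) auto
  then show ?thesis by (simp add: ennreal_power abs_mult flip: ennreal_mult)
qed

lemma square_integrable_iff:
  fixes f :: "'a \<Rightarrow> real"
  assumes "f \<in> borel_measurable M"
  shows "integrable M (\<lambda>x. (f x)\<^sup>2) \<longleftrightarrow> L2_sq M f < top"
  using assms by (simp add: integrable_iff_bounded)

lemma nn_integral_square_add_le:
  fixes f g :: "'a \<Rightarrow> real"
  assumes [measurable]: "f \<in> borel_measurable M" "g \<in> borel_measurable M"
  shows "L2_sq M (\<lambda>x. f x + g x) \<le> 2 * L2_sq M f + 2 * L2_sq M g"
proof -
  have "L2_sq M (\<lambda>x. f x + g x) \<le> (\<integral>\<^sup>+x. 2 * ennreal ((f x)\<^sup>2) + 2 * ennreal ((g x)\<^sup>2) \<partial>M)"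
  proof (intro nn_integral_mono)
    fix x
    have "(f x + g x)\<^sup>2 \<le> 2 * (f x)\<^sup>2 + 2 * (g x)\<^sup>2"
      using sum_squares_bound[of "f x" "g x"] by (simp add: power2_sum)
    then have "ennreal ((f x + g x)\<^sup>2) \<le> ennreal (2 * (f x)\<^sup>2 + 2 * (g x)\<^sup>2)" by (rule ennreal_leI)
    then show "ennreal ((f x + g x)\<^sup>2) \<le> 2 * ennreal ((f x)\<^sup>2) + 2 * ennreal ((g x)\<^sup>2)"
      by (simp add: ennreal_mult ennreal_plus)
  qed
  also have "\<dots> = 2 * L2_sq M f + 2 * L2_sq M g"
    by (simp add: nn_integral_add nn_integral_cmult)
  finally show ?thesis .
qed

text \<open>A single \<open>Y k\<close> at finite distance makes \<open>Z\<close> square integrable.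
  The convergence then follows from Y^2 - Z^2 = (Y - Z)^2 + (Y - Z) (2 Z), with Cauchy-Schwarz for
  the second summand.\<close>

lemma square_integrable_L2_limit:
  fixes Y :: "nat \<Rightarrow> 'a \<Rightarrow> real"
  assumes [measurable]: "\<And>k. Y k \<in> borel_measurable M" "Z \<in> borel_measurable M"
    and Y: "\<And>k. integrable M (\<lambda>x. (Y k x)\<^sup>2)"
    and lim: "(\<lambda>k. L2_sq M (\<lambda>x. Y k x - Z x)) \<longlonglongrightarrow> 0"
  shows "integrable M (\<lambda>x. (Z x)\<^sup>2)"
    and "(\<lambda>k. LINT x|M. (Y k x)\<^sup>2) \<longlonglongrightarrow> (LINT x|M. (Z x)\<^sup>2)"
proof -
  have "\<forall>\<^sub>F k in sequentially. L2_sq M (\<lambda>x. Y k x - Z x) < 1"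
    using lim by (rule order_tendstoD) simp
  then obtain k where k: "L2_sq M (\<lambda>x. Y k x - Z x) < 1"
    by (auto simp: eventually_sequentially)
  have "L2_sq M Z = L2_sq M (\<lambda>x. (Y k x) + - (Y k x - Z x))" by simp
  also have "\<dots> \<le> 2 * L2_sq M (Y k) + 2 * L2_sq M (\<lambda>x. - (Y k x - Z x))"
    by (rule nn_integral_square_add_le) auto
  also have "\<dots> < top"
    using k Y[of k] by (auto simp: square_integrable_iff ennreal_mult_less_top power2_commute[of "Z _"] less_top intro: less_trans)
  finally show Z: "integrable M (\<lambda>x. (Z x)\<^sup>2)" by (simp add: square_integrable_iff)
  show "(\<lambda>k. LINT x|M. (Y k x)\<^sup>2) \<longlonglongrightarrow> (LINT x|M. (Z x)\<^sup>2)"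
  proof (rule tendsto_L1_int[OF Y Z])
    let ?N = "\<lambda>k. L2_sq M (\<lambda>x. Y k x - Z x)" and ?X = "\<lambda>k. \<integral>\<^sup>+x. ennreal \<bar>(Y k x - Z x) * (2 * Z x)\<bar> \<partial>M"
    have "?X \<longlonglongrightarrow> 0"
    proof (rule ennreal_tendsto_0_of_square[OF _ _ lim])
      show "(?X k)\<^sup>2 \<le> L2_sq M (\<lambda>x. 2 * Z x) * ?N k" for k
        using nn_integral_abs_mult_sq_le[of "\<lambda>x. Y k x - Z x" M "\<lambda>x. 2 * Z x"] by (simp add: mult.commute)
      have "integrable M (\<lambda>x. (2 * Z x)\<^sup>2)" using Z by (simp add: power_mult_distrib)
      then show "L2_sq M (\<lambda>x. 2 * Z x) < top" by (subst (asm) square_integrable_iff) auto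
    qed
    then have NX: "(\<lambda>k. ?N k + ?X k) \<longlonglongrightarrow> 0" using tendsto_add[OF lim] by fastforce
    show "(\<lambda>k. \<integral>\<^sup>+x. ennreal (norm ((Y k x)\<^sup>2 - (Z x)\<^sup>2)) \<partial>M) \<longlonglongrightarrow> 0"
    proof (rule tendsto_sandwich[OF _ _ tendsto_const NX])
      show "\<forall>\<^sub>F k in sequentially. (\<integral>\<^sup>+x. ennreal (norm ((Y k x)\<^sup>2 - (Z x)\<^sup>2)) \<partial>M) \<le> ?N k + ?X k"
      proof (intro always_eventually allI)
        fix k
        have "(\<integral>\<^sup>+x. ennreal (norm ((Y k x)\<^sup>2 - (Z x)\<^sup>2)) \<partial>M) \<le>
          (\<integral>\<^sup>+x. ennreal ((Y k x - Z x)\<^sup>2) + ennreal \<bar>(Y k x - Z x) * (2 * Z x)\<bar> \<partial>M)"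
        proof (intro nn_integral_mono)
          fix x
          have "(Y k x)\<^sup>2 - (Z x)\<^sup>2 = (Y k x - Z x)\<^sup>2 + (Y k x - Z x) * (2 * Z x)"
            by (simp add: power2_eq_square algebra_simps)
          then have "norm ((Y k x)\<^sup>2 - (Z x)\<^sup>2) \<le> (Y k x - Z x)\<^sup>2 + \<bar>(Y k x - Z x) * (2 * Z x)\<bar>"
            using abs_triangle_ineq[of "(Y k x - Z x)\<^sup>2" "(Y k x - Z x) * (2 * Z x)"] by simp
          then show "ennreal (norm ((Y k x)\<^sup>2 - (Z x)\<^sup>2)) \<le> ennreal ((Y k x - Z x)\<^sup>2) + ennreal \<bar>(Y k x - Z x) * (2 * Z x)\<bar>"
            by (subst ennreal_plus[symmetric]) (auto intro: ennreal_leI simp del: ennreal_plus)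
        qed
        then show "(\<integral>\<^sup>+x. ennreal (norm ((Y k x)\<^sup>2 - (Z x)\<^sup>2)) \<partial>M) \<le> ?N k + ?X k"
          by (simp add: nn_integral_add)
      qed
    qed simp
  qed
qed

lemma AE_subseq_of_L2_limit:
  fixes Y :: "nat \<Rightarrow> 'a \<Rightarrow> real"
  assumes [measurable]: "\<And>k. Y k \<in> borel_measurable M" "Z \<in> borel_measurable M"
    and Y: "\<And>k. integrable M (\<lambda>x. (Y k x)\<^sup>2)"
    and lim: "(\<lambda>k. L2_sq M (\<lambda>x. Y k x - Z x)) \<longlonglongrightarrow> 0"
  obtains r where "strict_mono r" "AE x in M. (\<lambda>n. Y (r n) x) \<longlonglongrightarrow> Z x"
proof -
  have Z: "integrable M (\<lambda>x. (Z x)\<^sup>2)"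
    by (rule square_integrable_L2_limit(1)[OF _ _ Y lim]) auto
  have D: "integrable M (\<lambda>x. (Y k x - Z x)\<^sup>2)" for k
    using integrable_mult_of_squares[of "Y k" M Z] Y[of k] Z by (simp add: power2_diff mult.assoc)
  have "(\<lambda>k. LINT x|M. norm ((Y k x - Z x)\<^sup>2)) \<longlonglongrightarrow> 0"
    using lim D by (subst (asm) nn_integral_eq_integral) (auto simp: ennreal_tendsto_0_iff)
  from tendsto_L1_AE_subseq[OF D this]
  obtain r where r: "strict_mono r" "AE x in M. (\<lambda>n. (Y (r n) x - Z x)\<^sup>2) \<longlonglongrightarrow> 0" by auto
  from r(2) have "AE x in M. (\<lambda>n. Y (r n) x) \<longlonglongrightarrow> Z x"
  proof eventually_elim
    case (elim x)
    then have "(\<lambda>n. sqrt ((Y (r n) x - Z x)\<^sup>2)) \<longlonglongrightarrow> sqrt 0" by (intro tendsto_real_sqrt)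
    then show ?case by (simp add: tendsto_rabs_zero_iff LIM_zero_iff)
  qed
  with r(1) show ?thesis by (rule that)
qed

text \<open>Y^3 - Z^3 = (Y - Z) G with G = Y^2 + Y Z + Z^2. The first factor tends to 0 in L^2 and
  the second is bounded in L^2 by the fourth moments, so Cauchy-Schwarz gives convergence in
  L^1.\<close>

lemma L2_limit_cube:
  fixes Y :: "nat \<Rightarrow> 'a \<Rightarrow> real"
  assumes Y: "\<And>k. all_moments M (Y k)" and [measurable]: "Z \<in> borel_measurable M"
    and lim: "(\<lambda>k. L2_sq M (\<lambda>x. Y k x - Z x)) \<longlonglongrightarrow> 0"
    and C: "\<And>k. (LINT x|M. Y k x ^ 4) \<le> C"
  shows "integrable M (\<lambda>x. Z x ^ 3)"
    and "(\<lambda>k. LINT x|M. Y k x ^ 3) \<longlonglongrightarrow> (LINT x|M. Z x ^ 3)"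
proof -
  have [measurable]: "Y k \<in> borel_measurable M" for k using Y by (simp add: all_moments_def)
  have i: "integrable M (\<lambda>x. Y k x ^ n)" for k n using Y by (simp add: all_moments_def)
  obtain r where r: "strict_mono r" "AE x in M. (\<lambda>n. Y (r n) x) \<longlonglongrightarrow> Z x"
    by (rule AE_subseq_of_L2_limit[OF _ _ i lim]) auto
  have nY: "(\<integral>\<^sup>+x. ennreal (Y k x ^ 4) \<partial>M) \<le> ennreal C" for k
    using C[of k] i[of k 4] by (subst nn_integral_eq_integral) (auto intro: ennreal_leI)
  \<comment> \<open>Fatou's lemma along an almost everywhere convergent subsequence transfers the
    fourth moment bound to the limit.\<close>
  have "(\<integral>\<^sup>+x. ennreal (Z x ^ 4) \<partial>M) = (\<integral>\<^sup>+x. liminf (\<lambda>n. ennreal (Y (r n) x ^ 4)) \<partial>M)"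
    using r(2) by (intro nn_integral_cong_AE, eventually_elim)
      (rule lim_imp_Liminf[symmetric], auto intro!: tendsto_ennrealI tendsto_power)
  also have "\<dots> \<le> liminf (\<lambda>n. \<integral>\<^sup>+x. ennreal (Y (r n) x ^ 4) \<partial>M)"
    by (rule nn_integral_liminf) auto
  also have "\<dots> \<le> ennreal C"
    using nY by (intro Liminf_le) (auto intro!: eventually_frequently always_eventually)
  finally have nZ: "(\<integral>\<^sup>+x. ennreal (Z x ^ 4) \<partial>M) \<le> ennreal C" .
  define G where "G k x = (Y k x)\<^sup>2 + Y k x * Z x + (Z x)\<^sup>2" for k x
  have [measurable]: "G k \<in> borel_measurable M" for k unfolding G_def by measurable
  \<comment> \<open>|G| is at most (3/2) (Y^2 + Z^2), whose square is at most (9/2) (Y^4 + Z^4); the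
    two fourth moments contribute C each.\<close>
  have nG: "L2_sq M (G k) \<le> ennreal 9 * ennreal C" for k
  proof -
    have "L2_sq M (G k) \<le> (\<integral>\<^sup>+x. ennreal (9/2) * ennreal (Y k x ^ 4) + ennreal (9/2) * ennreal (Z x ^ 4) \<partial>M)"
    proof (intro nn_integral_mono)
      fix x
      define a where "a = (Y k x)\<^sup>2" define b where "b = (Z x)\<^sup>2"
      have ab: "0 \<le> a" "0 \<le> b" by (auto simp: a_def b_def)
      have m: "\<bar>Y k x * Z x\<bar> \<le> (a + b) / 2"
        using sum_squares_bound[of "\<bar>Y k x\<bar>" "\<bar>Z x\<bar>"] by (simp add: a_def b_def abs_mult)
      have "G k x \<le> 3/2 * (a + b)" "- G k x \<le> 3/2 * (a + b)"
        using abs_le_D1[OF m] abs_le_D2[OF m] ab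
        unfolding G_def a_def[symmetric] b_def[symmetric] by (simp_all add: field_simps)
      then have "\<bar>G k x\<bar> \<le> 3/2 * (a + b)" by (rule abs_leI)
      then have "(G k x)\<^sup>2 \<le> (3/2 * (a + b))\<^sup>2"
        using ab by (simp add: abs_le_square_iff[symmetric])
      also have "\<dots> \<le> 9/2 * a\<^sup>2 + 9/2 * b\<^sup>2"
        using sum_squares_bound[of a b] by (simp add: power2_eq_square field_simps)
      also have "\<dots> = 9/2 * Y k x ^ 4 + 9/2 * Z x ^ 4" by (simp add: a_def b_def flip: power_mult)
      finally have "ennreal ((G k x)\<^sup>2) \<le> ennreal (9/2 * Y k x ^ 4 + 9/2 * Z x ^ 4)" by (rule ennreal_leI)
      also have "\<dots> = ennreal (9/2) * ennreal (Y k x ^ 4) + ennreal (9/2) * ennreal (Z x ^ 4)"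
        using ennreal_mult'[of "9/2" "Y k x ^ 4"] ennreal_mult'[of "9/2" "Z x ^ 4"] by (subst ennreal_plus) auto
      finally show "ennreal ((G k x)\<^sup>2) \<le> ennreal (9/2) * ennreal (Y k x ^ 4) + ennreal (9/2) * ennreal (Z x ^ 4)" .
    qed
    also have "\<dots> = ennreal (9/2) * (\<integral>\<^sup>+x. ennreal (Y k x ^ 4) \<partial>M) + ennreal (9/2) * (\<integral>\<^sup>+x. ennreal (Z x ^ 4) \<partial>M)"
      by (simp add: nn_integral_add nn_integral_cmult)
    also have "\<dots> \<le> ennreal (9/2) * ennreal C + ennreal (9/2) * ennreal C"
      by (intro add_mono mult_left_mono nY nZ) auto
    also have "\<dots> = ennreal 9 * ennreal C"
      by (subst distrib_right[symmetric], subst ennreal_plus[symmetric]) auto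
    finally show ?thesis .
  qed
  have l: "(\<lambda>k. \<integral>\<^sup>+x. ennreal \<bar>(Y k x - Z x) * G k x\<bar> \<partial>M) \<longlonglongrightarrow> 0"
  proof (rule ennreal_tendsto_0_of_square[OF _ _ lim])
    fix k
    have "(\<integral>\<^sup>+x. ennreal \<bar>(Y k x - Z x) * G k x\<bar> \<partial>M)\<^sup>2 \<le> L2_sq M (\<lambda>x. Y k x - Z x) * L2_sq M (G k)"
      by (rule nn_integral_abs_mult_sq_le) auto
    also have "\<dots> \<le> L2_sq M (\<lambda>x. Y k x - Z x) * (ennreal 9 * ennreal C)"
      by (intro mult_left_mono nG) auto
    finally show "(\<integral>\<^sup>+x. ennreal \<bar>(Y k x - Z x) * G k x\<bar> \<partial>M)\<^sup>2 \<le> (ennreal 9 * ennreal C) * L2_sq M (\<lambda>x. Y k x - Z x)"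
      by (simp add: mult.commute)
  qed (simp add: ennreal_mult_less_top)
  have eq: "Y k x ^ 3 - Z x ^ 3 = (Y k x - Z x) * G k x" for k x
    by (simp add: G_def power2_eq_square power3_eq_cube algebra_simps)
  have "\<forall>\<^sub>F k in sequentially. (\<integral>\<^sup>+x. ennreal \<bar>(Y k x - Z x) * G k x\<bar> \<partial>M) < 1"
    using l by (rule order_tendstoD) simp
  then obtain k where k: "(\<integral>\<^sup>+x. ennreal \<bar>(Y k x - Z x) * G k x\<bar> \<partial>M) < 1"
    by (auto simp: eventually_sequentially)
  have "integrable M (\<lambda>x. Y k x ^ 3 - Z x ^ 3)"
    unfolding eq using k by (auto simp: integrable_iff_bounded less_top intro: less_trans)
  from Bochner_Integration.integrable_diff[OF i[of k 3] this]
  show Z3: "integrable M (\<lambda>x. Z x ^ 3)" by simp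
  show "(\<lambda>k. LINT x|M. Y k x ^ 3) \<longlonglongrightarrow> (LINT x|M. Z x ^ 3)"
    by (rule tendsto_L1_int[OF i Z3]) (use l eq in simp)
qed

section \<open>Iterated integrals and the Hilbert-Schmidt continuity of the trace\<close>

lemma nn_integral_swap_lborel:
  fixes f :: "real \<times> real \<Rightarrow> ennreal"
  assumes [measurable]: "f \<in> borel_measurable lborel2"
  shows "(\<integral>\<^sup>+p. f (snd p, fst p) \<partial>lborel2) = (\<integral>\<^sup>+p. f p \<partial>lborel2)"
  by (subst (2) lborel_pair.distr_pair_swap) (simp add: nn_integral_distr case_prod_unfold)

lemma sigma_finite_lborel_pair: "sigma_finite_measure lborel2"
  by (intro sigma_finite_pair_measure lborel.sigma_finite_measure_axioms)

lemma nn_integral_lborel_triple: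
  fixes f :: "real \<times> real \<times> real \<Rightarrow> ennreal"
  assumes [measurable]: "f \<in> borel_measurable lborel3"
  shows "(\<integral>\<^sup>+p. f p \<partial>lborel3) = (\<integral>\<^sup>+x. \<integral>\<^sup>+y. \<integral>\<^sup>+z. f (x, y, z) \<partial>lborel \<partial>lborel \<partial>lborel)"
  using assms
  by (subst sigma_finite_measure.nn_integral_fst[OF sigma_finite_lborel_pair, symmetric])
     (simp_all add: lborel.nn_integral_fst[symmetric])

text \<open>This is the Hilbert-Schmidt bound for the trace of a product of three integral operators.\<close>

lemma nn_integral_cyclic_le:
  fixes u v w :: "real \<times> real \<Rightarrow> ennreal"
  assumes [measurable]: "u \<in> borel_measurable lborel2" "v \<in> borel_measurable lborel2" "w \<in> borel_measurable lborel2"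
  shows "(\<integral>\<^sup>+x. \<integral>\<^sup>+y. \<integral>\<^sup>+z. u (x, y) * v (y, z) * w (z, x) \<partial>lborel \<partial>lborel \<partial>lborel)\<^sup>2 \<le>
    (\<integral>\<^sup>+p. (u p)\<^sup>2 \<partial>lborel2) * ((\<integral>\<^sup>+p. (v p)\<^sup>2 \<partial>lborel2) * (\<integral>\<^sup>+p. (w p)\<^sup>2 \<partial>lborel2))"
proof -
  \<comment> \<open>\<open>h\<close> is the kernel of the composition of the last two operators,
    with its arguments exchanged. Cauchy-Schwarz is used once against \<open>u\<close> and once
    inside \<open>h\<close>, after which the integrals of \<open>v\<close> and \<open>w\<close>
    separate.\<close>
  define h where "h p = (\<integral>\<^sup>+z. v (snd p, z) * w (z, fst p) \<partial>lborel)" for p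
  have [measurable]: "h \<in> borel_measurable lborel2" unfolding h_def by measurable
  have "(\<integral>\<^sup>+x. \<integral>\<^sup>+y. \<integral>\<^sup>+z. u (x, y) * v (y, z) * w (z, x) \<partial>lborel \<partial>lborel \<partial>lborel) = (\<integral>\<^sup>+x. \<integral>\<^sup>+y. u (x, y) * h (x, y) \<partial>lborel \<partial>lborel)"
    unfolding h_def by (intro nn_integral_cong) (simp add: mult.assoc nn_integral_cmult)
  also have "\<dots> = (\<integral>\<^sup>+p. u p * h p \<partial>lborel2)"
    by (subst lborel.nn_integral_fst[symmetric]) auto
  also have "\<dots>\<^sup>2 \<le> (\<integral>\<^sup>+p. (u p)\<^sup>2 \<partial>lborel2) * (\<integral>\<^sup>+p. (h p)\<^sup>2 \<partial>lborel2)"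
    by (rule Cauchy_Schwarz_nn_integral) auto
  also have "(\<integral>\<^sup>+p. (h p)\<^sup>2 \<partial>lborel2) \<le> (\<integral>\<^sup>+p. (v p)\<^sup>2 \<partial>lborel2) * (\<integral>\<^sup>+p. (w p)\<^sup>2 \<partial>lborel2)"
  proof -
    have "(\<integral>\<^sup>+p. (h p)\<^sup>2 \<partial>lborel2) \<le>
      (\<integral>\<^sup>+p. (\<integral>\<^sup>+z. (v (snd p, z))\<^sup>2 \<partial>lborel) * (\<integral>\<^sup>+z. (w (z, fst p))\<^sup>2 \<partial>lborel) \<partial>lborel2)"
      unfolding h_def by (intro nn_integral_mono Cauchy_Schwarz_nn_integral) (auto simp: space_pair_measure)
    also have "\<dots> = (\<integral>\<^sup>+x. \<integral>\<^sup>+y. (\<integral>\<^sup>+z. (w (z, x))\<^sup>2 \<partial>lborel) * (\<integral>\<^sup>+z. (v (y, z))\<^sup>2 \<partial>lborel) \<partial>lborel \<partial>lborel)"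
      by (subst lborel.nn_integral_fst[symmetric]) (auto simp: mult.commute)
    also have "\<dots> = (\<integral>\<^sup>+y. \<integral>\<^sup>+z. (v (y, z))\<^sup>2 \<partial>lborel \<partial>lborel) * (\<integral>\<^sup>+x. \<integral>\<^sup>+z. (w (z, x))\<^sup>2 \<partial>lborel \<partial>lborel)"
      by (simp add: nn_integral_cmult nn_integral_multc mult.commute)
    also have "(\<integral>\<^sup>+y. \<integral>\<^sup>+z. (v (y, z))\<^sup>2 \<partial>lborel \<partial>lborel) = (\<integral>\<^sup>+p. (v p)\<^sup>2 \<partial>lborel2)"
      by (rule lborel.nn_integral_fst) auto
    also have "(\<integral>\<^sup>+x. \<integral>\<^sup>+z. (w (z, x))\<^sup>2 \<partial>lborel \<partial>lborel) = (\<integral>\<^sup>+p. (w p)\<^sup>2 \<partial>lborel2)"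
      by (rule lborel_pair.nn_integral_snd) auto
    finally show ?thesis .
  qed
  finally show ?thesis by (simp add: mult_left_mono)
qed

lemma measurable_cyclic_product [measurable]:
  assumes [measurable]: "f \<in> borel_measurable lborel2"
  shows "cyclic_product f \<in> borel_measurable lborel3"
  unfolding cyclic_product_def by measurable

text \<open>The difference of the two products telescopes into three terms, each containing
  \<open>s - f\<close> exactly once. Each is controlled by the Hilbert-Schmidt bound, and the square
  of a sum of three terms costs the factor 9.\<close>

lemma nn_integral_cyclic_product_diff_le:
  fixes f s :: "real \<times> real \<Rightarrow> real"
  assumes [measurable]: "f \<in> borel_measurable lborel2" "s \<in> borel_measurable lborel2"
    and B: "L2_sq lborel2 f \<le> B" "L2_sq lborel2 s \<le> B"
  shows "(\<integral>\<^sup>+p. ennreal \<bar>cyclic_product s p - cyclic_product f p\<bar> \<partial>lborel3)\<^sup>2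
    \<le> 9 * B\<^sup>2 * L2_sq lborel2 (\<lambda>p. s p - f p)"
proof -
  let ?P = "lborel2"
  let ?T = "\<lambda>u v w. \<integral>\<^sup>+x. \<integral>\<^sup>+y. \<integral>\<^sup>+z. ennreal \<bar>u (x, y)\<bar> * ennreal \<bar>v (y, z)\<bar> * ennreal \<bar>w (z, x)\<bar> \<partial>lborel \<partial>lborel \<partial>lborel"
  define d where "d p = s p - f p" for p
  define N where "N = L2_sq ?P d"
  have [measurable]: "d \<in> borel_measurable ?P" unfolding d_def by measurable
  have T: "(?T u v w)\<^sup>2 \<le> L2_sq ?P u * (L2_sq ?P v * L2_sq ?P w)"
    if [measurable]: "u \<in> borel_measurable ?P" "v \<in> borel_measurable ?P" "w \<in> borel_measurable ?P" for u v w :: "real \<times> real \<Rightarrow> real"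
    using nn_integral_cyclic_le[of "\<lambda>p. ennreal \<bar>u p\<bar>" "\<lambda>p. ennreal \<bar>v p\<bar>" "\<lambda>p. ennreal \<bar>w p\<bar>"] that
    by (simp add: ennreal_power)
  have 1: "(?T d s s)\<^sup>2 \<le> B\<^sup>2 * N"
  proof -
    have "(?T d s s)\<^sup>2 \<le> N * (L2_sq ?P s * L2_sq ?P s)"
      unfolding N_def by (rule T) auto
    also have "\<dots> \<le> N * (B * B)" by (intro mult_left_mono mult_mono B) auto
    finally show ?thesis by (simp add: power2_eq_square mult.commute)
  qed
  have 2: "(?T f d s)\<^sup>2 \<le> B\<^sup>2 * N"
  proof -
    have "(?T f d s)\<^sup>2 \<le> L2_sq ?P f * (N * L2_sq ?P s)"
      unfolding N_def by (rule T) auto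
    also have "\<dots> \<le> B * (N * B)" by (intro mult_left_mono mult_mono B) auto
    finally show ?thesis by (simp add: power2_eq_square mult_ac)
  qed
  have 3: "(?T f f d)\<^sup>2 \<le> B\<^sup>2 * N"
  proof -
    have "(?T f f d)\<^sup>2 \<le> L2_sq ?P f * (L2_sq ?P f * N)"
      unfolding N_def by (rule T) auto
    also have "\<dots> \<le> B * (B * N)" by (intro mult_right_mono mult_mono B) auto
    finally show ?thesis by (simp add: power2_eq_square mult_ac)
  qed
  have sq3: "(a + b + c)\<^sup>2 \<le> 9 * X" if "a\<^sup>2 \<le> X" "b\<^sup>2 \<le> X" "c\<^sup>2 \<le> X" for a b c X :: ennreal
  proof -
    define m where "m = max a (max b c)"
    have "(a + b + c)\<^sup>2 \<le> (m + m + m)\<^sup>2" by (intro power_mono add_mono) (auto simp: m_def le_max_iff_disj)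
    also have "m + m + m = 3 * m"
      by (metis distrib_right mult_1 one_add_one numeral_plus_one semiring_norm(5))
    also have "(3 * m)\<^sup>2 = 9 * m\<^sup>2" by (simp add: power_mult_distrib)
    also have "m\<^sup>2 \<le> X" using that by (auto simp: m_def max_def)
    finally show ?thesis by (simp add: mult_left_mono)
  qed
  have "(\<integral>\<^sup>+p. ennreal \<bar>cyclic_product s p - cyclic_product f p\<bar> \<partial>lborel3) =
    (\<integral>\<^sup>+x. \<integral>\<^sup>+y. \<integral>\<^sup>+z. ennreal \<bar>cyclic_product s (x, y, z) - cyclic_product f (x, y, z)\<bar> \<partial>lborel \<partial>lborel \<partial>lborel)"
    by (rule nn_integral_lborel_triple) measurable
  also have "\<dots> \<le> (\<integral>\<^sup>+x. \<integral>\<^sup>+y. \<integral>\<^sup>+z. ennreal \<bar>d (x, y)\<bar> * ennreal \<bar>s (y, z)\<bar> * ennreal \<bar>s (z, x)\<bar>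
      + ennreal \<bar>f (x, y)\<bar> * ennreal \<bar>d (y, z)\<bar> * ennreal \<bar>s (z, x)\<bar>
      + ennreal \<bar>f (x, y)\<bar> * ennreal \<bar>f (y, z)\<bar> * ennreal \<bar>d (z, x)\<bar> \<partial>lborel \<partial>lborel \<partial>lborel)"
  proof (intro nn_integral_mono)
    fix x y z
    have "cyclic_product s (x, y, z) - cyclic_product f (x, y, z) =
      d (x, y) * s (y, z) * s (z, x) + f (x, y) * d (y, z) * s (z, x) + f (x, y) * f (y, z) * d (z, x)"
      by (simp add: cyclic_product_def d_def algebra_simps)
    then have "\<bar>cyclic_product s (x, y, z) - cyclic_product f (x, y, z)\<bar> \<le>
      \<bar>d (x, y)\<bar> * \<bar>s (y, z)\<bar> * \<bar>s (z, x)\<bar> + \<bar>f (x, y)\<bar> * \<bar>d (y, z)\<bar> * \<bar>s (z, x)\<bar> + \<bar>f (x, y)\<bar> * \<bar>f (y, z)\<bar> * \<bar>d (z, x)\<bar>"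
      unfolding abs_mult[symmetric] by linarith
    from ennreal_leI[OF this]
    show "ennreal \<bar>cyclic_product s (x, y, z) - cyclic_product f (x, y, z)\<bar> \<le>
       ennreal \<bar>d (x, y)\<bar> * ennreal \<bar>s (y, z)\<bar> * ennreal \<bar>s (z, x)\<bar>
      + ennreal \<bar>f (x, y)\<bar> * ennreal \<bar>d (y, z)\<bar> * ennreal \<bar>s (z, x)\<bar>
      + ennreal \<bar>f (x, y)\<bar> * ennreal \<bar>f (y, z)\<bar> * ennreal \<bar>d (z, x)\<bar>"
      by (simp add: ennreal_mult ennreal_plus)
  qed
  also have "\<dots> = ?T d s s + ?T f d s + ?T f f d"
    by (simp add: nn_integral_add)
  also have "\<dots>\<^sup>2 \<le> 9 * (B\<^sup>2 * N)"
    by (rule sq3[OF 1 2 3])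
  finally show ?thesis by (simp add: N_def d_def mult.assoc power_mono)
qed

text \<open>For symmetric \<open>f\<close> the difference on the left is the average of
  \<open>g - f\<close> and its reflection; convexity of the square and invariance of Lebesgue
  measure under reflection give the contraction.\<close>

lemma nn_integral_symmetrization_diff_le:
  fixes f g :: "real \<times> real \<Rightarrow> real"
  assumes [measurable]: "f \<in> borel_measurable lborel2" "g \<in> borel_measurable lborel2"
    and sym: "\<And>x y. f (x, y) = f (y, x)"
  shows "L2_sq lborel2 (\<lambda>p. symmetrization g p - f p) \<le> L2_sq lborel2 (\<lambda>p. g p - f p)"
proof -
  let ?P = "lborel2"
  define d where "d p = g p - f p" for p
  have [measurable]: "d \<in> borel_measurable ?P" unfolding d_def by measurable
  have "L2_sq ?P (\<lambda>p. symmetrization g p - f p) \<le> (\<integral>\<^sup>+p. ennreal (1/2) * ennreal ((d p)\<^sup>2) + ennreal (1/2) * ennreal ((d (snd p, fst p))\<^sup>2) \<partial>?P)"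
  proof (intro nn_integral_mono)
    fix p :: "real \<times> real"
    have e: "symmetrization g p - f p = (d p + d (snd p, fst p)) / 2"
      using sym[of "fst p" "snd p"] by (cases p) (simp add: symmetrization_def d_def field_simps)
    have "(symmetrization g p - f p)\<^sup>2 \<le> 1/2 * (d p)\<^sup>2 + 1/2 * (d (snd p, fst p))\<^sup>2"
      unfolding e using sum_squares_bound[of "d p" "d (snd p, fst p)"] by (simp add: power2_eq_square field_simps)
    from ennreal_leI[OF this]
    show "ennreal ((symmetrization g p - f p)\<^sup>2) \<le> ennreal (1/2) * ennreal ((d p)\<^sup>2) + ennreal (1/2) * ennreal ((d (snd p, fst p))\<^sup>2)"
      using ennreal_mult'[of "1/2" "(d p)\<^sup>2"] ennreal_mult'[of "1/2" "(d (snd p, fst p))\<^sup>2"]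
      by (simp add: ennreal_plus)
  qed
  also have "\<dots> = ennreal (1/2) * L2_sq ?P d + ennreal (1/2) * L2_sq ?P (\<lambda>p. d (snd p, fst p))"
    by (simp add: nn_integral_add nn_integral_cmult)
  also have "L2_sq ?P (\<lambda>p. d (snd p, fst p)) = L2_sq ?P d"
    by (rule nn_integral_swap_lborel) measurable
  also have "ennreal (1/2) * L2_sq ?P d + ennreal (1/2) * L2_sq ?P d = L2_sq ?P d"
    by (subst distrib_right[symmetric], subst ennreal_plus[symmetric]) auto
  finally show ?thesis by (simp add: d_def)
qed

lemma measurable_symmetrization [measurable]:
  assumes [measurable]: "g \<in> borel_measurable lborel2"
  shows "symmetrization g \<in> borel_measurable lborel2"
  unfolding symmetrization_def by measurable

text \<open>Valid for every version \<open>Z\<close>. The approximating step functions may be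
  symmetrized: their integrals stay the same and, \<open>f\<close> being symmetric, they still
  converge. The moments are then compared termwise along the sequence.\<close>

theorem (in brownian_random_measure) double_wiener_ito_integral_moments:
  assumes Z: "has_double_wiener_ito_integral M W f Z" and sym: "\<And>x y. f (x, y) = f (y, x)"
  shows "integrable lborel2 (\<lambda>p. (f p)\<^sup>2)"
    "has_bochner_integral M (\<lambda>\<omega>. (Z \<omega>)\<^sup>2) (2 * (LINT p|lborel2. (f p)\<^sup>2))"
    "has_bochner_integral M (\<lambda>\<omega>. Z \<omega> ^ 3) (8 * (LINT p|lborel3. cyclic_product f p))"
proof -
  let ?P = "lborel2"
  have [measurable]: "f \<in> borel_measurable ?P" "Z \<in> borel_measurable M"
    using Z by (auto simp: has_double_wiener_ito_integral_def)
  obtain g Y where step: "\<And>k::nat. step_double_integral W (g k) (Y k)"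
    and g: "(\<lambda>k. L2_sq ?P (\<lambda>x. g k x - f x)) \<longlonglongrightarrow> 0"
    and Y: "(\<lambda>k. L2_sq M (\<lambda>\<omega>. Y k \<omega> - Z \<omega>)) \<longlonglongrightarrow> 0"
    using Z by (auto simp: has_double_wiener_ito_integral_def)
  note mom = step_double_integral_moments[OF step]
  have [measurable]: "g k \<in> borel_measurable ?P" for k by (rule mom)
  have amY: "all_moments M (Y k)" for k by (rule mom)
  have [measurable]: "Y k \<in> borel_measurable M" for k using amY by (rule all_moments_measurable)
  have iY: "integrable M (\<lambda>\<omega>. Y k \<omega> ^ n)" for k n using amY by (simp add: all_moments_def)
  define s where "s k = symmetrization (g k)" for k
  have [measurable]: "s k \<in> borel_measurable ?P" for k unfolding s_def by measurable
  have s: "(\<lambda>k. L2_sq ?P (\<lambda>x. s k x - f x)) \<longlonglongrightarrow> 0"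
    unfolding s_def
    by (rule tendsto_sandwich[OF _ _ tendsto_const g]) (auto intro!: always_eventually nn_integral_symmetrization_diff_le sym)
  have is2: "integrable ?P (\<lambda>x. (s k x)\<^sup>2)" and es: "expectation (\<lambda>\<omega>. (Y k \<omega>)\<^sup>2) = 2 * (LINT x|?P. (s k x)\<^sup>2)" for k
    using mom(3)[of k] unfolding s_def[symmetric] by (auto simp: has_bochner_integral_iff)
  have ic: "integrable lborel3 (cyclic_product (s k))"
    and ec: "expectation (\<lambda>\<omega>. Y k \<omega> ^ 3) = 8 * (LINT x|lborel3. cyclic_product (s k) x)" for k
    using mom(4)[of k] unfolding s_def[symmetric] by (auto simp: has_bochner_integral_iff)
  show f2: "integrable ?P (\<lambda>p. (f p)\<^sup>2)"
    by (rule square_integrable_L2_limit(1)[OF _ _ is2 s]) auto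
  have ls: "(\<lambda>k. LINT x|?P. (s k x)\<^sup>2) \<longlonglongrightarrow> (LINT x|?P. (f x)\<^sup>2)"
    by (rule square_integrable_L2_limit(2)[OF _ _ is2 s]) auto
  have Z2: "integrable M (\<lambda>\<omega>. (Z \<omega>)\<^sup>2)"
    by (rule square_integrable_L2_limit(1)[OF _ _ iY Y]) auto
  have "(\<lambda>k. expectation (\<lambda>\<omega>. (Y k \<omega>)\<^sup>2)) \<longlonglongrightarrow> expectation (\<lambda>\<omega>. (Z \<omega>)\<^sup>2)"
    by (rule square_integrable_L2_limit(2)[OF _ _ iY Y]) auto
  moreover have "(\<lambda>k. expectation (\<lambda>\<omega>. (Y k \<omega>)\<^sup>2)) \<longlonglongrightarrow> 2 * (LINT x|?P. (f x)\<^sup>2)"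
    unfolding es by (intro tendsto_intros ls)
  ultimately have "expectation (\<lambda>\<omega>. (Z \<omega>)\<^sup>2) = 2 * (LINT x|?P. (f x)\<^sup>2)"
    by (rule LIMSEQ_unique)
  with Z2 show "has_bochner_integral M (\<lambda>\<omega>. (Z \<omega>)\<^sup>2) (2 * (LINT p|?P. (f p)\<^sup>2))"
    by (simp add: has_bochner_integral_iff)
  obtain K where K: "\<And>k. norm (LINT x|?P. (s k x)\<^sup>2) \<le> K"
    using convergent_imp_Bseq[OF convergentI[OF ls]] by (auto simp: Bseq_def)
  have s0: "0 \<le> (LINT x|?P. (s k x)\<^sup>2)" for k by (intro integral_nonneg_AE) auto
  \<comment> \<open>Convergent second moments are bounded, and the comparison of fourth with second
    moments turns this into the uniform bound required for the cubes.\<close>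
  have C: "expectation (\<lambda>\<omega>. Y k \<omega> ^ 4) \<le> 27 * (2 * K)\<^sup>2" for k
  proof -
    have "expectation (\<lambda>\<omega>. Y k \<omega> ^ 4) \<le> 27 * (2 * (LINT x|?P. (s k x)\<^sup>2))\<^sup>2"
      using mom(5)[of k] unfolding es .
    also have "\<dots> \<le> 27 * (2 * K)\<^sup>2"
      using K[of k] s0[of k] by (intro mult_left_mono power_mono) auto
    finally show ?thesis .
  qed
  define B where "B = ennreal (max K (LINT x|?P. (f x)\<^sup>2))"
  have Bf: "L2_sq ?P f \<le> B"
    using f2 by (subst nn_integral_eq_integral) (auto simp: B_def intro!: ennreal_leI)
  have Bs: "L2_sq ?P (s k) \<le> B" for k
    using is2[of k] K[of k] by (subst nn_integral_eq_integral) (auto simp: B_def intro!: ennreal_leI)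
  have lc: "(\<lambda>k. \<integral>\<^sup>+p. ennreal \<bar>cyclic_product (s k) p - cyclic_product f p\<bar> \<partial>lborel3) \<longlonglongrightarrow> 0"
  proof (rule ennreal_tendsto_0_of_square[OF _ _ s])
    show "(\<integral>\<^sup>+p. ennreal \<bar>cyclic_product (s k) p - cyclic_product f p\<bar> \<partial>lborel3)\<^sup>2
      \<le> (9 * B\<^sup>2) * L2_sq ?P (\<lambda>x. s k x - f x)" for k
      by (rule nn_integral_cyclic_product_diff_le[OF _ _ Bf Bs]) auto
    show "9 * B\<^sup>2 < top" by (simp add: B_def power2_eq_square ennreal_mult_less_top)
  qed
  then have "\<forall>\<^sub>F k in sequentially. (\<integral>\<^sup>+p. ennreal \<bar>cyclic_product (s k) p - cyclic_product f p\<bar> \<partial>lborel3) < 1"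
    by (rule order_tendstoD) simp
  then obtain k where k: "(\<integral>\<^sup>+p. ennreal \<bar>cyclic_product (s k) p - cyclic_product f p\<bar> \<partial>lborel3) < 1"
    by (auto simp: eventually_sequentially)
  have "integrable lborel3 (\<lambda>p. cyclic_product (s k) p - cyclic_product f p)"
    using k by (auto simp: integrable_iff_bounded less_top intro: less_trans)
  from Bochner_Integration.integrable_diff[OF ic[of k] this]
  have icf: "integrable lborel3 (cyclic_product f)" by simp
  have "(\<lambda>k. LINT x|lborel3. cyclic_product (s k) x) \<longlonglongrightarrow> (LINT x|lborel3. cyclic_product f x)"
    by (rule tendsto_L1_int[OF ic icf]) (use lc in simp)
  then have "(\<lambda>k. expectation (\<lambda>\<omega>. Y k \<omega> ^ 3)) \<longlonglongrightarrow> 8 * (LINT x|lborel3. cyclic_product f x)"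
    unfolding ec by (intro tendsto_intros)
  moreover have "(\<lambda>k. expectation (\<lambda>\<omega>. Y k \<omega> ^ 3)) \<longlonglongrightarrow> expectation (\<lambda>\<omega>. Z \<omega> ^ 3)"
    by (rule L2_limit_cube(2)[OF amY _ Y C]) auto
  ultimately have "expectation (\<lambda>\<omega>. Z \<omega> ^ 3) = 8 * (LINT x|lborel3. cyclic_product f x)"
    using LIMSEQ_unique by blast
  moreover have "integrable M (\<lambda>\<omega>. Z \<omega> ^ 3)"
    by (rule L2_limit_cube(1)[OF amY _ Y C]) auto
  ultimately show "has_bochner_integral M (\<lambda>\<omega>. Z \<omega> ^ 3) (8 * (LINT p|lborel3. cyclic_product f p))"
    by (simp add: has_bochner_integral_iff)
qed

section \<open>Density of step functions and existence of the integral\<close>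

context brownian_random_measure
begin

definition step_approximable :: "(real \<times> real \<Rightarrow> real) \<Rightarrow> bool" where
  "step_approximable f \<longleftrightarrow> f \<in> borel_measurable lborel2 \<and>
    (\<forall>e>0. \<exists>g Y. step_double_integral W g Y \<and> L2_sq lborel2 (\<lambda>p. g p - f p) \<le> ennreal e)"

lemma step_approximable_step: "step_double_integral W g Y \<Longrightarrow> step_approximable g"
  unfolding step_approximable_def
  using step_double_integral_moments(1)[of g Y] by (auto intro!: exI[of _ g] exI[of _ Y])

lemma step_double_integral_0: "step_double_integral W (\<lambda>_. 0) (\<lambda>_. 0)"
  by (rule step_double_integralI[of "{}"]) (auto simp: step_kernel_def disjoint_family_on_def fun_eq_iff)

lemma step_approximable_limit:
  assumes [measurable]: "f \<in> borel_measurable lborel2"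
    and h: "\<And>k::nat. step_approximable (h k)"
    and lim: "(\<lambda>k. L2_sq lborel2 (\<lambda>p. h k p - f p)) \<longlonglongrightarrow> 0"
  shows "step_approximable f"
  unfolding step_approximable_def
proof (intro conjI allI impI)
  fix e :: real assume "0 < e"
  \<comment> \<open>The square of a sum is at most twice the sum of the squares, so two errors of
    \<open>e / 4\<close> add up to \<open>e\<close>.\<close>
  then have "\<forall>\<^sub>F k in sequentially. L2_sq lborel2 (\<lambda>p. h k p - f p) < ennreal (e / 4)"
    by (intro order_tendstoD(2)[OF lim]) simp
  then obtain k where k: "L2_sq lborel2 (\<lambda>p. h k p - f p) < ennreal (e / 4)"
    by (auto simp: eventually_sequentially)
  obtain g Y where g: "step_double_integral W g Y" "L2_sq lborel2 (\<lambda>p. g p - h k p) \<le> ennreal (e / 4)"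
    using h[of k] \<open>0 < e\<close> unfolding step_approximable_def by (meson zero_less_divide_iff zero_less_numeral)
  have [measurable]: "g \<in> borel_measurable lborel2" "h k \<in> borel_measurable lborel2"
    using step_double_integral_moments(1)[OF g(1)] h[of k] by (auto simp: step_approximable_def)
  have "L2_sq lborel2 (\<lambda>p. g p - f p) = L2_sq lborel2 (\<lambda>p. (g p - h k p) + (h k p - f p))"
    by simp
  also have "\<dots> \<le> 2 * L2_sq lborel2 (\<lambda>p. g p - h k p) + 2 * L2_sq lborel2 (\<lambda>p. h k p - f p)"
    by (rule nn_integral_square_add_le) auto
  also have "\<dots> \<le> 2 * ennreal (e / 4) + 2 * ennreal (e / 4)"
    using g(2) k by (intro add_mono mult_left_mono) auto
  also have "\<dots> = ennreal (2 * (e / 4)) + ennreal (2 * (e / 4))"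
    using ennreal_mult'[of 2 "e / 4"] by simp
  also have "\<dots> = ennreal e"
    using \<open>0 < e\<close> by (subst ennreal_plus[symmetric]) auto
  finally show "\<exists>g Y. step_double_integral W g Y \<and> L2_sq lborel2 (\<lambda>p. g p - f p) \<le> ennreal e"
    using g(1) by blast
qed fact

text \<open>The rate 4^(-k) is chosen for the existence proof, where it must absorb a factor 2^k and
  remain summable.\<close>

lemma step_approximable_seq:
  assumes "step_approximable f"
  obtains g Y where "\<And>k::nat. step_double_integral W (g k) (Y k)"
    "\<And>k. L2_sq lborel2 (\<lambda>p. g k p - f p) \<le> ennreal ((1/4) ^ k)"
proof -
  have "\<forall>k::nat. \<exists>gY. step_double_integral W (fst gY) (snd gY) \<and>
      L2_sq lborel2 (\<lambda>p. fst gY p - f p) \<le> ennreal ((1/4) ^ k)"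
  proof
    fix k :: nat
    have "0 < (1/4 :: real) ^ k" by simp
    then obtain g Y where "step_double_integral W g Y" "L2_sq lborel2 (\<lambda>p. g p - f p) \<le> ennreal ((1/4) ^ k)"
      using assms unfolding step_approximable_def by blast
    then show "\<exists>gY. step_double_integral W (fst gY) (snd gY) \<and>
      L2_sq lborel2 (\<lambda>p. fst gY p - f p) \<le> ennreal ((1/4) ^ k)"
      by (intro exI[of _ "(g, Y)"]) simp
  qed
  then obtain gY where "\<forall>k::nat. step_double_integral W (fst (gY k)) (snd (gY k)) \<and>
      L2_sq lborel2 (\<lambda>p. fst (gY k) p - f p) \<le> ennreal ((1/4) ^ k)" by metis
  then show ?thesis using that[of "\<lambda>k. fst (gY k)" "\<lambda>k. snd (gY k)"] by blast
qed

lemma tendsto_ennreal_quarter_powers: "(\<lambda>k. ennreal ((1/4) ^ k)) \<longlonglongrightarrow> 0"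
  using tendsto_ennrealI[OF LIMSEQ_power_zero[of "1/4 :: real"]] by simp

lemma step_approximable_linear:
  assumes f: "step_approximable f" and h: "step_approximable h"
  shows "step_approximable (\<lambda>p. a * f p + b * h p)"
proof -
  obtain g Y where g: "\<And>k::nat. step_double_integral W (g k) (Y k)"
    "\<And>k. L2_sq lborel2 (\<lambda>p. g k p - f p) \<le> ennreal ((1/4) ^ k)"
    using step_approximable_seq[OF f] by blast
  obtain g' Y' where g': "\<And>k::nat. step_double_integral W (g' k) (Y' k)"
    "\<And>k. L2_sq lborel2 (\<lambda>p. g' k p - h p) \<le> ennreal ((1/4) ^ k)"
    using step_approximable_seq[OF h] by blast
  have [measurable]: "g k \<in> borel_measurable lborel2" "g' k \<in> borel_measurable lborel2" for k
    using step_double_integral_moments(1) g(1) g'(1) by auto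
  have [measurable]: "f \<in> borel_measurable lborel2" "h \<in> borel_measurable lborel2"
    using f h by (auto simp: step_approximable_def)
  show ?thesis
  proof (rule step_approximable_limit)
    show "step_approximable (\<lambda>p. a * g k p + b * g' k p)" for k
      using step_double_integral_linear[OF g(1)[of k] g'(1)[of k], of a b] step_approximable_step by metis
    have "(\<lambda>k. (2 * ennreal (a\<^sup>2) + 2 * ennreal (b\<^sup>2)) * ennreal ((1/4) ^ k)) \<longlonglongrightarrow> (2 * ennreal (a\<^sup>2) + 2 * ennreal (b\<^sup>2)) * 0"
      by (intro ennreal_tendsto_cmult tendsto_ennreal_quarter_powers) (simp add: ennreal_mult_less_top)
    then have l: "(\<lambda>k. (2 * ennreal (a\<^sup>2) + 2 * ennreal (b\<^sup>2)) * ennreal ((1/4) ^ k)) \<longlonglongrightarrow> 0" by simp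
    show "(\<lambda>k. L2_sq lborel2 (\<lambda>p. a * g k p + b * g' k p - (a * f p + b * h p))) \<longlonglongrightarrow> 0"
    proof (rule tendsto_sandwich[OF _ _ tendsto_const l])
      show "\<forall>\<^sub>F k in sequentially. L2_sq lborel2 (\<lambda>p. a * g k p + b * g' k p - (a * f p + b * h p))
        \<le> (2 * ennreal (a\<^sup>2) + 2 * ennreal (b\<^sup>2)) * ennreal ((1/4) ^ k)"
      proof (intro always_eventually allI)
        fix k
        have "L2_sq lborel2 (\<lambda>p. a * g k p + b * g' k p - (a * f p + b * h p)) =
          L2_sq lborel2 (\<lambda>p. a * (g k p - f p) + b * (g' k p - h p))"
          by (simp add: algebra_simps)
        also have "\<dots> \<le> 2 * L2_sq lborel2 (\<lambda>p. a * (g k p - f p)) + 2 * L2_sq lborel2 (\<lambda>p. b * (g' k p - h p))"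
          by (rule nn_integral_square_add_le) auto
        also have "\<dots> = 2 * (ennreal (a\<^sup>2) * L2_sq lborel2 (\<lambda>p. g k p - f p)) + 2 * (ennreal (b\<^sup>2) * L2_sq lborel2 (\<lambda>p. g' k p - h p))"
          by (simp add: power_mult_distrib ennreal_mult nn_integral_cmult)
        also have "\<dots> \<le> 2 * (ennreal (a\<^sup>2) * ennreal ((1/4) ^ k)) + 2 * (ennreal (b\<^sup>2) * ennreal ((1/4) ^ k))"
          by (intro add_mono mult_left_mono g g') auto
        finally show "L2_sq lborel2 (\<lambda>p. a * g k p + b * g' k p - (a * f p + b * h p))
          \<le> (2 * ennreal (a\<^sup>2) + 2 * ennreal (b\<^sup>2)) * ennreal ((1/4) ^ k)" by (simp add: distrib_right mult.assoc)
      qed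
    qed simp
  qed measurable
qed

lemma step_approximable_0: "step_approximable (\<lambda>_. 0)"
  by (rule step_approximable_step[OF step_double_integral_0])

lemma step_approximable_sum:
  assumes "\<And>i. i \<in> I \<Longrightarrow> step_approximable (f i)"
  shows "step_approximable (\<lambda>p. \<Sum>i\<in>I. f i p)"
  using assms
proof (induction I rule: infinite_finite_induct)
  case (insert i I)
  then show ?case using step_approximable_linear[of "f i" "\<lambda>p. \<Sum>i\<in>I. f i p" 1 1] by simp
qed (simp_all add: step_approximable_0)

text \<open>Dominated convergence for the squared distances, which are at most
  \<open>4 * (w p)\<^sup>2\<close>.\<close>

lemma step_approximable_dominated:
  assumes h: "\<And>k::nat. step_approximable (h k)" and [measurable]: "w \<in> borel_measurable lborel2"
    and lim: "\<And>p. (\<lambda>k. h k p) \<longlonglongrightarrow> f p" and dom: "\<And>k p. \<bar>h k p\<bar> \<le> w p"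
    and w: "L2_sq lborel2 w < top"
  shows "step_approximable f"
proof -
  have [measurable]: "h k \<in> borel_measurable lborel2" for k
    using h by (simp add: step_approximable_def)
  have fm [measurable]: "f \<in> borel_measurable lborel2"
    by (rule borel_measurable_LIMSEQ_real[OF lim]) auto
  show ?thesis
  proof (rule step_approximable_limit[OF fm h])
    have fw: "\<bar>f p\<bar> \<le> w p" for p
      by (rule LIMSEQ_le_const2[OF tendsto_rabs[OF lim]]) (use dom in auto)
    have "(\<lambda>k. L2_sq lborel2 (\<lambda>p. h k p - f p)) \<longlonglongrightarrow> (\<integral>\<^sup>+p. 0 \<partial>lborel2)"
    proof (rule nn_integral_dominated_convergence[where w="\<lambda>p. 4 * ennreal ((w p)\<^sup>2)"])
      show "AE p in lborel2. ennreal ((h k p - f p)\<^sup>2) \<le> 4 * ennreal ((w p)\<^sup>2)" for k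
      proof (rule AE_I2)
        fix p
        have "\<bar>h k p - f p\<bar> \<le> 2 * w p" using dom[of k p] fw[of p] by linarith
        then have "(h k p - f p)\<^sup>2 \<le> (2 * w p)\<^sup>2" using abs_le_square_iff[of "h k p - f p" "2 * w p"] by simp
        from ennreal_leI[OF this] show "ennreal ((h k p - f p)\<^sup>2) \<le> 4 * ennreal ((w p)\<^sup>2)"
          by (simp add: power_mult_distrib ennreal_mult)
      qed
      show "AE p in lborel2. (\<lambda>k. ennreal ((h k p - f p)\<^sup>2)) \<longlonglongrightarrow> 0"
      proof (rule AE_I2)
        fix p
        have "(\<lambda>k. (h k p - f p)\<^sup>2) \<longlonglongrightarrow> (f p - f p)\<^sup>2" by (intro tendsto_intros lim)
        from tendsto_ennrealI[OF this] show "(\<lambda>k. ennreal ((h k p - f p)\<^sup>2)) \<longlonglongrightarrow> 0" by simp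
      qed
      show "(\<integral>\<^sup>+p. 4 * ennreal ((w p)\<^sup>2) \<partial>lborel2) < \<infinity>"
        using w by (simp add: nn_integral_cmult ennreal_mult_less_top)
    qed auto
    then show "(\<lambda>k. L2_sq lborel2 (\<lambda>p. h k p - f p)) \<longlonglongrightarrow> 0" by simp
  qed
qed

lemma step_approximable_disjoint_Times:
  assumes "S \<in> fmeasurable lborel" "T \<in> fmeasurable lborel" "S \<inter> T = {}"
  shows "step_approximable (indicator (S \<times> T))"
proof (rule step_approximable_step)
  define R where "R b = (if b then S else T)" for b
  have U: "(\<Sum>b\<in>UNIV. F b) = F True + F False" for F :: "bool \<Rightarrow> real"
    by (simp add: UNIV_bool)
  define c where "c b b' = (if b \<and> \<not> b' then 1 else 0 :: real)" for b b'
  show "step_double_integral W (indicator (S \<times> T)) (\<lambda>\<omega>. \<Sum>b\<in>UNIV. \<Sum>b'\<in>UNIV. c b b' * W (R b) \<omega> * W (R b') \<omega>)"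
  proof (rule step_double_integralI)
    show "disjoint_family_on R UNIV" using assms by (auto simp: disjoint_family_on_def R_def)
    show "indicator (S \<times> T) = step_kernel UNIV R c"
      by (simp add: fun_eq_iff step_kernel_def U c_def R_def indicator_times)
  qed (use assms in \<open>auto simp: R_def c_def\<close>)
qed

text \<open>Cut into \<open>n\<close> short intervals, the only parts of a rectangle which are not products of disjoint
  sets are those near the diagonal; their total measure is \<open>O(1 / n)\<close>.\<close>

lemma step_approximable_Times:
  fixes N :: real
  assumes N: "0 < N" and S: "S \<in> sets borel" "S \<subseteq> {-N..<N}" and T: "T \<in> sets borel" "T \<subseteq> {-N..<N}"
  shows "step_approximable (indicator (S \<times> T))"
proof -
  note [measurable] = S(1) T(1)
  define J where "J n i = {- N + 2 * N * real i / real n ..< - N + 2 * N * (real i + 1) / real n}" for n i :: nat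
  \<comment> \<open>The indicator of the diagonal squares of the grid. It bounds the approximation
    error pointwise, and its squared norm is the area of n squares of side 2 N / n, that is 4 N^2 /
    n.\<close>
  define K where "K n = step_kernel {..<n} (J n) (\<lambda>i j. if i = j then 1 else 0)" for n
  have Jf: "J n i \<in> fmeasurable lborel" for n i
    by (rule fmeasurableI2[OF fmeasurable_cbox[of "- N + 2 * N * real i / real n" "- N + 2 * N * (real i + 1) / real n"]])
      (auto simp: J_def)
  have Jm: "measure lborel (J n i) = 2 * N / n" if "n > 0" for n i
    using that N by (simp add: J_def divide_right_mono) (simp add: field_simps)
  have Jdis: "disjoint_family_on (J n) {..<n}" for n
  proof -
    have "J n i \<inter> J n j = {}" if "i < j" for i j
    proof -
      have "2 * N * (real i + 1) / real n \<le> 2 * N * real j / real n"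
        using that N by (intro divide_right_mono mult_left_mono) auto
      then show ?thesis by (auto simp: J_def)
    qed
    then show ?thesis unfolding disjoint_family_on_def by (metis Int_commute nat_neq_iff)
  qed
  have Jcov: "\<exists>i<n. x \<in> J n i" if n: "n > 0" and x: "- N \<le> x" "x < N" for n x
  proof -
    define i where "i = nat \<lfloor>(x + N) * n / (2 * N)\<rfloor>"
    have p: "0 \<le> (x + N) * n / (2 * N)" using x N by simp
    have "(x + N) * n / (2 * N) < n" using x N n by (simp add: field_simps)
    then have "i < n" unfolding i_def using p by (simp add: floor_less_iff nat_less_iff)
    moreover have "real i \<le> (x + N) * n / (2 * N)" "(x + N) * n / (2 * N) < real i + 1"
      unfolding i_def using p by (simp_all add: of_nat_nat)
    then have "x \<in> J n i" using N n by (auto simp: J_def field_simps)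
    ultimately show ?thesis by blast
  qed
  define h where "h n p = (\<Sum>i<n. \<Sum>j<n. if i = j then 0 else indicator ((S \<inter> J n i) \<times> (T \<inter> J n j)) p :: real)" for n p
  have SI: "S \<inter> J n i \<in> fmeasurable lborel" "T \<inter> J n i \<in> fmeasurable lborel" for n i
    using Jf[of n i] by (auto intro: fmeasurable_Int_fmeasurable simp: Int_commute[of _ "J n i"])
  have happ: "step_approximable (h n)" for n
    unfolding h_def[abs_def]
  proof (intro step_approximable_sum)
    fix i j assume ij: "i \<in> {..<n}" "j \<in> {..<n}"
    show "step_approximable (\<lambda>p. if i = j then 0 else indicator ((S \<inter> J n i) \<times> (T \<inter> J n j)) p)"
    proof (cases "i = j")
      case False
      then have "(S \<inter> J n i) \<inter> (T \<inter> J n j) = {}" using Jdis[of n] ij by (auto simp: disjoint_family_on_def)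
      then show ?thesis using False step_approximable_disjoint_Times[OF SI(1) SI(2)] by simp
    qed (simp add: step_approximable_0)
  qed
  have diff: "\<bar>h n p - indicator (S \<times> T) p\<bar> \<le> \<bar>K n p\<bar>" if n: "n > 0" for n p
  proof (cases "p \<in> S \<times> T")
    case False
    then have "h n p = 0" unfolding h_def by (auto intro!: sum.neutral simp: indicator_def)
    then show ?thesis using False by simp
  next
    case True
    obtain x y where p: "p = (x, y)" by force
    obtain a b where ab: "a < n" "b < n" "x \<in> J n a" "y \<in> J n b"
      using Jcov[OF n] True S(2) T(2) p by (metis SigmaE2 atLeastLessThan_iff subset_iff)
    have "(if i = j then 0 else indicator ((S \<inter> J n i) \<times> (T \<inter> J n j)) p) =
      (if i = j then 0 else 1 :: real) * indicator (J n i) x * indicator (J n j) y" for i j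
      using True p by (auto split: split_indicator)
    then have "h n p = step_kernel {..<n} (J n) (\<lambda>i j. if i = j then 0 else 1) (x, y)"
      unfolding h_def step_kernel_def prod.case by (simp only:)
    also have "\<dots> = (if a = b then 0 else 1)"
      using ab by (intro step_kernel_eq[OF _ Jf Jdis]) auto
    finally have "h n p = (if a = b then 0 else 1)" .
    moreover have "K n p = (if a = b then 1 else 0)"
      unfolding K_def p using ab by (intro step_kernel_eq[OF _ Jf Jdis]) auto
    ultimately show ?thesis using True by auto
  qed
  have Kint: "L2_sq lborel2 (K n) = ennreal (4 * N\<^sup>2 / n)" if n: "n > 0" for n
  proof -
    have K2: "(\<lambda>p. (K n p)\<^sup>2) = K n"
      unfolding K_def by (rule ext, subst step_kernel_comp[OF _ Jf Jdis, where F="\<lambda>x. x\<^sup>2"]) (auto simp: if_distrib[of "\<lambda>x. x\<^sup>2"] cong: if_cong)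
    have s: "(\<Sum>i<n. \<Sum>j<n. (if i = j then 1 else 0) * (measure lborel (J n i) * measure lborel (J n j))) = 4 * N\<^sup>2 / n"
    proof -
      have "(\<Sum>i<n. \<Sum>j<n. (if i = j then 1 else 0) * (measure lborel (J n i) * measure lborel (J n j))) = (\<Sum>i<n. (2 * N / n)\<^sup>2)"
      proof (intro sum.cong refl)
        fix i assume "i \<in> {..<n}"
        have "(\<Sum>j<n. (if i = j then 1 else 0) * (measure lborel (J n i) * measure lborel (J n j))) = (\<Sum>j<n. if j = i then (2 * N / n)\<^sup>2 else 0)"
          using n by (intro sum.cong refl) (simp add: Jm power2_eq_square)
        also have "\<dots> = (2 * N / n)\<^sup>2" using \<open>i \<in> {..<n}\<close> by (subst sum.delta) auto
        finally show "(\<Sum>j<n. (if i = j then 1 else 0) * (measure lborel (J n i) * measure lborel (J n j))) = (2 * N / n)\<^sup>2" .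
      qed
      also have "\<dots> = 4 * N\<^sup>2 / n" using n by (simp add: power2_eq_square)
      finally show ?thesis .
    qed
    have "has_bochner_integral lborel2 (K n) (4 * N\<^sup>2 / n)"
      unfolding K_def s[symmetric] by (rule has_bochner_integral_step_kernel[OF _ Jf Jdis]) simp
    then show ?thesis
      by (subst nn_integral_eq_integral) (auto simp: K2 has_bochner_integral_iff)
  qed
  have Km [measurable]: "K n \<in> borel_measurable lborel2" for n
    unfolding K_def by (rule measurable_step_kernel[OF _ Jf Jdis]) simp
  show ?thesis
  proof (rule step_approximable_limit[OF _ happ[of "Suc n" for n]])
    show "indicator (S \<times> T) \<in> borel_measurable lborel2" by measurable
    have "(\<lambda>n. 4 * N\<^sup>2 * inverse (real (Suc n))) \<longlonglongrightarrow> 4 * N\<^sup>2 * 0"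
      by (intro tendsto_intros LIMSEQ_inverse_real_of_nat)
    from tendsto_ennrealI[OF this]
    have l: "(\<lambda>n. ennreal (4 * N\<^sup>2 / Suc n)) \<longlonglongrightarrow> 0" by (simp add: divide_inverse)
    show "(\<lambda>n. L2_sq lborel2 (\<lambda>p. h (Suc n) p - indicator (S \<times> T) p)) \<longlonglongrightarrow> 0"
    proof (rule tendsto_sandwich[OF _ _ tendsto_const l])
      show "\<forall>\<^sub>F n in sequentially. L2_sq lborel2 (\<lambda>p. h (Suc n) p - indicator (S \<times> T) p) \<le> ennreal (4 * N\<^sup>2 / Suc n)"
        unfolding Kint[OF zero_less_Suc, symmetric] using diff
        by (intro always_eventually allI nn_integral_mono ennreal_leI) (simp add: abs_le_square_iff[symmetric])
    qed simp
  qed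
qed

text \<open>A Dynkin system argument from rectangles. Cutting with a fixed square keeps all norms
  finite, turns complements into differences of approximable indicators, and provides the dominating
  function for disjoint unions.\<close>

lemma step_approximable_indicator_bounded:
  fixes N :: real
  assumes N: "0 < N" and E: "E \<in> sets lborel2"
  shows "step_approximable (indicator (E \<inter> {-N..<N} \<times> {-N..<N}))"
proof -
  let ?Q = "{-N..<N} \<times> {-N..<N}"
  have sets_eq: "sets lborel2 = sigma_sets (UNIV :: (real \<times> real) set) {A \<times> B |A B. A \<in> sets borel \<and> B \<in> sets borel}"
    by (simp add: sets_pair_measure)
  have Qm: "?Q \<in> sets lborel2" by simp
  have Qf: "L2_sq lborel2 (\<lambda>p. indicator ?Q p) < top"
  proof -
    have "ennreal ((indicator ?Q p)\<^sup>2) = indicator ?Q p" for p by (simp split: split_indicator)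
    then have "L2_sq lborel2 (\<lambda>p. indicator ?Q p) = emeasure lborel2 ?Q"
      using nn_integral_indicator[OF Qm] by simp
    also have "\<dots> < top"
      using N by (subst lborel.emeasure_pair_measure_Times) (auto simp: ennreal_mult_less_top)
    finally show ?thesis .
  qed
  have "Int_stable {A \<times> B |A B. A \<in> sets borel \<and> B \<in> sets (borel :: real measure)}"
    by (auto simp: Int_stable_def Times_Int_Times) blast
  moreover have "{A \<times> B |A B. A \<in> sets borel \<and> B \<in> sets (borel :: real measure)} \<subseteq> Pow UNIV" by simp
  ultimately show ?thesis
    using E[unfolded sets_eq]
  proof (induction rule: sigma_sets_induct_disjoint)
    case (basic A)
    then obtain S T where A: "A = S \<times> T" "S \<in> sets borel" "T \<in> sets borel" by auto
    have "step_approximable (indicator ((S \<inter> {-N..<N}) \<times> (T \<inter> {-N..<N})))"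
      using A by (intro step_approximable_Times[OF N]) auto
    then show ?case by (simp add: A Times_Int_Times)
  next
    case empty
    then show ?case using step_approximable_0 by (simp add: indicator_def)
  next
    case (compl A)
    have "step_approximable (indicator ?Q)"
      using step_approximable_Times[OF N, of "{-N..<N}" "{-N..<N}"] by simp
    from step_approximable_linear[OF this compl(2), of 1 "-1"]
    show ?case by (rule arg_cong[where f=step_approximable, THEN iffD1, rotated]) (auto simp: fun_eq_iff indicator_def)
  next
    case (union F)
    show ?case
    proof (rule step_approximable_dominated[where w="indicator ?Q"])
      show "step_approximable (\<lambda>p. \<Sum>i<k. indicator (F i \<inter> ?Q) p)" for k
        by (intro step_approximable_sum union)
      have e: "(\<Sum>i<k. indicator (F i \<inter> ?Q) p) = (indicator (\<Union>i<k. F i \<inter> ?Q) p :: real)" for k p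
        using union(1) by (subst indicator_UN_disjoint) (auto simp: disjoint_family_on_def)
      show "(\<lambda>k. \<Sum>i<k. indicator (F i \<inter> ?Q) p) \<longlonglongrightarrow> (indicator ((\<Union>i. F i) \<inter> ?Q) p :: real)" for p
      proof (cases "\<exists>i. p \<in> F i \<inter> ?Q")
        case True
        then obtain i where i: "p \<in> F i \<inter> ?Q" by blast
        have "(\<Sum>i<k. indicator (F i \<inter> ?Q) p) = (indicator ((\<Union>i. F i) \<inter> ?Q) p :: real)" if "Suc i \<le> k" for k
        proof -
          have "p \<in> (\<Union>i<k. F i \<inter> ?Q)" "p \<in> (\<Union>i. F i) \<inter> ?Q" using i that by auto
          then show ?thesis unfolding e by (simp only: indicator_simps)
        qed
        then show ?thesis by (intro tendsto_eventually) (auto simp only: eventually_sequentially)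
      next
        case False
        then have "(\<Sum>i<k. indicator (F i \<inter> ?Q) p) = (0::real)" for k by (auto intro!: sum.neutral simp: indicator_def)
        moreover have "indicator ((\<Union>i. F i) \<inter> ?Q) p = (0::real)" using False by (auto simp: indicator_def)
        ultimately show ?thesis by simp
      qed
      show "\<bar>\<Sum>i<k. indicator (F i \<inter> ?Q) p\<bar> \<le> (indicator ?Q p :: real)" for k p
        unfolding e by (auto simp: indicator_def)
      show "indicator ?Q \<in> borel_measurable lborel2" by measurable
    qed (rule Qf)
  qed
qed

text \<open>Induction along the construction of nonnegative measurable functions. The finite norm of
  the target passes to its nonnegative summands and to the members of an increasing sequence, since
  all of them lie below it; indicators are exhausted by growing squares.\<close>

lemma step_approximable_nonneg:
  assumes "f \<in> borel_measurable lborel2" "\<And>p. 0 \<le> f p"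
    and "L2_sq lborel2 f < top"
  shows "step_approximable f"
  using assms
proof (induction rule: borel_measurable_induct_real)
  case (set E)
  show ?case
  proof (rule step_approximable_dominated[where w="indicator E"])
    show "step_approximable (indicator (E \<inter> {-real (Suc k)..<real (Suc k)} \<times> {-real (Suc k)..<real (Suc k)}))" for k
      by (rule step_approximable_indicator_bounded) (use set in auto)
    show "(\<lambda>k. indicator (E \<inter> {-real (Suc k)..<real (Suc k)} \<times> {-real (Suc k)..<real (Suc k)}) p) \<longlonglongrightarrow> (indicator E p :: real)" for p
    proof -
      obtain x y where p: "p = (x, y)" by force
      obtain n :: nat where n: "\<bar>x\<bar> < n" "\<bar>y\<bar> < n"
        using reals_Archimedean2[of "max \<bar>x\<bar> \<bar>y\<bar>"] by auto
      show ?thesis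
      proof (rule tendsto_eventually, rule eventually_sequentiallyI[of n])
        fix k assume "n \<le> k"
        then have "p \<in> {-real (Suc k)..<real (Suc k)} \<times> {-real (Suc k)..<real (Suc k)}"
          using n by (auto simp: p abs_less_iff)
        then show "indicator (E \<inter> {-real (Suc k)..<real (Suc k)} \<times> {-real (Suc k)..<real (Suc k)}) p = (indicator E p :: real)"
          by (simp add: indicator_def)
      qed
    qed
  qed (use set in \<open>auto simp: indicator_def\<close>)
next
  case (mult u c)
  show ?case
  proof (cases "c = 0")
    case True
    then show ?thesis using step_approximable_0 by simp
  next
    case False
    note [measurable] = mult(2)
    have "L2_sq lborel2 (\<lambda>p. c * u p) = ennreal (c\<^sup>2) * L2_sq lborel2 u"
      by (simp add: power_mult_distrib ennreal_mult nn_integral_cmult)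
    then have "L2_sq lborel2 u < top"
      using mult(5) False by (auto simp: ennreal_mult_less_top)
    from step_approximable_linear[OF mult(4)[OF this] step_approximable_0, of c 0] show ?thesis by simp
  qed
next
  case (add u v)
  have "L2_sq lborel2 u \<le> L2_sq lborel2 (\<lambda>p. v p + u p)"
    "L2_sq lborel2 v \<le> L2_sq lborel2 (\<lambda>p. v p + u p)"
    using add.hyps by (auto intro!: nn_integral_mono ennreal_leI power_mono)
  then have "step_approximable v" "step_approximable u"
    using add.prems by (auto intro!: add.IH elim: le_less_trans)
  from step_approximable_linear[OF this, of 1 1] show ?case by simp
next
  case (seq U)
  have le: "U k p \<le> f p" for k p
  proof (rule incseq_le)
    show "incseq (\<lambda>k. U k p)" using \<open>incseq U\<close> by (auto simp only: incseq_def le_fun_def)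
    show "(\<lambda>k. U k p) \<longlonglongrightarrow> f p" by (rule seq) (simp add: space_pair_measure)
  qed
  show ?case
  proof (rule step_approximable_dominated[where w=f])
    show "step_approximable (U k)" for k
    proof (rule seq.IH)
      have "L2_sq lborel2 (U k) \<le> L2_sq lborel2 f"
        using le seq.hyps by (intro nn_integral_mono ennreal_leI power_mono) auto
      then show "L2_sq lborel2 (U k) < top" using seq.prems by (rule le_less_trans)
    qed
  qed (use seq le assms in \<open>auto simp: space_pair_measure\<close>)
qed

section \<open>Continuity of the integral on step functions, and completeness\<close>

lemma expectation_step_diff_le:
  assumes "step_double_integral W g Y" "step_double_integral W h X"
  shows "L2_sq M (\<lambda>\<omega>. Y \<omega> - X \<omega>) \<le> 2 * L2_sq lborel2 (\<lambda>p. g p - h p)"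
proof -
  obtain V where V: "step_double_integral W (\<lambda>x. 1 * g x + (-1) * h x) V" "AE \<omega> in M. V \<omega> = 1 * Y \<omega> + (-1) * X \<omega>"
    using step_double_integral_linear[OF assms] by blast
  define d where "d = (\<lambda>x. 1 * g x + (-1) * h x)"
  note mV = step_double_integral_moments[OF V(1)[folded d_def]]
  note [measurable] = mV(1)
  have "L2_sq M (\<lambda>\<omega>. Y \<omega> - X \<omega>) = L2_sq M V"
    using V(2) by (intro nn_integral_cong_AE) auto
  also have "\<dots> = ennreal (expectation (\<lambda>\<omega>. (V \<omega>)\<^sup>2))"
    using mV(2) by (intro nn_integral_eq_integral) (auto simp: all_moments_def)
  also have "\<dots> = ennreal (2 * (LINT p|lborel2. (symmetrization d p)\<^sup>2))"
    using mV(3) by (simp add: has_bochner_integral_iff)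
  also have "\<dots> = 2 * L2_sq lborel2 (symmetrization d)"
    using mV(3) by (subst nn_integral_eq_integral) (auto simp: has_bochner_integral_iff ennreal_mult)
  \<comment> \<open>Up to here there is equality, the Ito isometry for the symmetrized difference;
    dropping the symmetrization costs only an inequality.\<close>
  also have "\<dots> \<le> 2 * L2_sq lborel2 d"
    using nn_integral_symmetrization_diff_le[of "\<lambda>_. 0" d] by (intro mult_left_mono) auto
  finally show ?thesis by (simp add: d_def)
qed

text \<open>The argument of Riesz and Fischer: the errors are so small that the increments of
  \<open>Y\<close> are summable in L^1, hence \<open>Y\<close> converges almost surely, and Fatou's
  lemma identifies the limit in L^2.\<close>

theorem ex_double_wiener_ito_integral:
  assumes fm [measurable]: "f \<in> borel_measurable lborel2" and f0: "\<And>p. 0 \<le> f p"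
    and f2: "L2_sq lborel2 f < top"
  shows "\<exists>Z. has_double_wiener_ito_integral M W f Z"
proof -
  obtain g Y where step: "\<And>k::nat. step_double_integral W (g k) (Y k)"
    and g: "\<And>k. L2_sq lborel2 (\<lambda>p. g k p - f p) \<le> ennreal ((1/4) ^ k)"
    using step_approximable_seq[OF step_approximable_nonneg[OF assms]] by blast
  have [measurable]: "g k \<in> borel_measurable lborel2" "Y k \<in> borel_measurable M" for k
    using step_double_integral_moments(1,2)[OF step[of k]] by (auto simp: all_moments_def)
  \<comment> \<open>8 = 2 (2 + 2): the outer 2 is the isometry constant, the inner ones come from
    inserting \<open>f\<close> between the two step functions.\<close>
  have d: "L2_sq M (\<lambda>\<omega>. Y k \<omega> - Y j \<omega>) \<le> ennreal (8 * (1/4) ^ k)" if "k \<le> j" for k j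
  proof -
    have "L2_sq M (\<lambda>\<omega>. Y k \<omega> - Y j \<omega>) \<le> 2 * L2_sq lborel2 (\<lambda>p. g k p - g j p)"
      by (rule expectation_step_diff_le[OF step step])
    also have "L2_sq lborel2 (\<lambda>p. g k p - g j p) = L2_sq lborel2 (\<lambda>p. (g k p - f p) + (f p - g j p))"
      by simp
    also have "\<dots> \<le> 2 * L2_sq lborel2 (\<lambda>p. g k p - f p) + 2 * L2_sq lborel2 (\<lambda>p. f p - g j p)"
      by (rule nn_integral_square_add_le) auto
    also have "L2_sq lborel2 (\<lambda>p. f p - g j p) = L2_sq lborel2 (\<lambda>p. g j p - f p)"
      by (simp add: power2_commute)
    also have "2 * L2_sq lborel2 (\<lambda>p. g k p - f p) + 2 * \<dots> \<le> 2 * ennreal ((1/4) ^ k) + 2 * ennreal ((1/4) ^ k)"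
    proof (intro add_mono mult_left_mono g)
      have "(1/4 :: real) ^ j \<le> (1/4) ^ k" using that by (intro power_decreasing) auto
      then show "L2_sq lborel2 (\<lambda>p. g j p - f p) \<le> ennreal ((1/4) ^ k)"
        by (intro order_trans[OF g] ennreal_leI)
    qed auto
    also have "2 * (2 * ennreal ((1/4) ^ k) + 2 * ennreal ((1/4) ^ k)) = ennreal (8 * (1/4) ^ k)"
    proof -
      have "2 * ennreal ((1/4) ^ k) = ennreal (2 * (1/4) ^ k)" by (simp add: ennreal_mult)
      moreover have "2 * (ennreal (2 * (1/4) ^ k) + ennreal (2 * (1/4) ^ k)) = ennreal (2 * (2 * (1/4) ^ k + 2 * (1/4) ^ k))"
        by (subst ennreal_plus[symmetric]) (simp_all add: ennreal_mult del: ennreal_plus)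
      ultimately show ?thesis by simp
    qed
    finally show ?thesis by (simp add: mult_left_mono)
  qed
  \<comment> \<open>Pointwise D is at most 2^k D^2 + 2^(-k), by completing the square. The first
    part integrates to at most 8 * 2^(-k), the second to 2^(-k).\<close>
  have d1: "(\<integral>\<^sup>+\<omega>. ennreal \<bar>Y k \<omega> - Y (Suc k) \<omega>\<bar> \<partial>M) \<le> ennreal (9 * (1/2) ^ k)" for k
  proof -
    have "(\<integral>\<^sup>+\<omega>. ennreal \<bar>Y k \<omega> - Y (Suc k) \<omega>\<bar> \<partial>M) \<le>
      (\<integral>\<^sup>+\<omega>. ennreal (2 ^ k) * ennreal ((Y k \<omega> - Y (Suc k) \<omega>)\<^sup>2) + ennreal ((1/2) ^ k) \<partial>M)"
    proof (intro nn_integral_mono)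
      fix \<omega>
      define D where "D = \<bar>Y k \<omega> - Y (Suc k) \<omega>\<bar>"
      have "0 \<le> 2 ^ k * (D - (1/2) ^ k)\<^sup>2 + 2 ^ k * D\<^sup>2 + (1/2) ^ k" by simp
      also have "\<dots> = 2 * (2 ^ k * D\<^sup>2) - 2 * (2 ^ k * (1/2) ^ k) * D + (2 ^ k * (1/2) ^ k) * (1/2) ^ k + (1/2) ^ k"
        by (simp add: power2_eq_square algebra_simps)
      also have "2 ^ k * (1/2) ^ k = (1::real)" by (simp flip: power_mult_distrib)
      finally have "D \<le> 2 ^ k * D\<^sup>2 + (1/2) ^ k" by simp
      then have "ennreal D \<le> ennreal (2 ^ k * D\<^sup>2 + (1/2) ^ k)" by (rule ennreal_leI)
      also have "\<dots> = ennreal (2 ^ k) * ennreal (D\<^sup>2) + ennreal ((1/2) ^ k)"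
        by (subst ennreal_plus) (simp_all add: ennreal_mult)
      finally show "ennreal \<bar>Y k \<omega> - Y (Suc k) \<omega>\<bar> \<le> ennreal (2 ^ k) * ennreal ((Y k \<omega> - Y (Suc k) \<omega>)\<^sup>2) + ennreal ((1/2) ^ k)"
        by (simp add: D_def)
    qed
    also have "\<dots> = ennreal (2 ^ k) * L2_sq M (\<lambda>\<omega>. Y k \<omega> - Y (Suc k) \<omega>) + ennreal ((1/2) ^ k)"
      by (simp add: nn_integral_add nn_integral_cmult emeasure_space_1)
    also have "\<dots> \<le> ennreal (2 ^ k) * ennreal (8 * (1/4) ^ k) + ennreal ((1/2) ^ k)"
      using d[of k "Suc k"] by (intro add_mono mult_left_mono) auto
    also have "\<dots> = ennreal (2 ^ k * (8 * (1/4) ^ k) + (1/2) ^ k)"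
      by (subst ennreal_plus) (simp_all add: ennreal_mult)
    also have "2 ^ k * (8 * (1/4) ^ k) + (1/2) ^ k = (9 * (1/2) ^ k :: real)"
    proof -
      have "(2::real) ^ k * (1/4) ^ k = (1/2) ^ k" by (simp flip: power_mult_distrib)
      then show ?thesis by simp
    qed
    finally show ?thesis .
  qed
  have "(\<integral>\<^sup>+\<omega>. (\<Sum>k. ennreal \<bar>Y k \<omega> - Y (Suc k) \<omega>\<bar>) \<partial>M) = (\<Sum>k. \<integral>\<^sup>+\<omega>. ennreal \<bar>Y k \<omega> - Y (Suc k) \<omega>\<bar> \<partial>M)"
    by (rule nn_integral_suminf) auto
  also have "\<dots> \<le> (\<Sum>k. ennreal (9 * (1/2) ^ k))"
    by (intro suminf_le d1) auto
  also have "\<dots> < top"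
    by (subst suminf_ennreal2) (auto intro!: summable_mult summable_geometric)
  finally have "AE \<omega> in M. (\<Sum>k. ennreal \<bar>Y k \<omega> - Y (Suc k) \<omega>\<bar>) \<noteq> top"
    by (intro nn_integral_PInf_AE[unfolded infinity_ennreal_def]) auto
  then have conv: "AE \<omega> in M. (\<lambda>k. Y k \<omega>) \<longlonglongrightarrow> lim (\<lambda>k. Y k \<omega>)"
  proof eventually_elim
    case (elim \<omega>)
    then have "summable (\<lambda>k. \<bar>Y k \<omega> - Y (Suc k) \<omega>\<bar>)" by (intro summable_suminf_not_top) auto
    then have "summable (\<lambda>k. Y k \<omega> - Y (Suc k) \<omega>)" by (rule summable_rabs_cancel)
    then have "convergent (\<lambda>n. \<Sum>k<n. Y k \<omega> - Y (Suc k) \<omega>)" by (simp add: summable_iff_convergent)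
    then have "convergent (\<lambda>n. Y 0 \<omega> - Y n \<omega>)" by (simp add: sum_lessThan_telescope'[of "\<lambda>k. Y k \<omega>"])
    from convergent_diff[OF convergent_const[of "Y 0 \<omega>"] this]
    have "convergent (\<lambda>n. Y n \<omega>)" by simp
    then show ?case by (simp add: convergent_LIMSEQ_iff)
  qed
  define Z where "Z \<omega> = lim (\<lambda>k. Y k \<omega>)" for \<omega>
  have [measurable]: "Z \<in> borel_measurable M" unfolding Z_def by measurable
  have Z: "L2_sq M (\<lambda>\<omega>. Y k \<omega> - Z \<omega>) \<le> ennreal (8 * (1/4) ^ k)" for k
  proof -
    have "L2_sq M (\<lambda>\<omega>. Y k \<omega> - Z \<omega>) = (\<integral>\<^sup>+\<omega>. liminf (\<lambda>j. ennreal ((Y k \<omega> - Y j \<omega>)\<^sup>2)) \<partial>M)"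
      using conv by (intro nn_integral_cong_AE, eventually_elim)
        (rule lim_imp_Liminf[symmetric], auto simp: Z_def intro!: tendsto_ennrealI tendsto_intros)
    also have "\<dots> \<le> liminf (\<lambda>j. L2_sq M (\<lambda>\<omega>. Y k \<omega> - Y j \<omega>))"
      by (rule nn_integral_liminf) auto
    also have "\<dots> \<le> ennreal (8 * (1/4) ^ k)"
      using d[of k] by (intro Liminf_le) (auto simp: eventually_sequentially)
    finally show ?thesis .
  qed
  have "has_double_wiener_ito_integral M W f Z"
    unfolding has_double_wiener_ito_integral_def
  proof (intro conjI exI allI)
    show "step_double_integral W (g k) (Y k)" for k by (rule step)
    show "(\<lambda>k. L2_sq lborel2 (\<lambda>x. g k x - f x)) \<longlonglongrightarrow> 0"
      by (rule tendsto_sandwich[OF _ _ tendsto_const tendsto_ennreal_quarter_powers]) (auto intro!: always_eventually g)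
    have "(\<lambda>k. 8 * ennreal ((1/4) ^ k)) \<longlonglongrightarrow> 8 * 0"
      by (intro ennreal_tendsto_cmult tendsto_ennreal_quarter_powers) simp
    then have l: "(\<lambda>k. ennreal (8 * (1/4) ^ k)) \<longlonglongrightarrow> 0" by (simp add: ennreal_mult)
    show "(\<lambda>k. L2_sq M (\<lambda>\<omega>. Y k \<omega> - Z \<omega>)) \<longlonglongrightarrow> 0"
      by (rule tendsto_sandwich[OF _ _ tendsto_const l]) (auto intro!: always_eventually Z)
  qed measurable
  then show ?thesis by blast
qed

end

section \<open>Power integrals\<close>

lemma measurable_pos_powr [measurable (raw)]:
  assumes [measurable]: "f \<in> borel_measurable M"
  shows "(\<lambda>x. pos_powr (f x) a) \<in> borel_measurable M"
  unfolding pos_powr_def by measurable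

lemma pos_powr_nonneg [simp]: "0 \<le> pos_powr x a"
  by (simp add: pos_powr_def)

lemma pos_powr_eq_0: "x \<le> 0 \<Longrightarrow> pos_powr x a = 0"
  by (simp add: pos_powr_def)

lemma pos_powr_mult: "0 < c \<Longrightarrow> pos_powr (c * x) a = c powr a * pos_powr x a"
  by (auto simp: pos_powr_def powr_mult zero_less_mult_iff)

lemma pos_powr_add: "pos_powr x a * pos_powr x b = pos_powr x (a + b)"
  by (simp add: pos_powr_def powr_add)

lemma nn_integral_pos_powr_Beta:
  assumes "0 < a" "0 < b"
  shows "(\<integral>\<^sup>+v. ennreal (pos_powr v (a - 1) * pos_powr (1 - v) (b - 1)) \<partial>lborel) = ennreal (Beta a b)"
proof -
  have "(\<integral>\<^sup>+v. ennreal (v powr (a - 1) * (1 - v) powr (b - 1)) * indicator {0..1} v \<partial>lborel) = ennreal (Beta a b)"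
    by (rule nn_integral_has_integral_lebesgue'[OF _ has_integral_Beta_real[OF assms]]) auto
  also have "(\<lambda>v. ennreal (v powr (a - 1) * (1 - v) powr (b - 1)) * indicator {0..1} v) =
      (\<lambda>v. ennreal (pos_powr v (a - 1) * pos_powr (1 - v) (b - 1)))"
    by (auto simp: fun_eq_iff pos_powr_def indicator_def)
  finally show ?thesis .
qed

text \<open>Euler's beta integral after the substitution r = s + (t - s) v; both sides vanish unless
  \<open>s < t\<close>.\<close>

lemma nn_integral_pos_powr_convolution:
  assumes "0 < a" "0 < b"
  shows "(\<integral>\<^sup>+r. ennreal (pos_powr (r - s) (a - 1) * pos_powr (t - r) (b - 1)) \<partial>lborel) =
    ennreal (Beta a b * pos_powr (t - s) (a + b - 1))"
proof (cases "s < t")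
  case False
  then have z: "pos_powr (r - s) (a - 1) * pos_powr (t - r) (b - 1) = 0" for r
    by (auto simp: pos_powr_def)
  show ?thesis unfolding z using False by (simp add: pos_powr_eq_0)
next
  case True
  define c where "c = t - s"
  have c: "0 < c" using True by (simp add: c_def)
  have "(\<integral>\<^sup>+r. ennreal (pos_powr (r - s) (a - 1) * pos_powr (t - r) (b - 1)) \<partial>lborel) =
    ennreal \<bar>c\<bar> * (\<integral>\<^sup>+v. ennreal (pos_powr (s + c * v - s) (a - 1) * pos_powr (t - (s + c * v)) (b - 1)) \<partial>lborel)"
    using c by (intro nn_integral_real_affine) auto
  also have "(\<lambda>v. pos_powr (s + c * v - s) (a - 1) * pos_powr (t - (s + c * v)) (b - 1)) =
    (\<lambda>v. c powr (a + b - 2) * (pos_powr v (a - 1) * pos_powr (1 - v) (b - 1)))"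
  proof
    fix v
    have "t - (s + c * v) = c * (1 - v)" by (simp add: c_def algebra_simps)
    moreover have "c powr (a + b - 2) = c powr (a - 1) * c powr (b - 1)" by (simp flip: powr_add)
    ultimately show "pos_powr (s + c * v - s) (a - 1) * pos_powr (t - (s + c * v)) (b - 1) =
      c powr (a + b - 2) * (pos_powr v (a - 1) * pos_powr (1 - v) (b - 1))"
      using c by (simp add: pos_powr_mult)
  qed
  also have "(\<integral>\<^sup>+v. ennreal (c powr (a + b - 2) * (pos_powr v (a - 1) * pos_powr (1 - v) (b - 1))) \<partial>lborel) =
      ennreal (c powr (a + b - 2)) * ennreal (Beta a b)"
    by (subst nn_integral_pos_powr_Beta[OF assms, symmetric], subst nn_integral_cmult[symmetric]) (simp_all add: ennreal_mult)
  also have "ennreal \<bar>c\<bar> * \<dots> = ennreal (Beta a b * pos_powr (t - s) (a + b - 1))"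
  proof -
    have "c * c powr (a + b - 2) = c powr (a + b - 1)" using c by (simp add: powr_mult_base)
    moreover have "0 \<le> Beta a b" using assms by (simp add: Beta_def)
    ultimately show ?thesis
      using c by (simp add: c_def[symmetric] pos_powr_def mult_ac flip: ennreal_mult)
  qed
  finally show ?thesis .
qed

text \<open>The beta integral over the half-line. The substitution u = d v / (1 - v) maps the unit
  interval onto it and satisfies u + d = d / (1 - v), so all powers of 1 - v combine. The two
  hypotheses on \<open>a\<close> and \<open>b\<close> make both beta arguments positive.\<close>

lemma nn_integral_pos_powr_shift:
  assumes a: "-1 < a" and ab: "a + b < -1" and d: "0 < d"
  shows "(\<integral>\<^sup>+u. ennreal (pos_powr u a * pos_powr (u + d) b) \<partial>lborel) =
    ennreal (Beta (a + 1) (- a - b - 1) * d powr (a + b + 1))"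
proof -
  define f where "f u = u powr a * (u + d) powr b" for u
  define g where "g v = d * v / (1 - v)" for v
  define g' where "g' v = d / (1 - v)\<^sup>2" for v
  \<comment> \<open>The integrand after substitution, with its exponents left in the shape "beta
    argument minus 1".\<close>
  define h where "h v = d powr (a + b + 1) * (pos_powr v (a + 1 - 1) * pos_powr (1 - v) (- a - b - 1 - 1))" for v
  have B: "0 \<le> Beta (a + 1) (- a - b - 1)" using a ab by (simp add: Beta_def)
  have nh: "(\<integral>\<^sup>+v. ennreal (h v) \<partial>lborel) = ennreal (d powr (a + b + 1) * Beta (a + 1) (- a - b - 1))"
    unfolding h_def using a ab B
    by (subst ennreal_mult, simp, simp, subst nn_integral_cmult, simp, subst nn_integral_pos_powr_Beta) (simp_all add: ennreal_mult)
  have fg: "indicator {0<..<1} v *\<^sub>R (f (g v) * g' v) = h v" for v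
  proof (cases "0 < v \<and> v < 1")
    case True
    have e: "g v + d = d / (1 - v)" using True by (simp add: g_def field_simps)
    have "f (g v) * g' v = (d powr a * v powr a / (1 - v) powr a) * (d powr b / (1 - v) powr b) * (d / (1 - v)\<^sup>2)"
      unfolding f_def e g'_def using True d by (simp add: g_def powr_mult powr_divide)
    also have "\<dots> = (d powr a * d powr b * d) * (v powr a * (1 / ((1 - v) powr a * (1 - v) powr b * (1 - v)\<^sup>2)))"
      by (simp add: divide_inverse mult_ac)
    also have "d powr a * d powr b * d = d powr (a + b + 1)"
      using d by (simp add: powr_add)
    also have "(1 - v) powr a * (1 - v) powr b * (1 - v)\<^sup>2 = (1 - v) powr (a + b + 2)"
      using True by (simp add: powr_add)
    also have "1 / (1 - v) powr (a + b + 2) = (1 - v) powr (- a - b - 2)"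
      using powr_minus_divide[of "1 - v" "a + b + 2"] by (simp add: algebra_simps)
    finally show ?thesis using True by (simp add: h_def pos_powr_def)
  qed (auto simp: h_def pos_powr_def)
  have hm: "h \<in> borel_measurable lborel" unfolding h_def by measurable
  have hi: "integrable lborel h"
    by (rule integrableI_nn_integral_finite[OF hm _ nh]) (use a ab B in \<open>auto simp: h_def\<close>)
  have e1: "einterval 0 1 = {0<..<1::real}" using einterval_eq_Icc[of 0 1] by (simp add: zero_ereal_def one_ereal_def)
  have e2: "einterval 0 \<infinity> = {0::real<..}" using einterval_eq_Ici[of 0] by (simp add: zero_ereal_def)
  have d1: "DERIV g x :> g' x" if "0 < ereal x" "ereal x < 1" for x
    unfolding g_def g'_def using that by (auto intro!: derivative_eq_intros simp: field_simps power2_eq_square)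
  have c1: "isCont f (g x)" if "0 < ereal x" "ereal x < 1" for x
  proof -
    have "0 < g x" using that d by (simp add: g_def)
    then show ?thesis unfolding f_def using d by (intro continuous_intros) auto
  qed
  have c2: "isCont g' x" if "0 < ereal x" "ereal x < 1" for x
    unfolding g'_def using that by (intro continuous_intros) auto
  have lA: "((ereal \<circ> g \<circ> real_of_ereal) \<longlongrightarrow> 0) (at_right 0)"
    unfolding zero_ereal_def ereal_tendsto_simps g_def by (rule tendsto_eq_intros refl | simp)+
  have lB: "((ereal \<circ> g \<circ> real_of_ereal) \<longlongrightarrow> \<infinity>) (at_left 1)"
    unfolding one_ereal_def ereal_tendsto_simps g_def using d by real_asymp
  have si: "set_integrable lborel (einterval 0 1) (\<lambda>x. f (g x) * g' x)"
    unfolding set_integrable_def e1 fg by (rule hi)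
  have f0: "0 \<le> f (g x)" for x by (simp add: f_def)
  have g0: "0 \<le> g' x" for x using d by (simp add: g'_def)
  note sub = interval_integral_substitution_nonneg[where a=0 and b=1 and f=f and g=g and g'=g', OF _ d1 c1 c2 f0 g0 lA lB si]
  have "set_integrable lborel {0<..} f" using sub(1) unfolding e2 by simp
  then have fi: "integrable lborel (\<lambda>u. indicator {0<..} u * f u)" by (simp add: set_integrable_def)
  have "(LBINT x=0..\<infinity>. f x) = (LBINT x=0..1. f (g x) * g' x)" using sub(2) by simp
  then have eq: "(LINT u|lborel. indicator {0<..} u * f u) = (LINT v|lborel. h v)"
    unfolding interval_lebesgue_integral_def set_lebesgue_integral_def e1 e2 fg by simp
  have "pos_powr u a * pos_powr (u + d) b = indicator {0<..} u * f u" for u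
    using d by (auto simp: pos_powr_def f_def indicator_def)
  then have "(\<integral>\<^sup>+u. ennreal (pos_powr u a * pos_powr (u + d) b) \<partial>lborel) = (\<integral>\<^sup>+u. ennreal (indicator {0<..} u * f u) \<partial>lborel)"
    by simp
  also have "\<dots> = ennreal (LINT u|lborel. indicator {0<..} u * f u)"
    by (rule nn_integral_eq_integral[OF fi]) (auto simp: f_def)
  also have "\<dots> = (\<integral>\<^sup>+v. ennreal (h v) \<partial>lborel)"
    unfolding eq by (rule nn_integral_eq_integral[OF hi, symmetric]) (auto simp: h_def)
  finally show ?thesis by (simp add: nh mult.commute)
qed

text \<open>The inner integral leaves (1 - s)^(h + 1) / (h + 1), and the outer one adds the factor 1
  / (h + 2). For the second moment the bound on \<open>h\<close> is the hypothesis
  \<open>\<gamma> 1 + \<gamma> 2 > -3/2\<close>.\<close>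

lemma nn_integral_triangle_pos_powr:
  assumes h: "-1 < h"
  shows "(\<integral>\<^sup>+s. \<integral>\<^sup>+t. ennreal (pos_powr (t - s) h) * indicator {0..1} s * indicator {0..1} t \<partial>lborel \<partial>lborel) =
    ennreal (1 / ((h + 1) * (h + 2)))"
proof -
  have inner: "(\<integral>\<^sup>+t. ennreal (pos_powr (t - s) h) * indicator {0..1} s * indicator {0..1} t \<partial>lborel) =
    ennreal (1 / (h + 1)) * (ennreal ((1 - s) powr (h + 1)) * indicator {0..1} s)" for s :: real
  proof (cases "s \<in> {0..1}")
    case True
    have "(\<integral>\<^sup>+t. ennreal (pos_powr (t - s) h) * indicator {0..1} s * indicator {0..1} t \<partial>lborel) =
      (\<integral>\<^sup>+t. ennreal (pos_powr (t - s) h) * indicator {0..1} t \<partial>lborel)" using True by simp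
    also have "\<dots> = ennreal \<bar>1\<bar> * (\<integral>\<^sup>+u. ennreal (pos_powr (s + 1 * u - s) h) * indicator {0..1} (s + 1 * u) \<partial>lborel)"
      by (intro nn_integral_real_affine) auto
    also have "(\<lambda>u. ennreal (pos_powr (s + 1 * u - s) h) * indicator {0..1} (s + 1 * u)) =
        (\<lambda>u. ennreal (u powr h) * indicator {0..1 - s} u)"
      using True by (auto simp: fun_eq_iff pos_powr_def indicator_def)
    also have "(\<integral>\<^sup>+u. ennreal (u powr h) * indicator {0..1 - s} u \<partial>lborel) = ennreal ((1 - s) powr (h + 1) / (h + 1))"
      using True by (intro nn_integral_has_integral_lebesgue'[OF _ has_integral_powr_from_0[OF h]]) auto
    finally show ?thesis using True h by (simp flip: ennreal_mult)
  qed simp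
  have "(\<integral>\<^sup>+s. ennreal ((1 - s) powr (h + 1)) * indicator {0..1} s \<partial>lborel) =
      ennreal \<bar>-1\<bar> * (\<integral>\<^sup>+u. ennreal ((1 - (1 + -1 * u)) powr (h + 1)) * indicator {0..1} (1 + -1 * u) \<partial>lborel)"
    by (intro nn_integral_real_affine) auto
  also have "(\<lambda>u. ennreal ((1 - (1 + -1 * u)) powr (h + 1)) * indicator {0..1} (1 + -1 * u)) =
      (\<lambda>u. ennreal (u powr (h + 1)) * indicator {0..1} (u::real))"
    by (auto simp: fun_eq_iff indicator_def)
  also have "(\<integral>\<^sup>+u. ennreal (u powr (h + 1)) * indicator {0..1} (u::real) \<partial>lborel) = ennreal (1 powr (h + 1 + 1) / (h + 1 + 1))"
    using h by (intro nn_integral_has_integral_lebesgue'[OF _ has_integral_powr_from_0]) auto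
  finally have "(\<integral>\<^sup>+s. ennreal ((1 - s) powr (h + 1)) * indicator {0..1} s \<partial>lborel) = ennreal (1 / (h + 2))"
    by (simp add: add.assoc)
  then show ?thesis
    unfolding inner using h by (simp add: nn_integral_cmult ennreal_mult[symmetric])
qed

section \<open>The kernel and the covariances of its slices\<close>

lemma nn_integral_symmetric2:
  fixes H :: "real \<times> real \<Rightarrow> ennreal"
  assumes [measurable]: "H \<in> borel_measurable lborel2" and sym: "\<And>s t. H (s, t) = H (t, s)"
  shows "(\<integral>\<^sup>+s. \<integral>\<^sup>+t. H (s, t) \<partial>lborel \<partial>lborel) = 2 * (\<integral>\<^sup>+s. \<integral>\<^sup>+t. H (s, t) * (if s < t then 1 else 0) \<partial>lborel \<partial>lborel)"
proof -
  have "(\<integral>\<^sup>+t. H (s, t) \<partial>lborel) = (\<integral>\<^sup>+t. H (s, t) * (if s < t then 1 else 0) + H (s, t) * (if t < s then 1 else 0) \<partial>lborel)" for s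
    using AE_lborel_singleton[of s] by (intro nn_integral_cong_AE) (auto elim!: eventually_mono)
  then have "(\<integral>\<^sup>+s. \<integral>\<^sup>+t. H (s, t) \<partial>lborel \<partial>lborel) =
     (\<integral>\<^sup>+s. \<integral>\<^sup>+t. H (s, t) * (if s < t then 1 else 0) \<partial>lborel \<partial>lborel) + (\<integral>\<^sup>+s. \<integral>\<^sup>+t. H (s, t) * (if t < s then 1 else 0) \<partial>lborel \<partial>lborel)"
    by (simp add: nn_integral_add)
  also have "(\<integral>\<^sup>+s. \<integral>\<^sup>+t. H (s, t) * (if t < s then 1 else 0) \<partial>lborel \<partial>lborel) = (\<integral>\<^sup>+t. \<integral>\<^sup>+s. H (t, s) * (if t < s then 1 else 0) \<partial>lborel \<partial>lborel)"
    by (subst sym, rule lborel_pair.Fubini') measurable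
  finally show ?thesis by (simp add: mult_2)
qed

lemma nn_integral_swap12:
  fixes E :: "real \<times> real \<times> real \<Rightarrow> ennreal"
  assumes [measurable]: "E \<in> borel_measurable lborel3"
  shows "(\<integral>\<^sup>+a. \<integral>\<^sup>+b. \<integral>\<^sup>+c. E (a, b, c) \<partial>lborel \<partial>lborel \<partial>lborel) = (\<integral>\<^sup>+a. \<integral>\<^sup>+b. \<integral>\<^sup>+c. E (b, a, c) \<partial>lborel \<partial>lborel \<partial>lborel)"
  by (rule lborel_pair.Fubini'[symmetric]) measurable

lemma nn_integral_swap23:
  fixes E :: "real \<times> real \<times> real \<Rightarrow> ennreal"
  assumes [measurable]: "E \<in> borel_measurable lborel3"
  shows "(\<integral>\<^sup>+a. \<integral>\<^sup>+b. \<integral>\<^sup>+c. E (a, b, c) \<partial>lborel \<partial>lborel \<partial>lborel) = (\<integral>\<^sup>+a. \<integral>\<^sup>+b. \<integral>\<^sup>+c. E (a, c, b) \<partial>lborel \<partial>lborel \<partial>lborel)"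
  by (intro nn_integral_cong lborel_pair.Fubini'[symmetric]) measurable

definition increasing3 :: "real \<times> real \<times> real \<Rightarrow> ennreal" where
  "increasing3 = (\<lambda>(a, b, c). if a < b \<and> b < c then 1 else 0)"

lemma measurable_increasing3 [measurable]: "increasing3 \<in> borel_measurable lborel3"
  unfolding increasing3_def by measurable

text \<open>Up to null sets the space splits into six orderings, and invariance under adjacent
  transpositions makes their contributions equal.\<close>

lemma nn_integral_symmetric3:
  fixes D :: "real \<times> real \<times> real \<Rightarrow> ennreal"
  assumes [measurable]: "D \<in> borel_measurable lborel3"
    and sym12: "\<And>a b c. D (b, a, c) = D (a, b, c)" and sym23: "\<And>a b c. D (a, c, b) = D (a, b, c)"
  shows "(\<integral>\<^sup>+a. \<integral>\<^sup>+b. \<integral>\<^sup>+c. D (a, b, c) \<partial>lborel \<partial>lborel \<partial>lborel) =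
    6 * (\<integral>\<^sup>+a. \<integral>\<^sup>+b. \<integral>\<^sup>+c. D (a, b, c) * increasing3 (a, b, c) \<partial>lborel \<partial>lborel \<partial>lborel)"
proof -
  let ?A = "\<lambda>\<kappa>. \<integral>\<^sup>+a. \<integral>\<^sup>+b. \<integral>\<^sup>+c. D (a, b, c) * increasing3 (\<kappa> a b c) \<partial>lborel \<partial>lborel \<partial>lborel"
  have "(\<integral>\<^sup>+a. \<integral>\<^sup>+b. \<integral>\<^sup>+c. D (a, b, c) \<partial>lborel \<partial>lborel \<partial>lborel) =
    (\<integral>\<^sup>+a. \<integral>\<^sup>+b. \<integral>\<^sup>+c. D (a, b, c) * increasing3 (a, b, c) + D (a, b, c) * increasing3 (a, c, b)
      + D (a, b, c) * increasing3 (b, a, c) + D (a, b, c) * increasing3 (b, c, a)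
      + D (a, b, c) * increasing3 (c, a, b) + D (a, b, c) * increasing3 (c, b, a) \<partial>lborel \<partial>lborel \<partial>lborel)"
  proof (rule nn_integral_cong)
    fix a
    show "(\<integral>\<^sup>+b. \<integral>\<^sup>+c. D (a, b, c) \<partial>lborel \<partial>lborel) = (\<integral>\<^sup>+b. \<integral>\<^sup>+c. D (a, b, c) * increasing3 (a, b, c) + D (a, b, c) * increasing3 (a, c, b)
      + D (a, b, c) * increasing3 (b, a, c) + D (a, b, c) * increasing3 (b, c, a)
      + D (a, b, c) * increasing3 (c, a, b) + D (a, b, c) * increasing3 (c, b, a) \<partial>lborel \<partial>lborel)"
      using AE_lborel_singleton[of a]
    proof (intro nn_integral_cong_AE, eventually_elim)
      fix b assume ba: "b \<noteq> a"
      show "(\<integral>\<^sup>+c. D (a, b, c) \<partial>lborel) = (\<integral>\<^sup>+c. D (a, b, c) * increasing3 (a, b, c) + D (a, b, c) * increasing3 (a, c, b)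
      + D (a, b, c) * increasing3 (b, a, c) + D (a, b, c) * increasing3 (b, c, a)
      + D (a, b, c) * increasing3 (c, a, b) + D (a, b, c) * increasing3 (c, b, a) \<partial>lborel)"
        using AE_lborel_singleton[of a] AE_lborel_singleton[of b]
      proof (intro nn_integral_cong_AE, eventually_elim)
        fix c assume "c \<noteq> a" "c \<noteq> b"
        then consider "a < b \<and> b < c" | "a < c \<and> c < b" | "b < a \<and> a < c" | "b < c \<and> c < a" | "c < a \<and> a < b" | "c < b \<and> b < a"
          using ba by linarith
        then show "D (a, b, c) = D (a, b, c) * increasing3 (a, b, c) + D (a, b, c) * increasing3 (a, c, b)
          + D (a, b, c) * increasing3 (b, a, c) + D (a, b, c) * increasing3 (b, c, a)
          + D (a, b, c) * increasing3 (c, a, b) + D (a, b, c) * increasing3 (c, b, a)"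
          by cases (simp_all add: increasing3_def)
      qed
    qed
  qed
  also have "\<dots> = ?A (\<lambda>a b c. (a, b, c)) + ?A (\<lambda>a b c. (a, c, b)) + ?A (\<lambda>a b c. (b, a, c))
      + ?A (\<lambda>a b c. (b, c, a)) + ?A (\<lambda>a b c. (c, a, b)) + ?A (\<lambda>a b c. (c, b, a))"
    by (simp add: nn_integral_add)
  \<comment> \<open>Each of the five equations applies one adjacent transposition and leads to an
    ordering closer to the increasing one.\<close>
  also have e1: "?A (\<lambda>a b c. (a, c, b)) = ?A (\<lambda>a b c. (a, b, c))"
    by (subst nn_integral_swap23[of "\<lambda>(a, b, c). D (a, b, c) * increasing3 (a, b, c)", simplified]) (simp_all add: sym23)
  also have e2: "?A (\<lambda>a b c. (b, a, c)) = ?A (\<lambda>a b c. (a, b, c))"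
    by (subst nn_integral_swap12[of "\<lambda>(a, b, c). D (a, b, c) * increasing3 (a, b, c)", simplified]) (simp_all add: sym12)
  also have e3: "?A (\<lambda>a b c. (b, c, a)) = ?A (\<lambda>a b c. (a, c, b))"
    by (subst nn_integral_swap12[of "\<lambda>(a, b, c). D (a, b, c) * increasing3 (a, c, b)", simplified]) (simp_all add: sym12)
  also have e4: "?A (\<lambda>a b c. (c, a, b)) = ?A (\<lambda>a b c. (b, a, c))"
    by (subst nn_integral_swap23[of "\<lambda>(a, b, c). D (a, b, c) * increasing3 (b, a, c)", simplified]) (simp_all add: sym23)
  also have e5: "?A (\<lambda>a b c. (c, b, a)) = ?A (\<lambda>a b c. (c, a, b))"
    by (subst nn_integral_swap12[of "\<lambda>(a, b, c). D (a, b, c) * increasing3 (c, a, b)", simplified]) (simp_all add: sym12)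
  also note e1 also note e4 also note e2
  finally show ?thesis
    by (simp add: e1 e2 e4) (metis (no_types, lifting) add.assoc distrib_right mult_1 numeral_Bit0 numeral_Bit1 numeral_One)
qed

text \<open>The values lie in \<open>ennreal\<close> so that integrals can be interchanged before
  anything is known to be finite. The cutoff to the unit interval sits in every factor; being
  idempotent, it may be repeated in products.\<close>

definition kernel_factor :: "real \<Rightarrow> real \<Rightarrow> real \<Rightarrow> ennreal" where
  "kernel_factor a s x = ennreal (pos_powr (s - x) a) * indicator {0..1} s"

lemma measurable_kernel_factor [measurable (raw)]:
  assumes [measurable]: "f \<in> borel_measurable M" "g \<in> borel_measurable M"
  shows "(\<lambda>w. kernel_factor a (f w) (g w)) \<in> borel_measurable M"
  unfolding kernel_factor_def by measurable

definition factor_cov :: "real \<Rightarrow> real \<Rightarrow> real \<Rightarrow> real \<Rightarrow> ennreal" where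
  "factor_cov a b s t = (\<integral>\<^sup>+x. kernel_factor a s x * kernel_factor b t x \<partial>lborel)"

lemma measurable_factor_cov [measurable (raw)]:
  assumes [measurable]: "f \<in> borel_measurable M" "g \<in> borel_measurable M"
  shows "(\<lambda>w. factor_cov a b (f w) (g w)) \<in> borel_measurable M"
  unfolding factor_cov_def by measurable

lemma factor_cov_commute: "factor_cov a b s t = factor_cov b a t s"
  by (simp add: factor_cov_def mult.commute)

text \<open>The substitution u = s - x leads to the half-line beta integral. The result depends on
  which time is earlier: its exponent enters the first beta argument. This asymmetry is the reason
  for reducing all time integrals to ordered times.\<close>

lemma factor_cov_less:
  assumes a: "-1 < a" and ab: "a + b < -1" and st: "s < t"
  shows "factor_cov a b s t = ennreal (Beta (a + 1) (- a - b - 1) * pos_powr (t - s) (a + b + 1)) *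
    (indicator {0..1} s * indicator {0..1} t)"
proof -
  have "factor_cov a b s t = (\<integral>\<^sup>+x. ennreal (pos_powr (s - x) a * pos_powr (t - x) b) * (indicator {0..1} s * indicator {0..1} t) \<partial>lborel)"
    unfolding factor_cov_def kernel_factor_def by (intro nn_integral_cong) (simp add: ennreal_mult mult_ac)
  also have "\<dots> = (\<integral>\<^sup>+x. ennreal (pos_powr (s - x) a * pos_powr (t - x) b) \<partial>lborel) * (indicator {0..1} s * indicator {0..1} t)"
    by (rule nn_integral_multc) measurable
  also have "(\<integral>\<^sup>+x. ennreal (pos_powr (s - x) a * pos_powr (t - x) b) \<partial>lborel) =
    ennreal \<bar>-1\<bar> * (\<integral>\<^sup>+u. ennreal (pos_powr (s - (s + -1 * u)) a * pos_powr (t - (s + -1 * u)) b) \<partial>lborel)"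
    by (rule nn_integral_real_affine) auto
  also have "\<dots> = (\<integral>\<^sup>+u. ennreal (pos_powr u a * pos_powr (u + (t - s)) b) \<partial>lborel)"
    by (simp add: algebra_simps)
  also have "\<dots> = ennreal (Beta (a + 1) (- a - b - 1) * (t - s) powr (a + b + 1))"
    using st by (intro nn_integral_pos_powr_shift a ab) auto
  finally show ?thesis using st by (simp add: pos_powr_def)
qed

lemma nn_integral_product3:
  fixes A B C :: "real \<Rightarrow> ennreal"
  assumes [measurable]: "A \<in> borel_measurable lborel" "B \<in> borel_measurable lborel" "C \<in> borel_measurable lborel"
  shows "(\<integral>\<^sup>+x. \<integral>\<^sup>+y. \<integral>\<^sup>+z. A x * B y * C z \<partial>lborel \<partial>lborel \<partial>lborel) =
    (\<integral>\<^sup>+x. A x \<partial>lborel) * (\<integral>\<^sup>+y. B y \<partial>lborel) * (\<integral>\<^sup>+z. C z \<partial>lborel)"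
  by (simp add: nn_integral_cmult nn_integral_multc mult.assoc)

context
  fixes \<gamma> :: "nat \<Rightarrow> real"
begin

text \<open>The integrand of the kernel at time \<open>s\<close>, written as a sum over an index and
  its complement \<open>3 - i\<close>, so that products of slices expand directly into sums over
  index tuples.\<close>

definition slice :: "real \<Rightarrow> real \<Rightarrow> real \<Rightarrow> ennreal" where
  "slice s x y = (\<Sum>i\<in>{1, 2}. kernel_factor (\<gamma> i) s x * kernel_factor (\<gamma> (3 - i)) s y)"

lemma slice_commute: "slice s x y = slice s y x"
  by (simp add: slice_def mult.commute add.commute)

lemma measurable_slice [measurable (raw)]:
  assumes [measurable]: "f \<in> borel_measurable M" "g \<in> borel_measurable M" "h \<in> borel_measurable M"
  shows "(\<lambda>w. slice (f w) (g w) (h w)) \<in> borel_measurable M"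
  unfolding slice_def by measurable

definition nn_kernel :: "real \<Rightarrow> real \<Rightarrow> ennreal" where
  "nn_kernel x y = (\<integral>\<^sup>+s. slice s x y \<partial>lborel)"

lemma nn_kernel_commute: "nn_kernel x y = nn_kernel y x"
  unfolding nn_kernel_def by (subst slice_commute) simp

lemma measurable_nn_kernel [measurable (raw)]:
  assumes [measurable]: "g \<in> borel_measurable M" "h \<in> borel_measurable M"
  shows "(\<lambda>w. nn_kernel (g w) (h w)) \<in> borel_measurable M"
  unfolding nn_kernel_def by measurable

text \<open>Holds at every point, including those where the integral over \<open>s\<close> diverges:
  there the Bochner integral and \<open>enn2real\<close> of infinity are both 0.\<close>

lemma rosenblatt_kernel_eq: "rosenblatt_kernel (\<gamma> 1) (\<gamma> 2) (x, y) = enn2real (nn_kernel x y)"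
proof -
  have "rosenblatt_kernel (\<gamma> 1) (\<gamma> 2) (x, y) =
    (LINT s|lborel. indicator {0..1} s *\<^sub>R (pos_powr (s - x) (\<gamma> 1) * pos_powr (s - y) (\<gamma> 2) + pos_powr (s - x) (\<gamma> 2) * pos_powr (s - y) (\<gamma> 1)))"
    by (simp add: rosenblatt_kernel_def set_lebesgue_integral_def)
  also have "\<dots> = enn2real (\<integral>\<^sup>+s. ennreal (indicator {0..1} s *\<^sub>R (pos_powr (s - x) (\<gamma> 1) * pos_powr (s - y) (\<gamma> 2) + pos_powr (s - x) (\<gamma> 2) * pos_powr (s - y) (\<gamma> 1))) \<partial>lborel)"
    by (rule integral_eq_nn_integral) auto
  also have "(\<integral>\<^sup>+s. ennreal (indicator {0..1} s *\<^sub>R (pos_powr (s - x) (\<gamma> 1) * pos_powr (s - y) (\<gamma> 2) + pos_powr (s - x) (\<gamma> 2) * pos_powr (s - y) (\<gamma> 1))) \<partial>lborel) = nn_kernel x y"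
    unfolding nn_kernel_def slice_def kernel_factor_def
    by (intro nn_integral_cong) (auto simp: ennreal_mult indicator_def ennreal_plus)
  finally show ?thesis .
qed

definition cov2 :: "real \<times> real \<Rightarrow> ennreal" where
  "cov2 = (\<lambda>(s, t). \<Sum>i\<in>{1, 2}. \<Sum>j\<in>{1, 2}. factor_cov (\<gamma> i) (\<gamma> j) s t * factor_cov (\<gamma> (3 - i)) (\<gamma> (3 - j)) s t)"

lemma measurable_cov2 [measurable]: "cov2 \<in> borel_measurable lborel2"
  unfolding cov2_def by measurable

text \<open>The square is a double integral over two times. After Tonelli, for fixed times, each
  product of slices separates into an integral over x and one over y.\<close>

lemma nn_kernel_sq:
  "(\<integral>\<^sup>+p. (nn_kernel (fst p) (snd p))\<^sup>2 \<partial>lborel2) = (\<integral>\<^sup>+s. \<integral>\<^sup>+t. cov2 (s, t) \<partial>lborel \<partial>lborel)"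
proof -
  let ?P = "lborel2"
  interpret PP: pair_sigma_finite ?P ?P
    using sigma_finite_lborel_pair by (simp add: pair_sigma_finite_def)
  have "(nn_kernel (fst p) (snd p))\<^sup>2 = (\<integral>\<^sup>+q. slice (fst q) (fst p) (snd p) * slice (snd q) (fst p) (snd p) \<partial>?P)" for p
    unfolding nn_kernel_def power2_eq_square
    by (subst lborel.nn_integral_fst[symmetric], measurable) (simp add: nn_integral_cmult nn_integral_multc)
  then have "(\<integral>\<^sup>+p. (nn_kernel (fst p) (snd p))\<^sup>2 \<partial>?P) = (\<integral>\<^sup>+p. \<integral>\<^sup>+q. slice (fst q) (fst p) (snd p) * slice (snd q) (fst p) (snd p) \<partial>?P \<partial>?P)"
    by simp
  also have "\<dots> = (\<integral>\<^sup>+q. \<integral>\<^sup>+p. slice (fst q) (fst p) (snd p) * slice (snd q) (fst p) (snd p) \<partial>?P \<partial>?P)"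
    by (rule PP.Fubini') measurable
  also have "\<dots> = (\<integral>\<^sup>+q. cov2 q \<partial>?P)"
  proof (intro nn_integral_cong)
    fix q :: "real \<times> real"
    obtain s t where q: "q = (s, t)" by force
    have "(\<integral>\<^sup>+p. slice (fst q) (fst p) (snd p) * slice (snd q) (fst p) (snd p) \<partial>?P) =
      (\<integral>\<^sup>+x. \<integral>\<^sup>+y. slice s x y * slice t x y \<partial>lborel \<partial>lborel)"
      unfolding q by (subst lborel.nn_integral_fst[symmetric]) simp_all
    also have "\<dots> = (\<integral>\<^sup>+x. \<integral>\<^sup>+y. (\<Sum>i\<in>{1, 2}. \<Sum>j\<in>{1, 2}. (kernel_factor (\<gamma> i) s x * kernel_factor (\<gamma> j) t x) *
        (kernel_factor (\<gamma> (3 - i)) s y * kernel_factor (\<gamma> (3 - j)) t y)) \<partial>lborel \<partial>lborel)"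
      unfolding slice_def sum_product by (intro nn_integral_cong sum.cong refl) (simp add: mult_ac)
    also have "\<dots> = (\<Sum>i\<in>{1, 2}. \<Sum>j\<in>{1, 2}. \<integral>\<^sup>+x. \<integral>\<^sup>+y. (kernel_factor (\<gamma> i) s x * kernel_factor (\<gamma> j) t x) *
        (kernel_factor (\<gamma> (3 - i)) s y * kernel_factor (\<gamma> (3 - j)) t y) \<partial>lborel \<partial>lborel)"
      by (simp add: nn_integral_add)
    also have "\<dots> = cov2 q"
      unfolding q cov2_def prod.case factor_cov_def
      by (intro sum.cong refl) (simp add: nn_integral_cmult nn_integral_multc)
    finally show "(\<integral>\<^sup>+p. slice (fst q) (fst p) (snd p) * slice (snd q) (fst p) (snd p) \<partial>?P) = cov2 q" .
  qed
  also have "\<dots> = (\<integral>\<^sup>+s. \<integral>\<^sup>+t. cov2 (s, t) \<partial>lborel \<partial>lborel)"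
    by (rule lborel.nn_integral_fst[symmetric]) measurable
  finally show ?thesis .
qed

text \<open>The times s, t, r belong to the edges xy, yz, zx of a triangle, and each covariance
  belongs to a vertex: x meets s and r, y meets s and t, z meets t and r. The indices i, j, k are
  those of the slices at s, t, r.\<close>

definition cov3 :: "real \<times> real \<times> real \<Rightarrow> ennreal" where
  "cov3 = (\<lambda>(s, t, r). \<Sum>i\<in>{1, 2}. \<Sum>j\<in>{1, 2}. \<Sum>k\<in>{1, 2}.
    factor_cov (\<gamma> i) (\<gamma> (3 - k)) s r * factor_cov (\<gamma> (3 - i)) (\<gamma> j) s t * factor_cov (\<gamma> (3 - j)) (\<gamma> k) t r)"

lemma measurable_cov3 [measurable]: "cov3 \<in> borel_measurable lborel3"
  unfolding cov3_def by measurable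

lemma nn_kernel_cyclic:
  "(\<integral>\<^sup>+x. \<integral>\<^sup>+y. \<integral>\<^sup>+z. nn_kernel x y * nn_kernel y z * nn_kernel z x \<partial>lborel \<partial>lborel \<partial>lborel) =
    (\<integral>\<^sup>+s. \<integral>\<^sup>+t. \<integral>\<^sup>+r. cov3 (s, t, r) \<partial>lborel \<partial>lborel \<partial>lborel)"
proof -
  let ?P = "lborel3"
  define G where "G p q = slice (fst q) (fst p) (fst (snd p)) * slice (fst (snd q)) (fst (snd p)) (snd (snd p)) * slice (snd (snd q)) (snd (snd p)) (fst p)" for p q
  have [measurable]: "(\<lambda>(p, q). G p q) \<in> borel_measurable (?P \<Otimes>\<^sub>M ?P)"
    unfolding G_def by measurable
  interpret PP: pair_sigma_finite ?P ?P
    using sigma_finite_pair_measure[OF lborel.sigma_finite_measure_axioms sigma_finite_lborel_pair]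
    by (simp add: pair_sigma_finite_def)
  have "nn_kernel x y * nn_kernel y z * nn_kernel z x = (\<integral>\<^sup>+q. G (x, y, z) q \<partial>?P)" for x y z
  proof -
    have "(\<integral>\<^sup>+q. G (x, y, z) q \<partial>?P) = (\<integral>\<^sup>+s. \<integral>\<^sup>+t. \<integral>\<^sup>+r. slice s x y * slice t y z * slice r z x \<partial>lborel \<partial>lborel \<partial>lborel)"
      by (subst nn_integral_lborel_triple) (simp_all add: G_def)
    also have "\<dots> = nn_kernel x y * nn_kernel y z * nn_kernel z x"
      unfolding nn_kernel_def by (rule nn_integral_product3) measurable
    finally show ?thesis by simp
  qed
  then have "(\<integral>\<^sup>+x. \<integral>\<^sup>+y. \<integral>\<^sup>+z. nn_kernel x y * nn_kernel y z * nn_kernel z x \<partial>lborel \<partial>lborel \<partial>lborel) =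
    (\<integral>\<^sup>+x. \<integral>\<^sup>+y. \<integral>\<^sup>+z. (\<integral>\<^sup>+q. G (x, y, z) q \<partial>?P) \<partial>lborel \<partial>lborel \<partial>lborel)" by simp
  also have "\<dots> = (\<integral>\<^sup>+p. \<integral>\<^sup>+q. G p q \<partial>?P \<partial>?P)"
    by (subst nn_integral_lborel_triple[symmetric]) simp_all
  also have "\<dots> = (\<integral>\<^sup>+q. \<integral>\<^sup>+p. G p q \<partial>?P \<partial>?P)"
    by (rule PP.Fubini') measurable
  also have "\<dots> = (\<integral>\<^sup>+q. cov3 q \<partial>?P)"
  proof (intro nn_integral_cong)
    fix q :: "real \<times> real \<times> real"
    obtain s t r where q: "q = (s, t, r)" by (metis prod.exhaust)
    have "(\<integral>\<^sup>+p. G p q \<partial>?P) = (\<integral>\<^sup>+x. \<integral>\<^sup>+y. \<integral>\<^sup>+z. slice s x y * slice t y z * slice r z x \<partial>lborel \<partial>lborel \<partial>lborel)"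
      unfolding q by (subst nn_integral_lborel_triple) (simp_all add: G_def)
    also have "\<dots> = (\<integral>\<^sup>+x. \<integral>\<^sup>+y. \<integral>\<^sup>+z. (\<Sum>i\<in>{1, 2}. \<Sum>j\<in>{1, 2}. \<Sum>k\<in>{1, 2}.
        (kernel_factor (\<gamma> i) s x * kernel_factor (\<gamma> (3 - k)) r x) *
        (kernel_factor (\<gamma> (3 - i)) s y * kernel_factor (\<gamma> j) t y) *
        (kernel_factor (\<gamma> (3 - j)) t z * kernel_factor (\<gamma> k) r z)) \<partial>lborel \<partial>lborel \<partial>lborel)"
      unfolding slice_def by (intro nn_integral_cong) (simp add: algebra_simps)
    also have "\<dots> = (\<Sum>i\<in>{1, 2}. \<Sum>j\<in>{1, 2}. \<Sum>k\<in>{1, 2}. \<integral>\<^sup>+x. \<integral>\<^sup>+y. \<integral>\<^sup>+z.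
        (kernel_factor (\<gamma> i) s x * kernel_factor (\<gamma> (3 - k)) r x) *
        (kernel_factor (\<gamma> (3 - i)) s y * kernel_factor (\<gamma> j) t y) *
        (kernel_factor (\<gamma> (3 - j)) t z * kernel_factor (\<gamma> k) r z) \<partial>lborel \<partial>lborel \<partial>lborel)"
      by (simp add: nn_integral_add)
    also have "\<dots> = cov3 q"
      unfolding q cov3_def prod.case factor_cov_def by (intro sum.cong refl nn_integral_product3) measurable
    finally show "(\<integral>\<^sup>+p. G p q \<partial>?P) = cov3 q" .
  qed
  also have "\<dots> = (\<integral>\<^sup>+s. \<integral>\<^sup>+t. \<integral>\<^sup>+r. cov3 (s, t, r) \<partial>lborel \<partial>lborel \<partial>lborel)"
    by (rule nn_integral_lborel_triple) measurable
  finally show ?thesis .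
qed

lemma cov2_sym: "cov2 (s, t) = cov2 (t, s)"
  unfolding cov2_def prod.case
  by (subst sum.swap) (simp add: factor_cov_commute[of _ _ t s])

text \<open>Exchanging two times reverses the orientation of the triangle; the summation index (i,
  j, k) is replaced by (3 - j, 3 - i, 3 - k).\<close>

lemma cov3_sym12: "cov3 (t, s, r) = cov3 (s, t, r)"
  unfolding cov3_def prod.case by (simp add: factor_cov_commute[of _ _ t s] add_ac mult_ac)

lemma cov3_sym23: "cov3 (s, r, t) = cov3 (s, t, r)"
  unfolding cov3_def prod.case by (simp add: factor_cov_commute[of _ _ r t] add_ac mult_ac)

end

section \<open>The two norms of the kernel\<close>

text \<open>Integrating out the middle time is a beta convolution and leaves a power of r - s alone,
  with total exponent \<open>h\<close>; the triangle integral finishes.\<close>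

lemma nn_integral_ordered_product:
  assumes \<alpha>: "-1 < \<alpha>" and \<beta>: "-1 < \<beta>" and h: "h = \<alpha> + \<beta> + \<delta> + 1" "-1 < h"
  shows "(\<integral>\<^sup>+s. \<integral>\<^sup>+t. \<integral>\<^sup>+r. ennreal (pos_powr (r - s) \<delta> * pos_powr (t - s) \<alpha> * pos_powr (r - t) \<beta>) *
      (indicator {0..1} s * indicator {0..1} t * indicator {0..1} r) \<partial>lborel \<partial>lborel \<partial>lborel) =
    ennreal (Beta (\<alpha> + 1) (\<beta> + 1) * (1 / ((h + 1) * (h + 2))))"
proof -
  have B: "0 \<le> Beta (\<alpha> + 1) (\<beta> + 1)" using \<alpha> \<beta> by (simp add: Beta_def)
  \<comment> \<open>Where the powers do not vanish, t lies between s and r, so its cutoff follows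
    from theirs and the convolution can run over the whole line.\<close>
  have t: "ennreal (pos_powr (r - s) \<delta> * pos_powr (t - s) \<alpha> * pos_powr (r - t) \<beta>) *
      (indicator {0..1} s * indicator {0..1} t * indicator {0..1} r) =
    (ennreal (pos_powr (r - s) \<delta>) * (indicator {0..1} s * indicator {0..1} r)) * ennreal (pos_powr (t - s) \<alpha> * pos_powr (r - t) \<beta>)" for s t r :: real
  proof (cases "s < t \<and> t < r")
    case True
    then show ?thesis by (auto simp: indicator_def mult.assoc ennreal_mult)
  qed (auto simp: pos_powr_def)
  have "(\<integral>\<^sup>+s. \<integral>\<^sup>+t. \<integral>\<^sup>+r. ennreal (pos_powr (r - s) \<delta> * pos_powr (t - s) \<alpha> * pos_powr (r - t) \<beta>) *
      (indicator {0..1} s * indicator {0..1} t * indicator {0..1} r) \<partial>lborel \<partial>lborel \<partial>lborel) =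
    (\<integral>\<^sup>+s. \<integral>\<^sup>+r. \<integral>\<^sup>+t. (ennreal (pos_powr (r - s) \<delta>) * (indicator {0..1} s * indicator {0..1} r)) * ennreal (pos_powr (t - s) \<alpha> * pos_powr (r - t) \<beta>) \<partial>lborel \<partial>lborel \<partial>lborel)"
    unfolding t by (intro nn_integral_cong lborel_pair.Fubini'[symmetric]) measurable
  also have "\<dots> = (\<integral>\<^sup>+s. \<integral>\<^sup>+r. (ennreal (pos_powr (r - s) \<delta>) * (indicator {0..1} s * indicator {0..1} r)) *
      ennreal (Beta (\<alpha> + 1) (\<beta> + 1) * pos_powr (r - s) (\<alpha> + \<beta> + 1)) \<partial>lborel \<partial>lborel)"
  proof (intro nn_integral_cong)
    fix s r :: real
    have "(\<integral>\<^sup>+t. ennreal (pos_powr (t - s) \<alpha> * pos_powr (r - t) \<beta>) \<partial>lborel) = ennreal (Beta (\<alpha> + 1) (\<beta> + 1) * pos_powr (r - s) (\<alpha> + \<beta> + 1))"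
      using nn_integral_pos_powr_convolution[of "\<alpha> + 1" "\<beta> + 1" s r] \<alpha> \<beta> by (simp add: add_ac)
    then show "(\<integral>\<^sup>+t. (ennreal (pos_powr (r - s) \<delta>) * (indicator {0..1} s * indicator {0..1} r)) * ennreal (pos_powr (t - s) \<alpha> * pos_powr (r - t) \<beta>) \<partial>lborel) =
      (ennreal (pos_powr (r - s) \<delta>) * (indicator {0..1} s * indicator {0..1} r)) * ennreal (Beta (\<alpha> + 1) (\<beta> + 1) * pos_powr (r - s) (\<alpha> + \<beta> + 1))"
      by (subst nn_integral_cmult) auto
  qed
  also have "\<dots> = (\<integral>\<^sup>+s. \<integral>\<^sup>+r. ennreal (Beta (\<alpha> + 1) (\<beta> + 1)) * (ennreal (pos_powr (r - s) h) * indicator {0..1} s * indicator {0..1} r) \<partial>lborel \<partial>lborel)"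
  proof (intro nn_integral_cong)
    fix s r :: real
    have "pos_powr (r - s) h = pos_powr (r - s) \<delta> * pos_powr (r - s) (\<alpha> + \<beta> + 1)"
      unfolding pos_powr_add h(1) by (simp add: add_ac)
    then show "(ennreal (pos_powr (r - s) \<delta>) * (indicator {0..1} s * indicator {0..1} r)) * ennreal (Beta (\<alpha> + 1) (\<beta> + 1) * pos_powr (r - s) (\<alpha> + \<beta> + 1)) =
      ennreal (Beta (\<alpha> + 1) (\<beta> + 1)) * (ennreal (pos_powr (r - s) h) * indicator {0..1} s * indicator {0..1} r)"
      using B by (simp add: ennreal_mult mult_ac)
  qed
  also have "\<dots> = ennreal (Beta (\<alpha> + 1) (\<beta> + 1)) * ennreal (1 / ((h + 1) * (h + 2)))"
    unfolding nn_integral_triangle_pos_powr[OF h(2), symmetric] by (simp add: nn_integral_cmult)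
  also have "\<dots> = ennreal (Beta (\<alpha> + 1) (\<beta> + 1) * (1 / ((h + 1) * (h + 2))))"
    using B h(2) by (intro ennreal_mult[symmetric]) auto
  finally show ?thesis .
qed

definition cov2_coeff :: "(nat \<Rightarrow> real) \<Rightarrow> nat \<Rightarrow> nat \<Rightarrow> real" where
  "cov2_coeff \<gamma> i j = Beta (\<gamma> i + 1) (- \<gamma> i - \<gamma> j - 1) * Beta (\<gamma> (3 - i) + 1) (- \<gamma> (3 - i) - \<gamma> (3 - j) - 1)"

definition cov3_coeff :: "(nat \<Rightarrow> real) \<Rightarrow> nat \<Rightarrow> nat \<Rightarrow> nat \<Rightarrow> real" where
  "cov3_coeff \<gamma> i j k = Beta (\<gamma> i + 1) (- \<gamma> i - \<gamma> (3 - k) - 1)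
           * Beta (\<gamma> (3 - i) + 1) (- \<gamma> (3 - i) - \<gamma> j - 1)
           * Beta (\<gamma> (3 - j) + 1) (- \<gamma> (3 - j) - \<gamma> k - 1)"

context
  fixes \<gamma> :: "nat \<Rightarrow> real"
  assumes \<gamma>1: "-1 < \<gamma> 1" "\<gamma> 1 < -1/2" and \<gamma>2: "-1 < \<gamma> 2" "\<gamma> 2 < -1/2" and \<gamma>12: "\<gamma> 1 + \<gamma> 2 > -3/2"
begin

lemma \<gamma>_bounds: "i \<in> {1, 2} \<Longrightarrow> -1 < \<gamma> i" "i \<in> {1, 2} \<Longrightarrow> \<gamma> i < -1/2"
  using \<gamma>1 \<gamma>2 by auto

lemma \<gamma>_bounds': "i \<in> {1, 2} \<Longrightarrow> -1 < \<gamma> (3 - i)" "i \<in> {1, 2} \<Longrightarrow> \<gamma> (3 - i) < -1/2"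
  using \<gamma>1 \<gamma>2 by auto

text \<open>Every index occurs together with its complement, so the total exponent of a product of
  covariances is the same for all index tuples.\<close>

lemma \<gamma>_complement: "i \<in> {1, 2} \<Longrightarrow> \<gamma> (3 - i) = \<gamma> 1 + \<gamma> 2 - \<gamma> i"
  by auto

lemma Beta_\<gamma>_nonneg:
  fixes a b :: real
  assumes "-1 < a" "a < -1/2" "-1 < b" "b < -1/2"
  shows "0 \<le> Beta (a + 1) (- a - b - 1)"
  using assms by (simp add: Beta_def)

lemma cov2_less:
  assumes st: "s < t"
  shows "cov2 \<gamma> (s, t) = ennreal (\<Sum>i\<in>{1, 2}. \<Sum>j\<in>{1, 2}. cov2_coeff \<gamma> i j) *
    (ennreal (pos_powr (t - s) (2 * (\<gamma> 1 + \<gamma> 2) + 2)) * indicator {0..1} s * indicator {0..1} t)"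
proof -
  let ?X = "ennreal (pos_powr (t - s) (2 * (\<gamma> 1 + \<gamma> 2) + 2)) * indicator {0..1} s * indicator {0..1} t"
  have prod: "factor_cov (\<gamma> i) (\<gamma> j) s t * factor_cov (\<gamma> (3 - i)) (\<gamma> (3 - j)) s t = ennreal (cov2_coeff \<gamma> i j) * ?X"
    and nonneg: "0 \<le> cov2_coeff \<gamma> i j"
    if ij: "i \<in> {1, 2}" "j \<in> {1, 2}" for i j
  proof -
    note b = \<gamma>_bounds[OF ij(1)] \<gamma>_bounds[OF ij(2)] \<gamma>_bounds'[OF ij(1)] \<gamma>_bounds'[OF ij(2)]
    have B: "0 \<le> Beta (\<gamma> i + 1) (- \<gamma> i - \<gamma> j - 1)" "0 \<le> Beta (\<gamma> (3 - i) + 1) (- \<gamma> (3 - i) - \<gamma> (3 - j) - 1)"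
      using b by (auto intro: Beta_\<gamma>_nonneg)
    then show "0 \<le> cov2_coeff \<gamma> i j" by (simp add: cov2_coeff_def)
    have e: "2 * (\<gamma> 1 + \<gamma> 2) + 2 = (\<gamma> i + \<gamma> j + 1) + (\<gamma> (3 - i) + \<gamma> (3 - j) + 1)"
      unfolding \<gamma>_complement[OF ij(1)] \<gamma>_complement[OF ij(2)] by simp
    have I: "indicator {0..1} x * (indicator {0..1} x * y) = indicator {0..1} x * (y :: ennreal)" for x :: real and y
      by (simp add: indicator_def)
    have 1: "factor_cov (\<gamma> i) (\<gamma> j) s t = ennreal (Beta (\<gamma> i + 1) (- \<gamma> i - \<gamma> j - 1) * pos_powr (t - s) (\<gamma> i + \<gamma> j + 1)) * (indicator {0..1} s * indicator {0..1} t)"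
      using b by (intro factor_cov_less st) auto
    have 2: "factor_cov (\<gamma> (3 - i)) (\<gamma> (3 - j)) s t = ennreal (Beta (\<gamma> (3 - i) + 1) (- \<gamma> (3 - i) - \<gamma> (3 - j) - 1) * pos_powr (t - s) (\<gamma> (3 - i) + \<gamma> (3 - j) + 1)) * (indicator {0..1} s * indicator {0..1} t)"
      using b by (intro factor_cov_less st) auto
    show "factor_cov (\<gamma> i) (\<gamma> j) s t * factor_cov (\<gamma> (3 - i)) (\<gamma> (3 - j)) s t = ennreal (cov2_coeff \<gamma> i j) * ?X"
      unfolding 1 2 cov2_coeff_def e pos_powr_add[symmetric] using B
      by (simp add: ennreal_mult indicator_def mult_ac)
  qed
  have "cov2 \<gamma> (s, t) = (\<Sum>i\<in>{1, 2}. \<Sum>j\<in>{1, 2}. ennreal (cov2_coeff \<gamma> i j) * ?X)"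
    unfolding cov2_def prod.case by (intro sum.cong refl prod)
  also have "\<dots> = (\<Sum>i\<in>{1, 2}. \<Sum>j\<in>{1, 2}. ennreal (cov2_coeff \<gamma> i j)) * ?X"
    by (simp only: sum_distrib_right)
  also have "(\<Sum>i\<in>{1, 2}. \<Sum>j\<in>{1, 2}. ennreal (cov2_coeff \<gamma> i j)) = ennreal (\<Sum>i\<in>{1, 2}. \<Sum>j\<in>{1, 2}. cov2_coeff \<gamma> i j)"
    using nonneg by (simp add: sum_nonneg)
  finally show ?thesis .
qed

text \<open>The order of the two times contributes a factor 2, the coefficient sum another 2, and
  \<open>h + 2 = 2 * (\<gamma> 1 + \<gamma> 2 + 2)\<close> cancels one of them.\<close>

lemma nn_integral_cov2:
  "(\<integral>\<^sup>+s. \<integral>\<^sup>+t. cov2 \<gamma> (s, t) \<partial>lborel \<partial>lborel) =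
    ennreal (2 / ((\<gamma> 1 + \<gamma> 2 + 2) * (2 * (\<gamma> 1 + \<gamma> 2) + 3)) *
      (Beta (\<gamma> 1 + 1) (- \<gamma> 1 - \<gamma> 2 - 1) * Beta (\<gamma> 2 + 1) (- \<gamma> 1 - \<gamma> 2 - 1)
         + Beta (\<gamma> 1 + 1) (- 2 * \<gamma> 1 - 1) * Beta (\<gamma> 2 + 1) (- 2 * \<gamma> 2 - 1)))"
proof -
  define h where "h = 2 * (\<gamma> 1 + \<gamma> 2) + 2"
  define T where "T = Beta (\<gamma> 1 + 1) (- \<gamma> 1 - \<gamma> 2 - 1) * Beta (\<gamma> 2 + 1) (- \<gamma> 1 - \<gamma> 2 - 1)
         + Beta (\<gamma> 1 + 1) (- 2 * \<gamma> 1 - 1) * Beta (\<gamma> 2 + 1) (- 2 * \<gamma> 2 - 1)"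
  \<comment> \<open>The two pairs with different indices give the first product in T, the two pairs
    with equal indices the second.\<close>
  have S: "(\<Sum>i\<in>{1, 2}. \<Sum>j\<in>{1, 2}. cov2_coeff \<gamma> i j) = 2 * T"
  proof -
    have e: "- \<gamma> 1 - \<gamma> 1 - 1 = - 2 * \<gamma> 1 - 1" "- \<gamma> 2 - \<gamma> 2 - 1 = - 2 * \<gamma> 2 - 1" "- \<gamma> 2 - \<gamma> 1 - 1 = - \<gamma> 1 - \<gamma> 2 - 1"
      by simp_all
    have s: "(\<Sum>i\<in>{1, 2}. f i) = f 1 + f 2" for f :: "nat \<Rightarrow> real" by simp
    have n: "3 - 1 = (2::nat)" "3 - 2 = (1::nat)" by simp_all
    show ?thesis unfolding s cov2_coeff_def n e T_def by (simp add: mult.commute)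
  qed
  have T0: "0 \<le> T"
    using \<gamma>1 \<gamma>2 by (auto simp: T_def Beta_def intro!: add_nonneg_nonneg mult_nonneg_nonneg)
  have h: "-1 < h" using \<gamma>12 by (simp add: h_def)
  have "(\<integral>\<^sup>+s. \<integral>\<^sup>+t. cov2 \<gamma> (s, t) \<partial>lborel \<partial>lborel) = 2 * (\<integral>\<^sup>+s. \<integral>\<^sup>+t. cov2 \<gamma> (s, t) * (if s < t then 1 else 0) \<partial>lborel \<partial>lborel)"
    by (rule nn_integral_symmetric2) (auto intro: cov2_sym)
  also have "(\<integral>\<^sup>+s. \<integral>\<^sup>+t. cov2 \<gamma> (s, t) * (if s < t then 1 else 0) \<partial>lborel \<partial>lborel) =
    (\<integral>\<^sup>+s. \<integral>\<^sup>+t. ennreal (2 * T) * (ennreal (pos_powr (t - s) h) * indicator {0..1} s * indicator {0..1} t) \<partial>lborel \<partial>lborel)"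
  proof (intro nn_integral_cong)
    fix s t :: real
    show "cov2 \<gamma> (s, t) * (if s < t then 1 else 0) = ennreal (2 * T) * (ennreal (pos_powr (t - s) h) * indicator {0..1} s * indicator {0..1} t)"
      using cov2_less[of s t] by (cases "s < t") (simp_all only: S h_def[symmetric] if_True if_False mult_1_right mult_zero_right, simp add: pos_powr_eq_0)
  qed
  also have "\<dots> = ennreal (2 * T) * ennreal (1 / ((h + 1) * (h + 2)))"
    unfolding nn_integral_triangle_pos_powr[OF h, symmetric] by (simp add: nn_integral_cmult)
  also have "2 * \<dots> = ennreal (2 * (2 * T * (1 / ((h + 1) * (h + 2)))))"
  proof -
    have "ennreal (2 * T) * ennreal (1 / ((h + 1) * (h + 2))) = ennreal (2 * T * (1 / ((h + 1) * (h + 2))))"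
      using T0 h by (intro ennreal_mult[symmetric]) auto
    moreover have "2 * ennreal x = ennreal (2 * x)" for x by (subst ennreal_mult') simp_all
    ultimately show ?thesis by (simp only:)
  qed
  also have "2 * (2 * T * (1 / ((h + 1) * (h + 2)))) = 2 / ((\<gamma> 1 + \<gamma> 2 + 2) * (2 * (\<gamma> 1 + \<gamma> 2) + 3)) * T"
  proof -
    have e: "h + 2 = 2 * (\<gamma> 1 + \<gamma> 2 + 2)" "h + 1 = 2 * (\<gamma> 1 + \<gamma> 2) + 3" by (simp_all add: h_def)
    have "2 * (2 * T * (1 / (x * (2 * y)))) = 2 / (y * x) * T" for x y :: real
      by (cases "x = 0"; cases "y = 0") (auto simp: field_simps)
    then show ?thesis unfolding e .
  qed
  finally show ?thesis by (simp only: T_def)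
qed

lemma cov3_coeff_nonneg:
  "i \<in> {1, 2} \<Longrightarrow> j \<in> {1, 2} \<Longrightarrow> k \<in> {1, 2} \<Longrightarrow> 0 \<le> cov3_coeff \<gamma> i j k"
  unfolding cov3_coeff_def using \<gamma>_bounds \<gamma>_bounds' by (intro mult_nonneg_nonneg Beta_\<gamma>_nonneg) auto

text \<open>For increasing times every covariance in \<open>cov3\<close> has its earlier time first.
  For any other order one of the powers of t - s and r - t is 0, so the right-hand side carries the
  ordering by itself.\<close>

lemma cov3_increasing:
  "cov3 \<gamma> (s, t, r) * increasing3 (s, t, r) = (\<Sum>i\<in>{1, 2}. \<Sum>j\<in>{1, 2}. \<Sum>k\<in>{1, 2}. ennreal (cov3_coeff \<gamma> i j k) *
    (ennreal (pos_powr (r - s) (\<gamma> i + \<gamma> (3 - k) + 1) * pos_powr (t - s) (\<gamma> (3 - i) + \<gamma> j + 1) * pos_powr (r - t) (\<gamma> (3 - j) + \<gamma> k + 1)) *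
      (indicator {0..1} s * indicator {0..1} t * indicator {0..1} r)))"
proof (cases "s < t \<and> t < r")
  case False
  then have "increasing3 (s, t, r) = 0" by (auto simp: increasing3_def)
  moreover have "pos_powr (t - s) a * pos_powr (r - t) b = 0" for a b using False by (auto simp: pos_powr_def)
  ultimately show ?thesis by (simp add: mult.assoc)
next
  case True
  then have o: "s < t" "t < r" "s < r" "increasing3 (s, t, r) = 1" by (auto simp: increasing3_def)
  have "factor_cov (\<gamma> i) (\<gamma> (3 - k)) s r * factor_cov (\<gamma> (3 - i)) (\<gamma> j) s t * factor_cov (\<gamma> (3 - j)) (\<gamma> k) t r =
    ennreal (cov3_coeff \<gamma> i j k) *
    (ennreal (pos_powr (r - s) (\<gamma> i + \<gamma> (3 - k) + 1) * pos_powr (t - s) (\<gamma> (3 - i) + \<gamma> j + 1) * pos_powr (r - t) (\<gamma> (3 - j) + \<gamma> k + 1)) *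
      (indicator {0..1} s * indicator {0..1} t * indicator {0..1} r))"
    if ijk: "i \<in> {1, 2}" "j \<in> {1, 2}" "k \<in> {1, 2}" for i j k
  proof -
    note b = \<gamma>_bounds[OF ijk(1)] \<gamma>_bounds[OF ijk(2)] \<gamma>_bounds[OF ijk(3)] \<gamma>_bounds'[OF ijk(1)] \<gamma>_bounds'[OF ijk(2)] \<gamma>_bounds'[OF ijk(3)]
    have B: "0 \<le> Beta (\<gamma> i + 1) (- \<gamma> i - \<gamma> (3 - k) - 1)" "0 \<le> Beta (\<gamma> (3 - i) + 1) (- \<gamma> (3 - i) - \<gamma> j - 1)"
      "0 \<le> Beta (\<gamma> (3 - j) + 1) (- \<gamma> (3 - j) - \<gamma> k - 1)"
      using b by (auto intro: Beta_\<gamma>_nonneg)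
    have 1: "factor_cov (\<gamma> i) (\<gamma> (3 - k)) s r = ennreal (Beta (\<gamma> i + 1) (- \<gamma> i - \<gamma> (3 - k) - 1) * pos_powr (r - s) (\<gamma> i + \<gamma> (3 - k) + 1)) * (indicator {0..1} s * indicator {0..1} r)"
      using b by (intro factor_cov_less o) auto
    have 2: "factor_cov (\<gamma> (3 - i)) (\<gamma> j) s t = ennreal (Beta (\<gamma> (3 - i) + 1) (- \<gamma> (3 - i) - \<gamma> j - 1) * pos_powr (t - s) (\<gamma> (3 - i) + \<gamma> j + 1)) * (indicator {0..1} s * indicator {0..1} t)"
      using b by (intro factor_cov_less o) auto
    have 3: "factor_cov (\<gamma> (3 - j)) (\<gamma> k) t r = ennreal (Beta (\<gamma> (3 - j) + 1) (- \<gamma> (3 - j) - \<gamma> k - 1) * pos_powr (r - t) (\<gamma> (3 - j) + \<gamma> k + 1)) * (indicator {0..1} t * indicator {0..1} r)"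
      using b by (intro factor_cov_less o) auto
    show ?thesis
      unfolding 1 2 3 cov3_coeff_def using B by (simp add: ennreal_mult indicator_def mult_ac)
  qed
  then show ?thesis unfolding o(4) cov3_def prod.case mult_1_right by (intro sum.cong refl)
qed

text \<open>The six orderings of the times give the factor 6, of which
  \<open>h + 2 = 3 * (\<gamma> 1 + \<gamma> 2 + 2)\<close> cancels 3. The fourth beta factor comes
  from integrating out the middle time.\<close>

lemma nn_integral_cov3:
  "(\<integral>\<^sup>+s. \<integral>\<^sup>+t. \<integral>\<^sup>+r. cov3 \<gamma> (s, t, r) \<partial>lborel \<partial>lborel \<partial>lborel) =
    ennreal (2 / ((\<gamma> 1 + \<gamma> 2 + 2) * (3 * (\<gamma> 1 + \<gamma> 2) + 5)) *
      (\<Sum>(i, j, k) \<in> {1, 2} \<times> {1, 2} \<times> {1, 2}. cov3_coeff \<gamma> i j k * Beta (\<gamma> (3 - i) + \<gamma> j + 2) (\<gamma> (3 - j) + \<gamma> k + 2)))"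
proof -
  define h where "h = 3 * (\<gamma> 1 + \<gamma> 2) + 4"
  define N where "N = 1 / ((h + 1) * (h + 2))"
  have h: "-1 < h" using \<gamma>12 by (simp add: h_def)
  then have N0: "0 \<le> N" by (simp add: N_def)
  define b where "b i j k = Beta (\<gamma> (3 - i) + \<gamma> j + 2) (\<gamma> (3 - j) + \<gamma> k + 2)" for i j k
  let ?G = "\<lambda>i j k s t r. ennreal (pos_powr (r - s) (\<gamma> i + \<gamma> (3 - k) + 1) * pos_powr (t - s) (\<gamma> (3 - i) + \<gamma> j + 1) * pos_powr (r - t) (\<gamma> (3 - j) + \<gamma> k + 1)) *
      (indicator {0..1} s * indicator {0..1} t * indicator {0..1} r)"
  have G: "(\<integral>\<^sup>+s. \<integral>\<^sup>+t. \<integral>\<^sup>+r. ?G i j k s t r \<partial>lborel \<partial>lborel \<partial>lborel) = ennreal (b i j k * N)"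
    and b0: "0 \<le> b i j k" if ijk: "i \<in> {1, 2}" "j \<in> {1, 2}" "k \<in> {1, 2}" for i j k
  proof -
    note bd = \<gamma>_bounds[OF ijk(1)] \<gamma>_bounds[OF ijk(2)] \<gamma>_bounds[OF ijk(3)] \<gamma>_bounds'[OF ijk(1)] \<gamma>_bounds'[OF ijk(2)] \<gamma>_bounds'[OF ijk(3)]
    have "h = (\<gamma> (3 - i) + \<gamma> j + 1) + (\<gamma> (3 - j) + \<gamma> k + 1) + (\<gamma> i + \<gamma> (3 - k) + 1) + 1"
      unfolding h_def \<gamma>_complement[OF ijk(1)] \<gamma>_complement[OF ijk(2)] \<gamma>_complement[OF ijk(3)] by simp
    from nn_integral_ordered_product[OF _ _ this h]
    show "(\<integral>\<^sup>+s. \<integral>\<^sup>+t. \<integral>\<^sup>+r. ?G i j k s t r \<partial>lborel \<partial>lborel \<partial>lborel) = ennreal (b i j k * N)"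
      using bd by (simp add: b_def N_def add.assoc)
    show "0 \<le> b i j k" unfolding b_def using bd by (simp add: Beta_def)
  qed
  have "(\<integral>\<^sup>+s. \<integral>\<^sup>+t. \<integral>\<^sup>+r. cov3 \<gamma> (s, t, r) \<partial>lborel \<partial>lborel \<partial>lborel) =
    6 * (\<integral>\<^sup>+s. \<integral>\<^sup>+t. \<integral>\<^sup>+r. cov3 \<gamma> (s, t, r) * increasing3 (s, t, r) \<partial>lborel \<partial>lborel \<partial>lborel)"
    by (rule nn_integral_symmetric3) (auto intro: cov3_sym12 cov3_sym23)
  also have "(\<integral>\<^sup>+s. \<integral>\<^sup>+t. \<integral>\<^sup>+r. cov3 \<gamma> (s, t, r) * increasing3 (s, t, r) \<partial>lborel \<partial>lborel \<partial>lborel) =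
    (\<Sum>i\<in>{1, 2}. \<Sum>j\<in>{1, 2}. \<Sum>k\<in>{1, 2}. ennreal (cov3_coeff \<gamma> i j k) * (\<integral>\<^sup>+s. \<integral>\<^sup>+t. \<integral>\<^sup>+r. ?G i j k s t r \<partial>lborel \<partial>lborel \<partial>lborel))"
    unfolding cov3_increasing by (simp add: nn_integral_add nn_integral_cmult)
  also have "\<dots> = (\<Sum>i\<in>{1, 2}. \<Sum>j\<in>{1, 2}. \<Sum>k\<in>{1, 2}. ennreal (cov3_coeff \<gamma> i j k * (b i j k * N)))"
    using cov3_coeff_nonneg b0 N0 by (intro sum.cong refl) (simp only: G, subst ennreal_mult, auto)
  also have "\<dots> = ennreal (\<Sum>i\<in>{1, 2}. \<Sum>j\<in>{1, 2}. \<Sum>k\<in>{1, 2}. cov3_coeff \<gamma> i j k * (b i j k * N))"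
  proof -
    have "0 \<le> cov3_coeff \<gamma> i j k * (b i j k * N)" if "i \<in> {1, 2}" "j \<in> {1, 2}" "k \<in> {1, 2}" for i j k
      using that cov3_coeff_nonneg b0 N0 by simp
    note nn = this
    have "(\<Sum>i\<in>{1, 2}. \<Sum>j\<in>{1, 2}. \<Sum>k\<in>{1, 2}. ennreal (cov3_coeff \<gamma> i j k * (b i j k * N))) =
      (\<Sum>i\<in>{1, 2}. \<Sum>j\<in>{1, 2}. ennreal (\<Sum>k\<in>{1, 2}. cov3_coeff \<gamma> i j k * (b i j k * N)))"
      by (intro sum.cong refl sum_ennreal nn)
    also have "\<dots> = (\<Sum>i\<in>{1, 2}. ennreal (\<Sum>j\<in>{1, 2}. \<Sum>k\<in>{1, 2}. cov3_coeff \<gamma> i j k * (b i j k * N)))"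
      by (intro sum.cong refl sum_ennreal sum_nonneg nn)
    also have "\<dots> = ennreal (\<Sum>i\<in>{1, 2}. \<Sum>j\<in>{1, 2}. \<Sum>k\<in>{1, 2}. cov3_coeff \<gamma> i j k * (b i j k * N))"
      by (intro sum_ennreal sum_nonneg nn)
    finally show ?thesis .
  qed
  also have "6 * \<dots> = ennreal (6 * (\<Sum>i\<in>{1, 2}. \<Sum>j\<in>{1, 2}. \<Sum>k\<in>{1, 2}. cov3_coeff \<gamma> i j k * (b i j k * N)))"
    by (subst ennreal_mult') simp_all
  also have "(\<Sum>i\<in>{1, 2}. \<Sum>j\<in>{1, 2}. \<Sum>k\<in>{1, 2}. cov3_coeff \<gamma> i j k * (b i j k * N)) =
      N * (\<Sum>(i, j, k) \<in> {1, 2} \<times> {1, 2} \<times> {1, 2}. cov3_coeff \<gamma> i j k * b i j k)"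
    by (simp only: sum.cartesian_product sum_distrib_left case_prod_unfold) (simp add: mult_ac)
  also have "6 * (N * (\<Sum>(i, j, k) \<in> {1, 2} \<times> {1, 2} \<times> {1, 2}. cov3_coeff \<gamma> i j k * b i j k)) =
    2 / ((\<gamma> 1 + \<gamma> 2 + 2) * (3 * (\<gamma> 1 + \<gamma> 2) + 5)) * (\<Sum>(i, j, k) \<in> {1, 2} \<times> {1, 2} \<times> {1, 2}. cov3_coeff \<gamma> i j k * b i j k)"
  proof -
    have e: "h + 2 = 3 * (\<gamma> 1 + \<gamma> 2 + 2)" "h + 1 = 3 * (\<gamma> 1 + \<gamma> 2) + 5" by (simp_all add: h_def)
    have "6 * (1 / (x * (3 * y))) = 2 / (y * x)" for x y :: real
      by (cases "x = 0"; cases "y = 0") (auto simp: field_simps)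
    then have "6 * N = 2 / ((\<gamma> 1 + \<gamma> 2 + 2) * (3 * (\<gamma> 1 + \<gamma> 2) + 5))"
      unfolding N_def e .
    then show ?thesis by (simp only: mult.assoc[symmetric])
  qed
  finally show ?thesis unfolding b_def .
qed

section \<open>Passage from the extended kernel to the real-valued one\<close>

lemma measurable_rosenblatt_kernel: "rosenblatt_kernel (\<gamma> 1) (\<gamma> 2) \<in> borel_measurable lborel2"
proof -
  have "rosenblatt_kernel (\<gamma> 1) (\<gamma> 2) = (\<lambda>p. enn2real (nn_kernel \<gamma> (fst p) (snd p)))"
    by (auto simp: fun_eq_iff rosenblatt_kernel_eq simp del: One_nat_def)
  then show ?thesis by simp
qed

text \<open>The square of the extended kernel has a finite integral by the explicit formula, so
  infinite values, as may occur on the diagonal, form a null set.\<close>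

lemma AE_nn_kernel_finite: "AE p in lborel2. nn_kernel \<gamma> (fst p) (snd p) < top"
proof -
  have "AE p in lborel2. (nn_kernel \<gamma> (fst p) (snd p))\<^sup>2 \<noteq> \<infinity>"
    by (rule nn_integral_PInf_AE) (simp_all add: nn_kernel_sq nn_integral_cov2)
  then show ?thesis
    by eventually_elim (auto simp: less_top power2_eq_square ennreal_mult_eq_top_iff)
qed

lemma ennreal_rosenblatt_kernel:
  "nn_kernel \<gamma> x y < top \<Longrightarrow> ennreal (rosenblatt_kernel (\<gamma> 1) (\<gamma> 2) (x, y)) = nn_kernel \<gamma> x y"
  by (simp add: rosenblatt_kernel_eq del: One_nat_def)

lemma nn_integral_rosenblatt_kernel_sq:
  "L2_sq lborel2 (\<lambda>p. rosenblatt_kernel (\<gamma> 1) (\<gamma> 2) p) = (\<integral>\<^sup>+s. \<integral>\<^sup>+t. cov2 \<gamma> (s, t) \<partial>lborel \<partial>lborel)"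
proof -
  have "L2_sq lborel2 (\<lambda>p. rosenblatt_kernel (\<gamma> 1) (\<gamma> 2) p) = (\<integral>\<^sup>+p. (nn_kernel \<gamma> (fst p) (snd p))\<^sup>2 \<partial>lborel2)"
    using AE_nn_kernel_finite
  proof (intro nn_integral_cong_AE, eventually_elim)
    fix p :: "real \<times> real" assume f: "nn_kernel \<gamma> (fst p) (snd p) < top"
    have "0 \<le> rosenblatt_kernel (\<gamma> 1) (\<gamma> 2) p" by (cases p) (simp add: rosenblatt_kernel_eq del: One_nat_def)
    then show "ennreal ((rosenblatt_kernel (\<gamma> 1) (\<gamma> 2) p)\<^sup>2) = (nn_kernel \<gamma> (fst p) (snd p))\<^sup>2"
      using ennreal_rosenblatt_kernel[OF f] by (simp add: ennreal_power[symmetric])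
  qed
  then show ?thesis by (simp add: nn_kernel_sq)
qed

lemma nn_integral_cyclic_product_rosenblatt_kernel:
  "(\<integral>\<^sup>+p. ennreal (cyclic_product (rosenblatt_kernel (\<gamma> 1) (\<gamma> 2)) p) \<partial>lborel3) =
    (\<integral>\<^sup>+s. \<integral>\<^sup>+t. \<integral>\<^sup>+r. cov3 \<gamma> (s, t, r) \<partial>lborel \<partial>lborel \<partial>lborel)"
proof -
  note [measurable] = measurable_rosenblatt_kernel
  \<comment> \<open>Iterated null sets are used so that the three factors can be replaced one
    variable at a time; the pair (z, x) is reached from (x, z) by symmetry of the kernel.\<close>
  have f: "AE x in lborel. AE y in lborel. nn_kernel \<gamma> x y < top"
    using lborel_pair.AE_pair[OF AE_nn_kernel_finite] by simp
  have "(\<integral>\<^sup>+p. ennreal (cyclic_product (rosenblatt_kernel (\<gamma> 1) (\<gamma> 2)) p) \<partial>lborel3) =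
    (\<integral>\<^sup>+x. \<integral>\<^sup>+y. \<integral>\<^sup>+z. ennreal (cyclic_product (rosenblatt_kernel (\<gamma> 1) (\<gamma> 2)) (x, y, z)) \<partial>lborel \<partial>lborel \<partial>lborel)"
    by (rule nn_integral_lborel_triple) measurable
  also have "\<dots> = (\<integral>\<^sup>+x. \<integral>\<^sup>+y. \<integral>\<^sup>+z. nn_kernel \<gamma> x y * nn_kernel \<gamma> y z * nn_kernel \<gamma> z x \<partial>lborel \<partial>lborel \<partial>lborel)"
    using f
  proof (intro nn_integral_cong_AE, eventually_elim)
    fix x assume x: "AE y in lborel. nn_kernel \<gamma> x y < top"
    show "(\<integral>\<^sup>+y. \<integral>\<^sup>+z. ennreal (cyclic_product (rosenblatt_kernel (\<gamma> 1) (\<gamma> 2)) (x, y, z)) \<partial>lborel \<partial>lborel) =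
      (\<integral>\<^sup>+y. \<integral>\<^sup>+z. nn_kernel \<gamma> x y * nn_kernel \<gamma> y z * nn_kernel \<gamma> z x \<partial>lborel \<partial>lborel)"
      using f x
    proof (intro nn_integral_cong_AE, eventually_elim)
      fix y assume y: "AE z in lborel. nn_kernel \<gamma> y z < top" "nn_kernel \<gamma> x y < top"
      show "(\<integral>\<^sup>+z. ennreal (cyclic_product (rosenblatt_kernel (\<gamma> 1) (\<gamma> 2)) (x, y, z)) \<partial>lborel) =
        (\<integral>\<^sup>+z. nn_kernel \<gamma> x y * nn_kernel \<gamma> y z * nn_kernel \<gamma> z x \<partial>lborel)"
        using x y(1)
      proof (intro nn_integral_cong_AE, eventually_elim)
        fix z assume z: "nn_kernel \<gamma> x z < top" "nn_kernel \<gamma> y z < top"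
        then have zx: "nn_kernel \<gamma> z x < top" by (simp add: nn_kernel_commute[of _ z x])
        have "ennreal (cyclic_product (rosenblatt_kernel (\<gamma> 1) (\<gamma> 2)) (x, y, z)) =
          ennreal (rosenblatt_kernel (\<gamma> 1) (\<gamma> 2) (x, y)) * ennreal (rosenblatt_kernel (\<gamma> 1) (\<gamma> 2) (y, z)) * ennreal (rosenblatt_kernel (\<gamma> 1) (\<gamma> 2) (z, x))"
          by (simp add: cyclic_product_def rosenblatt_kernel_eq ennreal_mult del: One_nat_def)
        then show "ennreal (cyclic_product (rosenblatt_kernel (\<gamma> 1) (\<gamma> 2)) (x, y, z)) = nn_kernel \<gamma> x y * nn_kernel \<gamma> y z * nn_kernel \<gamma> z x"
          by (simp only: ennreal_rosenblatt_kernel[OF y(2)] ennreal_rosenblatt_kernel[OF z(2)] ennreal_rosenblatt_kernel[OF zx])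
      qed
    qed
  qed
  finally show ?thesis by (simp add: nn_kernel_cyclic)
qed

end

theorem theorem2p1:
  fixes M :: "'a measure" and W :: "real set \<Rightarrow> 'a \<Rightarrow> real"
    and \<gamma> :: "nat \<Rightarrow> real" and A :: real and Z :: "'a \<Rightarrow> real"
  assumes "brownian_random_measure M W"
    and "\<gamma> 1 \<in> {-1 <..< -1/2}" and "\<gamma> 2 \<in> {-1 <..< -1/2}"
    and "\<gamma> 1 + \<gamma> 2 > -3/2"
    and "A \<noteq> 0"
    and "Z = rosenblatt_at_1 M W A (\<gamma> 1) (\<gamma> 2)"
  shows "has_bochner_integral M (\<lambda>\<omega>. (Z \<omega>) ^ 2)
      (A ^ 2 / ((\<gamma> 1 + \<gamma> 2 + 2) * (2 * (\<gamma> 1 + \<gamma> 2) + 3)) *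
        (Beta (\<gamma> 1 + 1) (- \<gamma> 1 - \<gamma> 2 - 1) * Beta (\<gamma> 2 + 1) (- \<gamma> 1 - \<gamma> 2 - 1)
         + Beta (\<gamma> 1 + 1) (- 2 * \<gamma> 1 - 1) * Beta (\<gamma> 2 + 1) (- 2 * \<gamma> 2 - 1)))
    \<and> has_bochner_integral M (\<lambda>\<omega>. (Z \<omega>) ^ 3)
      (2 * A ^ 3 / ((\<gamma> 1 + \<gamma> 2 + 2) * (3 * (\<gamma> 1 + \<gamma> 2) + 5)) *
        (\<Sum>(i, j, k) \<in> {1, 2} \<times> {1, 2} \<times> {1, 2}.
           Beta (\<gamma> i + 1) (- \<gamma> i - \<gamma> (3 - k) - 1)
           * Beta (\<gamma> (3 - i) + 1) (- \<gamma> (3 - i) - \<gamma> j - 1)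
           * Beta (\<gamma> (3 - j) + 1) (- \<gamma> (3 - j) - \<gamma> k - 1)
           * Beta (\<gamma> (3 - i) + \<gamma> j + 2) (\<gamma> (3 - j) + \<gamma> k + 2)))"
proof -
  interpret brownian_random_measure M W by fact
  have g: "-1 < \<gamma> 1" "\<gamma> 1 < -1/2" "-1 < \<gamma> 2" "\<gamma> 2 < -1/2" "\<gamma> 1 + \<gamma> 2 > -3/2"
    using assms by auto
  define T where "T = Beta (\<gamma> 1 + 1) (- \<gamma> 1 - \<gamma> 2 - 1) * Beta (\<gamma> 2 + 1) (- \<gamma> 1 - \<gamma> 2 - 1)
         + Beta (\<gamma> 1 + 1) (- 2 * \<gamma> 1 - 1) * Beta (\<gamma> 2 + 1) (- 2 * \<gamma> 2 - 1)"
  define S where "S = (\<Sum>(i, j, k) \<in> {1, 2} \<times> {1, 2} \<times> {1, 2}.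
           Beta (\<gamma> i + 1) (- \<gamma> i - \<gamma> (3 - k) - 1)
           * Beta (\<gamma> (3 - i) + 1) (- \<gamma> (3 - i) - \<gamma> j - 1)
           * Beta (\<gamma> (3 - j) + 1) (- \<gamma> (3 - j) - \<gamma> k - 1)
           * Beta (\<gamma> (3 - i) + \<gamma> j + 2) (\<gamma> (3 - j) + \<gamma> k + 2))"
  define V where "V = 2 / ((\<gamma> 1 + \<gamma> 2 + 2) * (2 * (\<gamma> 1 + \<gamma> 2) + 3)) * T"
  define U where "U = 2 / ((\<gamma> 1 + \<gamma> 2 + 2) * (3 * (\<gamma> 1 + \<gamma> 2) + 5)) * S"
  define K where "K = rosenblatt_kernel (\<gamma> 1) (\<gamma> 2)"
  have Km [measurable]: "K \<in> borel_measurable lborel2"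
    unfolding K_def by (rule measurable_rosenblatt_kernel[OF g])
  have K0: "0 \<le> K p" for p unfolding K_def by (cases p) (simp add: rosenblatt_kernel_eq del: One_nat_def)
  have Ksym: "K (x, y) = K (y, x)" for x y
    unfolding K_def rosenblatt_kernel_eq by (subst nn_kernel_commute) simp
  have T0: "0 \<le> T"
    using g by (auto simp: T_def Beta_def intro!: add_nonneg_nonneg mult_nonneg_nonneg)
  have V0: "0 \<le> V" unfolding V_def using g T0 by (intro mult_nonneg_nonneg divide_nonneg_nonneg) auto
  have S0: "0 \<le> S"
    unfolding S_def using g by (intro sum_nonneg) (auto simp: Beta_def intro!: mult_nonneg_nonneg)
  have U0: "0 \<le> U" unfolding U_def using g S0 by (intro mult_nonneg_nonneg divide_nonneg_nonneg) auto
  have KV: "L2_sq lborel2 K = ennreal V"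
    unfolding K_def nn_integral_rosenblatt_kernel_sq[OF g] nn_integral_cov2[OF g] V_def T_def ..
  have KU: "(\<integral>\<^sup>+p. ennreal (cyclic_product K p) \<partial>lborel3) = ennreal U"
    unfolding K_def nn_integral_cyclic_product_rosenblatt_kernel[OF g] nn_integral_cov3[OF g] U_def S_def cov3_coeff_def ..
  define I where "I = double_wiener_ito_integral M W K"
  \<comment> \<open>Existence is what makes the version chosen by \<open>SOME\<close> a genuine
    integral; it applies because the kernel is nonnegative with finite norm.\<close>
  have I: "has_double_wiener_ito_integral M W K I"
    unfolding I_def double_wiener_ito_integral_def
    by (rule someI_ex[where P="has_double_wiener_ito_integral M W K"], rule ex_double_wiener_ito_integral)
      (simp_all add: K0 KV)
  note mom = double_wiener_ito_integral_moments[OF I Ksym]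
  have iV: "(LINT p|lborel2. (K p)\<^sup>2) = V"
    using V0 by (subst integral_eq_nn_integral) (auto simp: KV)
  have iU: "(LINT p|lborel3. cyclic_product K p) = U"
  proof -
    have "0 \<le> cyclic_product K p" for p by (cases p) (simp add: cyclic_product_def K0)
    then show ?thesis using U0 by (subst integral_eq_nn_integral) (auto simp: KU)
  qed
  have Z: "Z \<omega> = A / 2 * I \<omega>" for \<omega>
    using assms(6) by (simp add: rosenblatt_at_1_def I_def K_def)
  have "has_bochner_integral M (\<lambda>\<omega>. (A / 2)\<^sup>2 * (I \<omega>)\<^sup>2) ((A / 2)\<^sup>2 * (2 * V))"
    using mom(2) unfolding iV by (rule has_bochner_integral_mult_right)
  moreover have "has_bochner_integral M (\<lambda>\<omega>. (A / 2) ^ 3 * I \<omega> ^ 3) ((A / 2) ^ 3 * (8 * U))"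
    using mom(3) unfolding iU by (rule has_bochner_integral_mult_right)
  \<comment> \<open>The 2 from the second moment and the 2 in \<open>V\<close> cancel the square of
    the prefactor 1/2; in the third moment the 8 cancels its cube, and the 2 in \<open>U\<close>
    survives.\<close>
  moreover have "(A / 2)\<^sup>2 * (2 * V) = A ^ 2 / ((\<gamma> 1 + \<gamma> 2 + 2) * (2 * (\<gamma> 1 + \<gamma> 2) + 3)) * T"
    by (simp add: V_def power_divide)
  moreover have "(A / 2) ^ 3 * (8 * U) = 2 * A ^ 3 / ((\<gamma> 1 + \<gamma> 2 + 2) * (3 * (\<gamma> 1 + \<gamma> 2) + 5)) * S"
    by (simp add: U_def power_divide)
  ultimately show ?thesis
    unfolding Z power_mult_distrib S_def[symmetric] T_def[symmetric] by simp
qed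

end
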